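(* Let $h,\tau>0$ and suppose that assumptions (B1)–(B5) and the well-posedness assumption (WP) listed in the context hold. Let $(E_h^0,H_h^0)\in ND_h\times DG_h$ be given and set $(E_h^n,H_h^n):=S_{h,\tau}^n(E_h^{n-1},H_h^{n-1})$ for all $n\in\mathbb N$. If $(E_h^m,H_h^m)\in\mathcal W_h$, then $\{\mathcal E_h^n(E_h^n,H_h^n)\}_{n=1}^\infty$ decays exponentially, i.e. there are constants $C,c>0$ with $\mathcal E_h^n(E_h^n,H_h^n)\le Ce^{-ct_n}$ for all $n\in\mathbb N$. In particular, this holds if $T_\mu=0$ and $(E_h^0,H_h^0)\in\mathcal W_h$.
   Context: **Domain and finite elements.** $\Omega\subset\mathbb R^3$ is a bounded Lipschitz polyhedral domain with outer unit normal $\nu$; $H(\mathrm{curl})=\{u\in L^2(\Omega)^3:\mathrm{curl}\,u\in L^2(\Omega)^3\}$; $\mathcal T_h$ is a (tetrahedral) triangulation of $\Omega$ from a quasi-uniform family. $ND_h=\{v_h\in H(\mathrm{curl}): v_h|_K(x)=a_K+b_K\times x,\ a_K,b_K\in\mathbb R^3,\ \forall K\in\mathcal T_h\}$, $DG_h=\{w_h\in L^2(\Omega)^3:w_h|_K\equiv a_K\in\mathbb R^3\ \forall K\in\mathcal T_h\}$. $Q_h$ is the $L^2$-orthogonal projection onto $DG_h$ (elementwise mean value), also applied componentwise to matrix-valued functions. $\mathbb N=\{1,2,\dots\}$, $\mathbb N_0=\mathbb N\cup\{0\}$, $t_n=n\tau$ for $n\in\mathbb N_0$. **Assumptions.** (B1)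 $\varepsilon\in W^{2,\infty}_{\rm loc}(0,\infty;L^\infty_{\rm sym}(\Omega)^{3\times3})\cap W^{1,\infty}(0,\infty;L^\infty_{\rm sym}(\Omega)^{3\times3})$ and $\mu\in W^{2,\infty}(0,\infty;L^\infty_{\rm sym}(\Omega)^{3\times3})$ (symmetric matrix-valued); $\mu(t)=\mu_\infty$ for all $t\ge T_\mu$, for some $T_\mu\ge0$ and a uniformly positive definite $\mu_\infty\in L^\infty_{\rm sym}(\Omega)^{3\times3}$. There are $\underline\varepsilon,\overline\varepsilon,\underline\mu,\overline\mu>0$ with $\underline\varepsilon|\xi|^2\le\xi^T\varepsilon(x,t)\xi\le\overline\varepsilon|\xi|^2$, $\underline\mu|\xi|^2\le\xi^T\mu(x,t)\xi\le\overline\mu|\xi|^2$ for a.e. $x\in\Omega$, all $\xi\in\mathbb R^3$, $t\in[0,\infty)$. (B2) $J_{tot}:\Omega\times\mathbb R^3\times\mathbb R^3\times[0,\infty)\to\mathbb R^3$ is measurable in the first variable, $J_{tot}(\cdot,0,0,0)\in L^2(\Omega)^3$, and there is $L_{tot}>0$ with $|J_{tot}(x,\xi,\eta,t)-J_{tot}(x,\xi',\eta',t')|\le L_{tot}(|\xi-\xi'|+|\eta-\eta'|+(1+|\xi|+|\xi'|+|\eta|+|\eta'|)|t-t'|)$ for a.e. $x$ and all $\xi,\xi',\eta,\eta'\in\mathbb R^3$, $t,t'\in[0,\infty)$. There is $T_J\ge0$ such that for all $t\ge T_J$, $\lambda\ge0$: $J_{tot}(x,\lambda\xi,\eta,t)=\lambda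 J_{tot}(x,\xi,\eta,t)$ and $J_{tot}(x,\xi,\eta,t)=J_{tot}(x,\xi,\eta',t)$ for a.e. $x\in\Omega$ and all $\xi,\eta,\eta'\in\mathbb R^3$. (B3) $b:\partial\Omega\times\mathbb R^3\to\mathbb R^3$ is measurable in the first variable, continuous and monotone in the second, $b(\cdot,0)=0$; there are $\underline b,\overline b,K>0$ with $b(x,\xi)\cdot\xi\ge\underline b|\xi|^2$ for a.e. $x\in\partial\Omega$ and all $|\xi|\ge K$, and $|b(x,\xi)|\le\overline b(|\xi|+1)$ for a.e. $x$ and all $\xi$; and $b(x,\lambda\xi)=\lambda b(x,\xi)$ for a.e. $x\in\partial\Omega$, all $\xi\in\mathbb R^3$, $\lambda\ge0$. (B4) $f\in H^1(0,\infty;L^2(\Omega)^3)$ and there is $T_f\ge0$ with $f(t)=0$ for all $t\ge T_f$. Put $J(x,\xi,\eta,t)=J_{tot}(x,\xi,\eta,t)+\partial_t\varepsilon(x,t)\xi$; for $t\ge T_J$ this does not depend on $\eta$ and one writes $J(x,\xi,t)$. (B5) There is $\gamma>0$ such that for all $v_h,\hat v_h\in ND_h$ and all $n\in\mathbb N$ with $t_n\ge T_J$: $$\tfrac12(\varepsilon(t_n)(v_h-\hat v_h),v_h-\hat v_h)_{L^2(\Omega)}+\tau(J(\cdot,v_h,t_n),v_h)_{L^2(\Omega)}-\tfrac12((\varepsilon(t_n)-\varepsilon(t_{n-1}))\hat v_h,\hat v_h)_{L^2(\Omega)}\ge\gamma\|v_h\|_{L^2(\Omega)}^2 .$$ **Solution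 operator.** Let $\mu_h^n=Q_h\mu(t_n)$, $\mu_{t,h}^n=Q_h\partial_t\mu(t_n)$, $f_h^n=Q_hf(t_n)$. For $n\in\mathbb N$ and $(v,w)\in ND_h\times DG_h$ consider: find $(E^{v,w},H^{v,w})\in ND_h\times DG_h$ with $$\int_\Omega\varepsilon(t_n)\tfrac{E^{v,w}-v}{\tau}\cdot v_h-H^{v,w}\cdot\mathrm{curl}\,v_h+J(\cdot,E^{v,w},H^{v,w},t_n)\cdot v_h\,dx+\int_{\partial\Omega}b(\cdot,\nu\times E^{v,w})\cdot(\nu\times v_h)\,dS=\int_\Omega f_h^n\cdot v_h\,dx\ \ \forall v_h\in ND_h,$$ $$\mu_h^n\tfrac{H^{v,w}-w}{\tau}+\mathrm{curl}\,E^{v,w}+\mu_{t,h}^nH^{v,w}=0 .$$ (WP) For every $n\in\mathbb N$ this problem has a unique solution for every $(v,w)$, so that $S_{h,\tau}^n:ND_h\times DG_h\to ND_h\times DG_h$, $(v,w)\mapsto(E^{v,w},H^{v,w})$, is well-defined. **Energy and spaces.** $\mathcal E_h^n(v,w)=\tfrac12\big((\varepsilon(t_n)v,v)_{L^2(\Omega)}+(\mu_h^nw,w)_{L^2(\Omega)}\big)$ for $n\in\mathbb N_0$. With $\mu_{h,\infty}=Q_h\mu_\infty$: $\mathcal W_h=ND_h\times\mu_{h,\infty}^{-1}\mathrm{curl}\,ND_h$. Finally $m=\min\{n\in\mathbb N_0:t_n\ge\max\{T_J,T_f,T_\mu\}\}$. *)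

theory Defs
  imports "HOL-Analysis.Analysis"
begin

type_synonym vec3 = "real^3"
type_synonym mat3 = "real^3^3"
type_synonym field = "real^3 \<Rightarrow> real^3"

text \<open>Elements of the Lebesgue spaces are represented by functions on the whole of \<^typ>\<open>vec3\<close>,
  of which only the values almost everywhere in \<open>\<Omega>\<close> are relevant.\<close>

definition L2 :: "vec3 set \<Rightarrow> (vec3 \<Rightarrow> 'b::euclidean_space) set" where
  "L2 \<Omega> = {g. g \<in> borel_measurable (lebesgue_on \<Omega>) \<and> integrable (lebesgue_on \<Omega>) (\<lambda>x. (norm (g x))\<^sup>2)}"

definition L2_inner :: "vec3 set \<Rightarrow> (vec3 \<Rightarrow> 'b::euclidean_space) \<Rightarrow> (vec3 \<Rightarrow> 'b) \<Rightarrow> real" where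
  "L2_inner \<Omega> u v = (LINT x|lebesgue_on \<Omega>. u x \<bullet> v x)"

definition L2_norm :: "vec3 set \<Rightarrow> (vec3 \<Rightarrow> 'b::euclidean_space) \<Rightarrow> real" where
  "L2_norm \<Omega> u = sqrt (LINT x|lebesgue_on \<Omega>. (norm (u x))\<^sup>2)"

definition Linf_sym :: "vec3 set \<Rightarrow> (vec3 \<Rightarrow> mat3) set" where
  "Linf_sym \<Omega> = {g. g \<in> borel_measurable (lebesgue_on \<Omega>)
      \<and> (\<exists>c. AE x in lebesgue_on \<Omega>. norm (g x) \<le> c)
      \<and> (AE x in lebesgue_on \<Omega>. transpose (g x) = g x)}"

definition Linf_norm :: "vec3 set \<Rightarrow> (vec3 \<Rightarrow> 'b::real_normed_vector) \<Rightarrow> real" where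
  "Linf_norm \<Omega> g = Inf {c. 0 \<le> c \<and> (AE x in lebesgue_on \<Omega>. norm (g x) \<le> c)}"

coinductive smooth :: "('a::euclidean_space \<Rightarrow> 'b::real_normed_vector) \<Rightarrow> bool" where
  "(\<And>x. f differentiable (at x)) \<Longrightarrow> (\<And>v. smooth (\<lambda>x. frechet_derivative f (at x) v)) \<Longrightarrow> smooth f"

definition test_functions :: "'a::euclidean_space set \<Rightarrow> ('a \<Rightarrow> 'b::real_normed_vector) set" where
  "test_functions U = {\<phi>. smooth \<phi> \<and> compact (closure {x. \<phi> x \<noteq> 0}) \<and> closure {x. \<phi> x \<noteq> 0} \<subseteq> U}"

text \<open>In the following, a Banach space of functions on \<open>\<Omega>\<close> is given by its set \<open>X\<close> of elements
  and its norm \<open>N\<close>. Strong measurability is meant in the sense of Bochner.\<close>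

definition strongly_measurable_on ::
  "real set \<Rightarrow> (vec3 \<Rightarrow> 'b::euclidean_space) set \<Rightarrow> ((vec3 \<Rightarrow> 'b) \<Rightarrow> real) \<Rightarrow> (real \<Rightarrow> vec3 \<Rightarrow> 'b) \<Rightarrow> bool" where
  "strongly_measurable_on I X N u \<longleftrightarrow>
     (AE t in lebesgue_on I. u t \<in> X) \<and>
     (\<exists>s :: nat \<Rightarrow> real \<Rightarrow> vec3 \<Rightarrow> 'b.
        (\<forall>k. range (s k) \<subseteq> X \<and> finite (range (s k)) \<and> (\<forall>g. {t. s k t = g} \<in> sets lebesgue)) \<and>
        (AE t in lebesgue_on I. (\<lambda>k. N (\<lambda>x. s k t x - u t x)) \<longlonglongrightarrow> 0))"

definition Linf_time ::
  "(vec3 \<Rightarrow> 'b::euclidean_space) set \<Rightarrow> ((vec3 \<Rightarrow> 'b) \<Rightarrow> real) \<Rightarrow> real set \<Rightarrow> (real \<Rightarrow> vec3 \<Rightarrow> 'b) set" where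
  "Linf_time X N I = {u. strongly_measurable_on I X N u \<and> (\<exists>C. AE t in lebesgue_on I. N (u t) \<le> C)}"

definition Linf_time_loc ::
  "(vec3 \<Rightarrow> 'b::euclidean_space) set \<Rightarrow> ((vec3 \<Rightarrow> 'b) \<Rightarrow> real) \<Rightarrow> (real \<Rightarrow> vec3 \<Rightarrow> 'b) set" where
  "Linf_time_loc X N = {u. \<forall>\<alpha> \<beta>. 0 < \<alpha> \<and> \<alpha> < \<beta> \<longrightarrow> u \<in> Linf_time X N {\<alpha><..<\<beta>}}"

definition L2_time ::
  "(vec3 \<Rightarrow> 'b::euclidean_space) set \<Rightarrow> ((vec3 \<Rightarrow> 'b) \<Rightarrow> real) \<Rightarrow> real set \<Rightarrow> (real \<Rightarrow> vec3 \<Rightarrow> 'b) set" where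
  "L2_time X N I = {u. strongly_measurable_on I X N u \<and> integrable (lebesgue_on I) (\<lambda>t. (N (u t))\<^sup>2)}"

definition time_continuous_on ::
  "real set \<Rightarrow> (vec3 \<Rightarrow> 'b::euclidean_space) set \<Rightarrow> ((vec3 \<Rightarrow> 'b) \<Rightarrow> real) \<Rightarrow> (real \<Rightarrow> vec3 \<Rightarrow> 'b) \<Rightarrow> bool" where
  "time_continuous_on I X N u \<longleftrightarrow>
     (\<forall>t\<in>I. u t \<in> X \<and> ((\<lambda>s. N (\<lambda>x. u s x - u t x)) \<longlongrightarrow> 0) (at t within I))"

text \<open>\<open>g\<close> is the weak derivative of \<open>u\<close> on \<open>(0,\<infinity>)\<close>. The defining identity of Bochner integrals
  \<open>\<integral> \<phi>' u = - \<integral> \<phi> g\<close> is tested with the functionals \<open>L2_inner \<Omega> _ \<psi>\<close>; these commute with Bochner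
  integrals and separate the points of \<open>L2 \<Omega>\<close>, hence also those of the smaller space of
  essentially bounded functions on the bounded set \<open>\<Omega>\<close>.\<close>

definition has_weak_time_deriv ::
  "vec3 set \<Rightarrow> (real \<Rightarrow> vec3 \<Rightarrow> 'b::euclidean_space) \<Rightarrow> (real \<Rightarrow> vec3 \<Rightarrow> 'b) \<Rightarrow> bool" where
  "has_weak_time_deriv \<Omega> u g \<longleftrightarrow>
     (\<forall>\<phi> \<in> test_functions {0<..}. \<forall>\<psi> \<in> L2 \<Omega>.
        (LINT t|lebesgue_on {0<..}. deriv \<phi> t * L2_inner \<Omega> (u t) \<psi>)
        = - (LINT t|lebesgue_on {0<..}. \<phi> t * L2_inner \<Omega> (g t) \<psi>))"

text \<open>The functions with weak derivatives up to order \<open>k\<close> in the Bochner space \<open>\<L>\<close>. In one (time)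
  dimension, the derivatives of order below \<open>k\<close> have continuous representatives;
  these are the ones that are meant whenever a function is evaluated at a point in time.\<close>

definition time_sobolev ::
  "vec3 set \<Rightarrow> (vec3 \<Rightarrow> 'b::euclidean_space) set \<Rightarrow> ((vec3 \<Rightarrow> 'b) \<Rightarrow> real) \<Rightarrow> nat \<Rightarrow>
     (real \<Rightarrow> vec3 \<Rightarrow> 'b) set \<Rightarrow> (real \<Rightarrow> vec3 \<Rightarrow> 'b) set" where
  "time_sobolev \<Omega> X N k \<L> = {u. \<exists>D. D 0 = u \<and> (\<forall>j\<le>k. D j \<in> \<L>) \<and>
      (\<forall>j<k. time_continuous_on {0<..} X N (D j) \<and> has_weak_time_deriv \<Omega> (D j) (D (Suc j)))}"

text \<open>The continuous representative of the weak time derivative; each value is determined up to a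
  null set in \<open>\<Omega>\<close>.\<close>

definition dt :: "vec3 set \<Rightarrow> (real \<Rightarrow> vec3 \<Rightarrow> mat3) \<Rightarrow> real \<Rightarrow> vec3 \<Rightarrow> mat3" where
  "dt \<Omega> u = (SOME g. time_continuous_on {0<..} (Linf_sym \<Omega>) (Linf_norm \<Omega>) g
                  \<and> has_weak_time_deriv \<Omega> u g)"

definition classical_curl :: "field \<Rightarrow> field" where
  "classical_curl \<phi> x = (\<Sum>i\<in>UNIV. cross3 (axis i 1) (frechet_derivative \<phi> (at x) (axis i 1)))"

definition has_weak_curl :: "vec3 set \<Rightarrow> field \<Rightarrow> field \<Rightarrow> bool" where
  "has_weak_curl \<Omega> u w \<longleftrightarrow>
     (\<forall>\<phi> \<in> test_functions \<Omega>. L2_inner \<Omega> u (classical_curl \<phi>) = L2_inner \<Omega> w \<phi>)"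

definition Hcurl :: "vec3 set \<Rightarrow> field set" where
  "Hcurl \<Omega> = {u \<in> L2 \<Omega>. \<exists>w \<in> L2 \<Omega>. has_weak_curl \<Omega> u w}"

definition curl :: "vec3 set \<Rightarrow> field \<Rightarrow> field" where
  "curl \<Omega> u = (SOME w. w \<in> L2 \<Omega> \<and> has_weak_curl \<Omega> u w)"

definition lipschitz_boundary :: "vec3 set \<Rightarrow> bool" where
  "lipschitz_boundary \<Omega> \<longleftrightarrow>
     (\<forall>p \<in> frontier \<Omega>. \<exists>U (A :: vec3 \<Rightarrow> vec3) (L :: real) (g :: real \<times> real \<Rightarrow> real).
        open U \<and> p \<in> U \<and> orthogonal_transformation A \<and> L-lipschitz_on UNIV g \<and>
        \<Omega> \<inter> U = {x \<in> U. g (A x $ 1, A x $ 2) < A x $ 3})"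

definition lipschitz_polyhedral_domain :: "vec3 set \<Rightarrow> bool" where
  "lipschitz_polyhedral_domain \<Omega> \<longleftrightarrow>
     open \<Omega> \<and> connected \<Omega> \<and> \<Omega> \<noteq> {} \<and> bounded \<Omega> \<and> lipschitz_boundary \<Omega> \<and>
     (\<exists>F. finite F \<and> (\<forall>P\<in>F. polytope P) \<and> closure \<Omega> = \<Union>F)"

text \<open>Two-dimensional Hausdorff measure, normalised to agree with the area on planes.\<close>

definition hausdorff2_pre :: "real \<Rightarrow> vec3 set \<Rightarrow> ennreal" where
  "hausdorff2_pre \<delta> A =
     (INF U \<in> {U :: nat \<Rightarrow> vec3 set. A \<subseteq> (\<Union>i. U i) \<and> (\<forall>i. bounded (U i) \<and> diameter (U i) \<le> \<delta>)}.
        \<Sum>i. ennreal (pi / 4 * (diameter (U i))\<^sup>2))"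

definition hausdorff2 :: "vec3 set \<Rightarrow> ennreal" where
  "hausdorff2 A = (SUP \<delta>\<in>{0<..}. hausdorff2_pre \<delta> A)"

text \<open>Being a metric outer measure, \<^const>\<open>hausdorff2\<close> is countably additive on Borel sets, so
  that \<^const>\<open>measure_of\<close> does yield the measure with these values.\<close>

definition surface_measure :: "vec3 set \<Rightarrow> vec3 measure" where
  "surface_measure \<Omega> =
     completion (measure_of (frontier \<Omega>) {B \<in> sets borel. B \<subseteq> frontier \<Omega>} hausdorff2)"

text \<open>For a polyhedral domain the following defines the outer unit normal everywhere on the
  boundary except on its edges, which are null sets of the surface measure.\<close>

definition outer_normal :: "vec3 set \<Rightarrow> field" where
  "outer_normal \<Omega> x =
     (SOME n. norm n = 1 \<and> (\<exists>r>0. \<Omega> \<inter> ball x r = {y \<in> ball x r. (y - x) \<bullet> n < 0}))"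

text \<open>Boundary values of a piecewise continuous function; for the finite element functions below
  the limit exists in the relative interior of every boundary facet.\<close>

definition boundary_trace :: "vec3 set \<Rightarrow> field \<Rightarrow> field" where
  "boundary_trace \<Omega> v x = Lim (at x within \<Omega>) v"

definition tangential_trace :: "vec3 set \<Rightarrow> field \<Rightarrow> field" where
  "tangential_trace \<Omega> v x = cross3 (outer_normal \<Omega> x) (boundary_trace \<Omega> v x)"

definition tetrahedral_mesh :: "vec3 set \<Rightarrow> vec3 set set \<Rightarrow> bool" where
  "tetrahedral_mesh \<Omega> \<T> \<longleftrightarrow> triangulation \<T> \<and> (\<forall>K\<in>\<T>. 3 simplex K) \<and> \<Union>\<T> = closure \<Omega>"

definition quasi_uniform_family :: "vec3 set \<Rightarrow> real set \<Rightarrow> (real \<Rightarrow> vec3 set set) \<Rightarrow> bool" where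
  "quasi_uniform_family \<Omega> M \<T> \<longleftrightarrow>
     M \<subseteq> {0<..} \<and> (\<forall>h\<in>M. tetrahedral_mesh \<Omega> (\<T> h)) \<and>
     (\<exists>\<sigma>>0. \<forall>h\<in>M. \<forall>K\<in>\<T> h. diameter K \<le> h \<and> (\<exists>x. cball x (\<sigma> * h) \<subseteq> K))"

text \<open>Each finite element function, a priori an equivalence class in \<^const>\<open>L2\<close>, is represented by
  its unique representative that is polynomial on the interior of every tetrahedron and vanishes
  outside of these interiors.\<close>

definition ND :: "vec3 set \<Rightarrow> vec3 set set \<Rightarrow> field set" where
  "ND \<Omega> \<T> = {v \<in> Hcurl \<Omega>. (\<forall>K\<in>\<T>. \<exists>a b. \<forall>x\<in>interior K. v x = a + cross3 b x)
                    \<and> (\<forall>x. x \<notin> (\<Union>K\<in>\<T>. interior K) \<longrightarrow> v x = 0)}"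

definition DG :: "vec3 set \<Rightarrow> vec3 set set \<Rightarrow> field set" where
  "DG \<Omega> \<T> = {w \<in> L2 \<Omega>. (\<forall>K\<in>\<T>. \<exists>a. \<forall>x\<in>interior K. w x = a)
                    \<and> (\<forall>x. x \<notin> (\<Union>K\<in>\<T>. interior K) \<longrightarrow> w x = 0)}"

text \<open>The elementwise mean value, i.e. the \<^const>\<open>L2\<close>-orthogonal projection onto \<^const>\<open>DG\<close>.\<close>

definition Qh :: "vec3 set set \<Rightarrow> (vec3 \<Rightarrow> 'b::euclidean_space) \<Rightarrow> vec3 \<Rightarrow> 'b" where
  "Qh \<T> g x = (\<Sum>K\<in>\<T>. indicator (interior K) x *\<^sub>R
     ((1 / measure lebesgue K) *\<^sub>R (LINT y|lebesgue_on (interior K). g y)))"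

text \<open>Since \<open>\<epsilon> t\<close> and \<open>\<mu> t\<close> are equivalence classes, the exceptional null sets in the bounds
  may depend on \<open>t\<close>.\<close>

definition B1 ::
  "vec3 set \<Rightarrow> (real \<Rightarrow> vec3 \<Rightarrow> mat3) \<Rightarrow> (real \<Rightarrow> vec3 \<Rightarrow> mat3) \<Rightarrow> (vec3 \<Rightarrow> mat3) \<Rightarrow> real \<Rightarrow> bool" where
  "B1 \<Omega> \<epsilon> \<mu> \<mu>inf T\<^sub>\<mu> \<longleftrightarrow>
     time_continuous_on {0..} (Linf_sym \<Omega>) (Linf_norm \<Omega>) \<epsilon> \<and>
     time_continuous_on {0..} (Linf_sym \<Omega>) (Linf_norm \<Omega>) \<mu> \<and>
     \<epsilon> \<in> time_sobolev \<Omega> (Linf_sym \<Omega>) (Linf_norm \<Omega>) 2 (Linf_time_loc (Linf_sym \<Omega>) (Linf_norm \<Omega>)) \<and>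
     \<epsilon> \<in> time_sobolev \<Omega> (Linf_sym \<Omega>) (Linf_norm \<Omega>) 1 (Linf_time (Linf_sym \<Omega>) (Linf_norm \<Omega>) {0<..}) \<and>
     \<mu> \<in> time_sobolev \<Omega> (Linf_sym \<Omega>) (Linf_norm \<Omega>) 2 (Linf_time (Linf_sym \<Omega>) (Linf_norm \<Omega>) {0<..}) \<and>
     T\<^sub>\<mu> \<ge> 0 \<and> \<mu>inf \<in> Linf_sym \<Omega> \<and>
     (\<exists>c>0. AE x in lebesgue_on \<Omega>. \<forall>\<xi>. c * (norm \<xi>)\<^sup>2 \<le> \<xi> \<bullet> (\<mu>inf x *v \<xi>)) \<and>
     (\<forall>t\<ge>T\<^sub>\<mu>. AE x in lebesgue_on \<Omega>. \<mu> t x = \<mu>inf x) \<and>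
     (\<exists>\<epsilon>\<^sub>l>0. \<exists>\<epsilon>\<^sub>u>0. \<exists>\<mu>\<^sub>l>0. \<exists>\<mu>\<^sub>u>0. \<forall>t\<ge>0. AE x in lebesgue_on \<Omega>. \<forall>\<xi>.
        \<epsilon>\<^sub>l * (norm \<xi>)\<^sup>2 \<le> \<xi> \<bullet> (\<epsilon> t x *v \<xi>) \<and> \<xi> \<bullet> (\<epsilon> t x *v \<xi>) \<le> \<epsilon>\<^sub>u * (norm \<xi>)\<^sup>2 \<and>
        \<mu>\<^sub>l * (norm \<xi>)\<^sup>2 \<le> \<xi> \<bullet> (\<mu> t x *v \<xi>) \<and> \<xi> \<bullet> (\<mu> t x *v \<xi>) \<le> \<mu>\<^sub>u * (norm \<xi>)\<^sup>2)"

definition B2 :: "vec3 set \<Rightarrow> (vec3 \<Rightarrow> vec3 \<Rightarrow> vec3 \<Rightarrow> real \<Rightarrow> vec3) \<Rightarrow> real \<Rightarrow> bool" where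
  "B2 \<Omega> J\<^sub>t\<^sub>o\<^sub>t T\<^sub>J \<longleftrightarrow>
     (\<forall>\<xi> \<eta>. \<forall>t\<ge>0. (\<lambda>x. J\<^sub>t\<^sub>o\<^sub>t x \<xi> \<eta> t) \<in> borel_measurable (lebesgue_on \<Omega>)) \<and>
     (\<lambda>x. J\<^sub>t\<^sub>o\<^sub>t x 0 0 0) \<in> L2 \<Omega> \<and>
     (\<exists>L>0. AE x in lebesgue_on \<Omega>. \<forall>\<xi> \<xi>' \<eta> \<eta>'. \<forall>t\<ge>0. \<forall>t'\<ge>0.
        norm (J\<^sub>t\<^sub>o\<^sub>t x \<xi> \<eta> t - J\<^sub>t\<^sub>o\<^sub>t x \<xi>' \<eta>' t')
        \<le> L * (norm (\<xi> - \<xi>') + norm (\<eta> - \<eta>')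
               + (1 + norm \<xi> + norm \<xi>' + norm \<eta> + norm \<eta>') * \<bar>t - t'\<bar>)) \<and>
     T\<^sub>J \<ge> 0 \<and>
     (\<forall>t\<ge>T\<^sub>J. \<forall>r\<ge>0. AE x in lebesgue_on \<Omega>. \<forall>\<xi> \<eta> \<eta>'.
        J\<^sub>t\<^sub>o\<^sub>t x (r *\<^sub>R \<xi>) \<eta> t = r *\<^sub>R J\<^sub>t\<^sub>o\<^sub>t x \<xi> \<eta> t \<and> J\<^sub>t\<^sub>o\<^sub>t x \<xi> \<eta> t = J\<^sub>t\<^sub>o\<^sub>t x \<xi> \<eta>' t)"

definition B3 :: "vec3 set \<Rightarrow> (vec3 \<Rightarrow> vec3 \<Rightarrow> vec3) \<Rightarrow> bool" where
  "B3 \<Omega> b \<longleftrightarrow>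
     (\<forall>\<xi>. (\<lambda>x. b x \<xi>) \<in> borel_measurable (surface_measure \<Omega>)) \<and>
     (AE x in surface_measure \<Omega>. continuous_on UNIV (b x)
        \<and> (\<forall>\<xi> \<eta>. 0 \<le> (b x \<xi> - b x \<eta>) \<bullet> (\<xi> - \<eta>)) \<and> b x 0 = 0) \<and>
     (\<exists>b\<^sub>l>0. \<exists>b\<^sub>u>0. \<exists>K>0.
        (AE x in surface_measure \<Omega>. \<forall>\<xi>. norm \<xi> \<ge> K \<longrightarrow> b\<^sub>l * (norm \<xi>)\<^sup>2 \<le> b x \<xi> \<bullet> \<xi>) \<and>
        (AE x in surface_measure \<Omega>. \<forall>\<xi>. norm (b x \<xi>) \<le> b\<^sub>u * (norm \<xi> + 1))) \<and>
     (AE x in surface_measure \<Omega>. \<forall>\<xi>. \<forall>r\<ge>0. b x (r *\<^sub>R \<xi>) = r *\<^sub>R b x \<xi>)"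

definition B4 :: "vec3 set \<Rightarrow> (real \<Rightarrow> field) \<Rightarrow> real \<Rightarrow> bool" where
  "B4 \<Omega> f T\<^sub>f \<longleftrightarrow>
     time_continuous_on {0..} (L2 \<Omega>) (L2_norm \<Omega>) f \<and>
     f \<in> time_sobolev \<Omega> (L2 \<Omega>) (L2_norm \<Omega>) 1 (L2_time (L2 \<Omega>) (L2_norm \<Omega>) {0<..}) \<and>
     T\<^sub>f \<ge> 0 \<and> (\<forall>t\<ge>T\<^sub>f. AE x in lebesgue_on \<Omega>. f t x = 0)"

definition current ::
  "vec3 set \<Rightarrow> (real \<Rightarrow> vec3 \<Rightarrow> mat3) \<Rightarrow> (vec3 \<Rightarrow> vec3 \<Rightarrow> vec3 \<Rightarrow> real \<Rightarrow> vec3) \<Rightarrow> vec3 \<Rightarrow> vec3 \<Rightarrow> vec3 \<Rightarrow> real \<Rightarrow> vec3" where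
  "current \<Omega> \<epsilon> J\<^sub>t\<^sub>o\<^sub>t x \<xi> \<eta> t = J\<^sub>t\<^sub>o\<^sub>t x \<xi> \<eta> t + dt \<Omega> \<epsilon> t x *v \<xi>"

text \<open>For \<open>t \<ge> T\<^sub>J\<close> the current does not depend on its third argument, here set to \<open>0\<close>.\<close>

definition B5 ::
  "vec3 set \<Rightarrow> vec3 set set \<Rightarrow> real \<Rightarrow> (real \<Rightarrow> vec3 \<Rightarrow> mat3) \<Rightarrow> (vec3 \<Rightarrow> vec3 \<Rightarrow> vec3 \<Rightarrow> real \<Rightarrow> vec3) \<Rightarrow> real \<Rightarrow> bool" where
  "B5 \<Omega> \<T> \<tau> \<epsilon> J\<^sub>t\<^sub>o\<^sub>t T\<^sub>J \<longleftrightarrow>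
     (\<exists>\<gamma>>0. \<forall>v\<in>ND \<Omega> \<T>. \<forall>v'\<in>ND \<Omega> \<T>. \<forall>n\<ge>1. real n * \<tau> \<ge> T\<^sub>J \<longrightarrow>
        1/2 * L2_inner \<Omega> (\<lambda>x. \<epsilon> (real n * \<tau>) x *v (v x - v' x)) (\<lambda>x. v x - v' x)
        + \<tau> * L2_inner \<Omega> (\<lambda>x. current \<Omega> \<epsilon> J\<^sub>t\<^sub>o\<^sub>t x (v x) 0 (real n * \<tau>)) v
        - 1/2 * L2_inner \<Omega> (\<lambda>x. (\<epsilon> (real n * \<tau>) x - \<epsilon> (real (n - 1) * \<tau>) x) *v v' x) v'
        \<ge> \<gamma> * (L2_norm \<Omega> v)\<^sup>2)"

definition solves_step where
  "solves_step \<Omega> \<T> \<tau> \<epsilon> \<mu> J\<^sub>t\<^sub>o\<^sub>t b f (n::nat) = (\<lambda>(v, w) (E, H).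
     (\<forall>v\<^sub>h \<in> ND \<Omega> \<T>.
        (LINT x|lebesgue_on \<Omega>.
           (\<epsilon> (real n * \<tau>) x *v ((1/\<tau>) *\<^sub>R (E x - v x))) \<bullet> v\<^sub>h x
           - H x \<bullet> curl \<Omega> v\<^sub>h x
           + current \<Omega> \<epsilon> J\<^sub>t\<^sub>o\<^sub>t x (E x) (H x) (real n * \<tau>) \<bullet> v\<^sub>h x)
        + (LINT x|surface_measure \<Omega>. b x (tangential_trace \<Omega> E x) \<bullet> tangential_trace \<Omega> v\<^sub>h x)
        = (LINT x|lebesgue_on \<Omega>. Qh \<T> (f (real n * \<tau>)) x \<bullet> v\<^sub>h x)) \<and>
     (AE x in lebesgue_on \<Omega>.
        Qh \<T> (\<mu> (real n * \<tau>)) x *v ((1/\<tau>) *\<^sub>R (H x - w x)) + curl \<Omega> E x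
        + Qh \<T> (dt \<Omega> \<mu> (real n * \<tau>)) x *v H x = 0))"

definition well_posed where
  "well_posed \<Omega> \<T> \<tau> \<epsilon> \<mu> J\<^sub>t\<^sub>o\<^sub>t b f \<longleftrightarrow>
     (\<forall>n\<ge>1. \<forall>p \<in> ND \<Omega> \<T> \<times> DG \<Omega> \<T>. \<exists>!q. q \<in> ND \<Omega> \<T> \<times> DG \<Omega> \<T> \<and>
        solves_step \<Omega> \<T> \<tau> \<epsilon> \<mu> J\<^sub>t\<^sub>o\<^sub>t b f n p q)"

definition solution_op where
  "solution_op \<Omega> \<T> \<tau> \<epsilon> \<mu> J\<^sub>t\<^sub>o\<^sub>t b f n p =
     (THE q. q \<in> ND \<Omega> \<T> \<times> DG \<Omega> \<T> \<and> solves_step \<Omega> \<T> \<tau> \<epsilon> \<mu> J\<^sub>t\<^sub>o\<^sub>t b f n p q)"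

definition energy ::
  "vec3 set \<Rightarrow> vec3 set set \<Rightarrow> real \<Rightarrow> (real \<Rightarrow> vec3 \<Rightarrow> mat3) \<Rightarrow> (real \<Rightarrow> vec3 \<Rightarrow> mat3) \<Rightarrow> nat \<Rightarrow> field \<Rightarrow> field \<Rightarrow> real" where
  "energy \<Omega> \<T> \<tau> \<epsilon> \<mu> n v w =
     1/2 * (L2_inner \<Omega> (\<lambda>x. \<epsilon> (real n * \<tau>) x *v v x) v
            + L2_inner \<Omega> (\<lambda>x. Qh \<T> (\<mu> (real n * \<tau>)) x *v w x) w)"

definition Wh :: "vec3 set \<Rightarrow> vec3 set set \<Rightarrow> (vec3 \<Rightarrow> mat3) \<Rightarrow> (field \<times> field) set" where
  "Wh \<Omega> \<T> \<mu>inf = ND \<Omega> \<T> \<times>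
     {w \<in> DG \<Omega> \<T>. \<exists>u \<in> ND \<Omega> \<T>. AE x in lebesgue_on \<Omega>. w x = matrix_inv (Qh \<T> \<mu>inf x) *v curl \<Omega> u x}"

definition decays_exponentially :: "real \<Rightarrow> (nat \<Rightarrow> real) \<Rightarrow> bool" where
  "decays_exponentially \<tau> e \<longleftrightarrow> (\<exists>C>0. \<exists>c>0. \<forall>n\<ge>1. e n \<le> C * exp (- c * (real n * \<tau>)))"

end

theory Submission
  imports Defs
begin

text \<open>
  From the time level \<open>m\<close> on, the source vanishes, the permeability is constant and the current is
  positively homogeneous. Testing Ampere's law with \<open>E\<close> and Faraday's law with \<open>H\<close> then shows that each
  step reduces the energy by at least \<open>\<gamma> |E|\<^sup>2\<close> (\<open>energy_dissipation\<close>). Only the electric field is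
  damped directly, so exponential decay requires that the magnetic field be controlled by the
  electric one. For general data this fails, since a magnetic field orthogonal to all curls
  persists. The space \<open>Wh\<close> excludes such fields: there, \<open>\<mu>h H\<close> is the curl of a finite element field, a
  property that Faraday's law preserves (\<open>magnetic_flux_invariant\<close>). Then twice the magnetic energy is
  \<open>\<langle>H, curl u\<rangle>\<close> with \<open>\<mu>h H = curl u\<close>, and Ampere's law expresses it through \<open>E\<close> at the new and the old time
  level, every other term being bounded by the electric field. As the curl has a bounded right
  inverse on its finite-dimensional range (\<open>curl_representation\<close>), this yields
  \<open>|H\<^sub>n| \<le> C (|E\<^sub>n| + |E\<^sub>n\<^sub>-\<^sub>1|)\<close> (\<open>magnetic_field_bound\<close>). Hence the energy at level \<open>n + 2\<close> is at most a
  multiple of the energy dissipated in the last two steps, and it decays geometrically. Here \<open>|_|\<close> is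
  the norm of \<open>L2\<close>, and the constants, which depend on the mesh and on the step size, come from the
  equivalence of norms on finite-dimensional spaces.

  Three facts of analysis enter. First, weak curls are unique, whence the curl is linear on
  \<open>ND\<close>, and the weak time derivatives behave as expected: that of \<open>\<mu>\<close> vanishes after \<open>T\<^sub>\<mu>\<close>, and that of
  \<open>\<epsilon>\<close> is bounded uniformly in time. Both rest on testing with the explicit bump functions
  \<open>exp (- c / s)\<close>. Second, the current is measurable along measurable fields and grows linearly.
  Third, the boundary form is bounded on \<open>ND\<close> although traces are defined as limits: the boundary points
  that belong to more than one tetrahedron lie on finitely many segments, which are null sets of
  the two-dimensional Hausdorff measure (\<open>surface_AE_in_single_element\<close>), and at all other points the
  limit exists. The total surface measure is finite because the boundary is locally a Lipschitz graph.
\<close>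

section \<open>Square-integrable fields\<close>

text \<open>A non-integrable function has integral \<open>0\<close>, so a pointwise bound suffices: boundary integrals are
  estimated from bounds on the traces, and distributional pairings from bounds on the norms.\<close>

lemma abs_integral_le:
  fixes f g :: "'a \<Rightarrow> real"
  assumes "integrable M g" "AE x in M. \<bar>f x\<bar> \<le> g x"
  shows "\<bar>integral\<^sup>L M f\<bar> \<le> integral\<^sup>L M g"
proof (cases "integrable M f")
  case True
  have "\<bar>integral\<^sup>L M f\<bar> \<le> (LINT x|M. \<bar>f x\<bar>)"
    by (rule integral_abs_bound)
  also have "\<dots> \<le> integral\<^sup>L M g"
    using True assms by (intro integral_mono_AE) auto
  finally show ?thesis .
next
  case False
  have "AE x in M. 0 \<le> g x" using assms(2) by eventually_elim auto
  then show ?thesis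
    using False by (simp add: not_integrable_integral_eq integral_nonneg_AE)
qed

lemma L2D: "u \<in> L2 \<Omega> \<Longrightarrow> u \<in> borel_measurable (lebesgue_on \<Omega>)"
  "u \<in> L2 \<Omega> \<Longrightarrow> integrable (lebesgue_on \<Omega>) (\<lambda>x. (norm (u x))\<^sup>2)"
  by (auto simp: L2_def)

lemma L2_integrable_inner:
  assumes "u \<in> L2 \<Omega>" "v \<in> L2 \<Omega>"
  shows "integrable (lebesgue_on \<Omega>) (\<lambda>x. u x \<bullet> v x)"
proof (rule Bochner_Integration.integrable_bound)
  show "integrable (lebesgue_on \<Omega>) (\<lambda>x. (norm (u x))\<^sup>2 + (norm (v x))\<^sup>2)"
    using assms by (auto simp: L2_def)
  show "(\<lambda>x. u x \<bullet> v x) \<in> borel_measurable (lebesgue_on \<Omega>)"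
    using assms by (intro borel_measurable_inner L2D)
  have "\<bar>u x \<bullet> v x\<bar> \<le> (norm (u x))\<^sup>2 + (norm (v x))\<^sup>2" for x
  proof -
    have "\<bar>u x \<bullet> v x\<bar> \<le> norm (u x) * norm (v x)"
      by (rule Cauchy_Schwarz_ineq2)
    also have "2 * (norm (u x) * norm (v x)) \<le> (norm (u x))\<^sup>2 + (norm (v x))\<^sup>2"
      using sum_squares_bound[of "norm (u x)" "norm (v x)"] by simp
    then have "norm (u x) * norm (v x) \<le> (norm (u x))\<^sup>2 + (norm (v x))\<^sup>2"
      using mult_nonneg_nonneg[of "norm (u x)" "norm (v x)"] norm_ge_zero[of "u x"] norm_ge_zero[of "v x"] by linarith
    finally show ?thesis .
  qed
  then show "AE x in lebesgue_on \<Omega>. norm (u x \<bullet> v x) \<le> norm ((norm (u x))\<^sup>2 + (norm (v x))\<^sup>2)"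
    by simp
qed

lemma L2_add_scaleR:
  fixes u v :: "vec3 \<Rightarrow> 'b::euclidean_space"
  assumes "u \<in> L2 \<Omega>" "v \<in> L2 \<Omega>"
  shows "(\<lambda>x. u x + c *\<^sub>R v x) \<in> L2 \<Omega>"
proof -
  have "(norm (u x + c *\<^sub>R v x))\<^sup>2 = (norm (u x))\<^sup>2 + 2 * c * (u x \<bullet> v x) + c\<^sup>2 * (norm (v x))\<^sup>2" for x
    unfolding power2_norm_eq_inner
    by (simp add: inner_add_left inner_add_right inner_commute power2_eq_square)
  then show ?thesis
    using assms L2_integrable_inner[OF assms] unfolding L2_def by auto
qed

lemma L2_zero: "(\<lambda>x. 0) \<in> L2 \<Omega>"
  by (simp add: L2_def)

lemma L2_diff:
  assumes "u \<in> L2 \<Omega>" "v \<in> L2 \<Omega>"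
  shows "(\<lambda>x. u x - v x) \<in> L2 \<Omega>"
  using L2_add_scaleR[OF assms, of "-1"] by simp

lemma L2_scaleR:
  assumes "v \<in> L2 \<Omega>"
  shows "(\<lambda>x. c *\<^sub>R v x) \<in> L2 \<Omega>"
  using L2_add_scaleR[OF L2_zero assms, of c] by simp

lemma L2_dominated:
  fixes v :: "vec3 \<Rightarrow> 'b::euclidean_space" and u :: "vec3 \<Rightarrow> 'c::euclidean_space"
  assumes "v \<in> L2 \<Omega>" "u \<in> borel_measurable (lebesgue_on \<Omega>)"
    and "AE x in lebesgue_on \<Omega>. norm (u x) \<le> c * norm (v x)"
  shows "u \<in> L2 \<Omega>"
proof -
  have "integrable (lebesgue_on \<Omega>) (\<lambda>x. (norm (u x))\<^sup>2)"
  proof (rule Bochner_Integration.integrable_bound)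
    show "integrable (lebesgue_on \<Omega>) (\<lambda>x. c\<^sup>2 * (norm (v x))\<^sup>2)"
      using assms by (auto simp: L2_def)
    show "AE x in lebesgue_on \<Omega>. norm ((norm (u x))\<^sup>2) \<le> norm (c\<^sup>2 * (norm (v x))\<^sup>2)"
      using assms(3) by eventually_elim (auto simp flip: power_mult_distrib intro: power_mono)
  qed (use assms(2) in auto)
  then show ?thesis using assms by (simp add: L2_def)
qed

lemma L2_bounded:
  fixes u :: "vec3 \<Rightarrow> 'b::euclidean_space"
  assumes "\<Omega> \<in> lmeasurable" "u \<in> borel_measurable (lebesgue_on \<Omega>)" "AE x in lebesgue_on \<Omega>. norm (u x) \<le> C"
  shows "u \<in> L2 \<Omega>"
proof (rule L2_dominated)
  show "(\<lambda>_. 1 :: real) \<in> L2 \<Omega>"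
    using finite_measure.integrable_const[OF finite_measure_lebesgue_on[OF assms(1)]] by (simp add: L2_def)
qed (use assms in auto)

lemma L2_inner_commute: "L2_inner \<Omega> u v = L2_inner \<Omega> v u"
  by (simp add: L2_inner_def inner_commute)

lemma L2_inner_add_scaleR_left:
  assumes "u \<in> L2 \<Omega>" "v \<in> L2 \<Omega>" "w \<in> L2 \<Omega>"
  shows "L2_inner \<Omega> (\<lambda>x. u x + c *\<^sub>R v x) w = L2_inner \<Omega> u w + c * L2_inner \<Omega> v w"
  unfolding L2_inner_def using L2_integrable_inner[OF assms(1,3)] L2_integrable_inner[OF assms(2,3)]
  by (simp add: inner_add_left)

lemma L2_norm_sq: "(L2_norm \<Omega> u)\<^sup>2 = L2_inner \<Omega> u u"
  by (simp add: L2_norm_def L2_inner_def power2_norm_eq_inner)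

lemma L2_norm_nonneg [simp]: "L2_norm \<Omega> u \<ge> 0"
  by (simp add: L2_norm_def)

lemma L2_Cauchy_Schwarz:
  assumes "u \<in> L2 \<Omega>" "v \<in> L2 \<Omega>"
  shows "\<bar>L2_inner \<Omega> u v\<bar> \<le> L2_norm \<Omega> u * L2_norm \<Omega> v"
proof -
  let ?a = "L2_inner \<Omega> u u" and ?b = "L2_inner \<Omega> u v" and ?d = "L2_inner \<Omega> v v"
  have nonneg: "L2_inner \<Omega> w w \<ge> 0" for w :: "vec3 \<Rightarrow> 'a"
    by (simp add: L2_inner_def)
  have expand: "0 \<le> ?a + 2 * c * ?b + c\<^sup>2 * ?d" for c
  proof -
    let ?w = "\<lambda>x. u x + c *\<^sub>R v x"
    have "L2_inner \<Omega> ?w ?w = L2_inner \<Omega> u ?w + c * L2_inner \<Omega> v ?w"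
      using assms L2_add_scaleR by (intro L2_inner_add_scaleR_left) auto
    also have "\<dots> = ?a + 2 * c * ?b + c\<^sup>2 * ?d"
      using L2_inner_add_scaleR_left[OF assms assms(1), of c] L2_inner_add_scaleR_left[OF assms assms(2), of c]
      by (simp add: L2_inner_commute[of \<Omega> u ?w] L2_inner_commute[of \<Omega> v ?w] L2_inner_commute[of \<Omega> v u]
          power2_eq_square algebra_simps)
    finally show ?thesis using nonneg[of ?w] by simp
  qed
  have "?b\<^sup>2 \<le> ?a * ?d"
  proof (cases "?d = 0")
    case True
    have "?b = 0"
    proof (rule ccontr)
      assume "?b \<noteq> 0"
      then show False
        using expand[of "- (?a + 1) / (2 * ?b)"] True by (simp add: field_simps)
    qed
    then show ?thesis using True by simp
  next
    case False
    then have "?d > 0" using nonneg[of v] by simp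
    have "0 \<le> ?a - ?b\<^sup>2 / ?d"
      using expand[of "- ?b / ?d"] \<open>?d > 0\<close> by (simp add: power2_eq_square field_simps)
    then show ?thesis using \<open>?d > 0\<close> by (simp add: field_simps)
  qed
  then have "\<bar>?b\<bar> \<le> sqrt (?a * ?d)"
    by (metis real_sqrt_abs real_sqrt_le_mono)
  then show ?thesis
    by (simp add: real_sqrt_mult flip: L2_norm_sq)
qed

lemma L2_inner_cong_AE:
  assumes "AE x in lebesgue_on \<Omega>. u x = u' x" "AE x in lebesgue_on \<Omega>. v x = v' x"
    and "u \<in> borel_measurable (lebesgue_on \<Omega>)" "u' \<in> borel_measurable (lebesgue_on \<Omega>)"
      "v \<in> borel_measurable (lebesgue_on \<Omega>)" "v' \<in> borel_measurable (lebesgue_on \<Omega>)"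
  shows "L2_inner \<Omega> u v = L2_inner \<Omega> u' v'"
  unfolding L2_inner_def using assms
  by (intro integral_cong_AE) (auto elim: AE_mp)

lemma L2_norm_mono:
  fixes v :: "vec3 \<Rightarrow> 'b::euclidean_space" and u :: "vec3 \<Rightarrow> 'c::euclidean_space"
  assumes "v \<in> L2 \<Omega>" "u \<in> L2 \<Omega>" "AE x in lebesgue_on \<Omega>. norm (u x) \<le> c * norm (v x)" "c \<ge> 0"
  shows "L2_norm \<Omega> u \<le> c * L2_norm \<Omega> v"
proof -
  have "(LINT x|lebesgue_on \<Omega>. (norm (u x))\<^sup>2) \<le> (LINT x|lebesgue_on \<Omega>. c\<^sup>2 * (norm (v x))\<^sup>2)"
  proof (rule integral_mono_AE)
    show "AE x in lebesgue_on \<Omega>. (norm (u x))\<^sup>2 \<le> c\<^sup>2 * (norm (v x))\<^sup>2"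
      using assms(3) by eventually_elim (auto simp flip: power_mult_distrib intro: power_mono)
  qed (use assms in \<open>auto simp: L2_def\<close>)
  then have "L2_norm \<Omega> u \<le> sqrt (c\<^sup>2 * (LINT x|lebesgue_on \<Omega>. (norm (v x))\<^sup>2))"
    unfolding L2_norm_def by (intro real_sqrt_le_mono) simp
  then show ?thesis
    using assms(4) by (simp add: L2_norm_def real_sqrt_mult)
qed

lemma L2_integrable_norm:
  fixes \<psi> :: "vec3 \<Rightarrow> 'b::euclidean_space"
  assumes "\<Omega> \<in> lmeasurable" "\<psi> \<in> L2 \<Omega>"
  shows "integrable (lebesgue_on \<Omega>) (\<lambda>x. norm (\<psi> x))"
proof -
  have "(\<lambda>x. norm (\<psi> x)) \<in> L2 \<Omega>"
    by (rule L2_dominated[OF assms(2), where c = 1]) (use L2D(1)[OF assms(2)] in auto)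
  moreover have "(\<lambda>_. 1::real) \<in> L2 \<Omega>" by (rule L2_bounded[OF assms(1)]) auto
  ultimately show ?thesis using L2_integrable_inner by fastforce
qed

lemma L2_inner_sum_left:
  assumes "\<And>j. j < (M::nat) \<Longrightarrow> u j \<in> L2 \<Omega>" "v \<in> L2 \<Omega>"
  shows "L2_inner \<Omega> (\<lambda>x. \<Sum>j<M. c j *\<^sub>R u j x) v = (\<Sum>j<M. c j * L2_inner \<Omega> (u j) v)"
proof -
  have "integrable (lebesgue_on \<Omega>) (\<lambda>x. c j * (u j x \<bullet> v x))" if "j < M" for j
    using L2_integrable_inner[OF assms(1)[OF that] assms(2)] by simp
  then show ?thesis unfolding L2_inner_def by (simp add: inner_sum_left)
qed

lemma L2_triangle:
  assumes "u \<in> L2 \<Omega>" "v \<in> L2 \<Omega>"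
  shows "L2_norm \<Omega> (\<lambda>x. u x + v x) \<le> L2_norm \<Omega> u + L2_norm \<Omega> v"
proof -
  let ?w = "\<lambda>x. u x + 1 *\<^sub>R v x"
  have w: "?w \<in> L2 \<Omega>" by (rule L2_add_scaleR[OF assms])
  have "(L2_norm \<Omega> ?w)\<^sup>2 = L2_inner \<Omega> u ?w + L2_inner \<Omega> v ?w"
    unfolding L2_norm_sq using L2_inner_add_scaleR_left[OF assms w, of 1] by simp
  also have "L2_inner \<Omega> u ?w = L2_inner \<Omega> u u + L2_inner \<Omega> u v"
    using L2_inner_add_scaleR_left[OF assms assms(1), of 1] by (simp add: L2_inner_commute)
  also have "L2_inner \<Omega> v ?w = L2_inner \<Omega> u v + L2_inner \<Omega> v v"
    using L2_inner_add_scaleR_left[OF assms assms(2), of 1] by (simp add: L2_inner_commute)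
  finally have "(L2_norm \<Omega> ?w)\<^sup>2 \<le> (L2_norm \<Omega> u + L2_norm \<Omega> v)\<^sup>2"
    using L2_Cauchy_Schwarz[OF assms] by (simp add: power2_sum L2_norm_sq)
  then have "L2_norm \<Omega> ?w \<le> L2_norm \<Omega> u + L2_norm \<Omega> v" by (rule power2_le_imp_le) simp
  then show ?thesis by simp
qed

section \<open>Matrix-valued coefficients\<close>

text \<open>The integrand of a Nemytskii operator: if \<open>u\<close> takes finitely many values, then \<open>F x (u x)\<close> is
  pieced together from finitely many of the measurable functions \<open>F _ \<xi>\<close>; the general case follows
  by continuity in \<open>\<xi>\<close>, with completeness of the Lebesgue measure absorbing the exceptional set.\<close>

lemma caratheodory_measurable:
  fixes F :: "vec3 \<Rightarrow> 'b::euclidean_space \<Rightarrow> 'c::euclidean_space"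
  assumes S: "S \<in> sets lebesgue"
    and F: "\<And>\<xi>. (\<lambda>x. F x \<xi>) \<in> borel_measurable (lebesgue_on S)"
    and cont: "AE x in lebesgue_on S. continuous_on UNIV (F x)"
    and u: "u \<in> borel_measurable (lebesgue_on S)"
  shows "(\<lambda>x. F x (u x)) \<in> borel_measurable (lebesgue_on S)"
proof -
  let ?M = "lebesgue_on S"
  obtain s where s: "\<And>i. simple_function ?M (s i)" "\<And>x. x \<in> space ?M \<Longrightarrow> (\<lambda>i. s i x) \<longlonglongrightarrow> u x"
    using borel_measurable_implies_sequence_metric[OF u, of 0] by metis
  have meas: "(\<lambda>x. F x (s i x)) \<in> borel_measurable ?M" for i
  proof (rule measurable_compose_countable'[where I = "s i ` space ?M" and f = "\<lambda>\<xi> x. F x \<xi>"])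
    have fin: "finite (s i ` space ?M)" using s(1) by (rule simple_functionD)
    then show "countable (s i ` space ?M)" by (rule countable_finite)
    show "s i \<in> measurable ?M (count_space (s i ` space ?M))"
      using fin simple_functionD(2)[OF s(1)] by (subst measurable_count_space_eq2) auto
  qed (rule F)
  define h where "h i x = (if x \<in> S then F x (s i x) else 0)" for i x
  define h' where "h' x = (if x \<in> S then F x (u x) else 0)" for x
  have h: "h i \<in> borel_measurable lebesgue" for i
    unfolding h_def[abs_def] using meas[of i] S by (simp add: borel_measurable_if)
  have "AE x in lebesgue. x \<in> S \<longrightarrow> continuous_on UNIV (F x)"
    using cont S by (simp add: AE_restrict_space_iff)
  then obtain N where N: "N \<in> null_sets lebesgue" "{x. \<not> (x \<in> S \<longrightarrow> continuous_on UNIV (F x))} \<subseteq> N"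
    unfolding eventually_ae_filter by auto
  have Ns: "N \<in> sets lebesgue" using N(1) by blast
  have cNs: "- N \<in> sets lebesgue" using sets.compl_sets[OF Ns] by (simp add: Compl_eq_Diff_UNIV)
  have "(\<lambda>x. indicator (- N) x *\<^sub>R h' x) \<in> borel_measurable lebesgue"
  proof (rule borel_measurable_LIMSEQ_metric)
    show "(\<lambda>x. indicator (- N) x *\<^sub>R h i x) \<in> borel_measurable lebesgue" for i
      using h[of i] cNs by (intro borel_measurable_scaleR borel_measurable_indicator) auto
    fix x :: vec3
    show "(\<lambda>i. indicator (- N) x *\<^sub>R h i x) \<longlonglongrightarrow> indicator (- N) x *\<^sub>R h' x"
    proof (cases "x \<in> S \<and> x \<notin> N")
      case True
      then have "continuous_on UNIV (F x)" using N(2) by blast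
      then have "isCont (F x) (u x)" by (simp add: continuous_on_eq_continuous_at)
      moreover have "(\<lambda>i. s i x) \<longlonglongrightarrow> u x" using s(2) True by (simp add: space_restrict_space)
      ultimately have "(\<lambda>i. F x (s i x)) \<longlonglongrightarrow> F x (u x)" by (rule isCont_tendsto_compose)
      then show ?thesis using True by (simp add: h_def h'_def)
    qed (auto simp: h_def h'_def indicator_def)
  qed
  moreover have "AE x in lebesgue. indicator (- N) x *\<^sub>R h' x = h' x"
    using AE_not_in[OF N(1)] by eventually_elim simp
  ultimately have "h' \<in> borel_measurable lebesgue" by (rule borel_measurable_AE)
  then show ?thesis unfolding h'_def[abs_def] using S by (simp add: borel_measurable_if)
qed

lemma norm_matrix_vector_le:
  fixes A :: mat3
  shows "norm (A *v x) \<le> norm A * norm x"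
proof -
  have "(norm (A *v x))\<^sup>2 = (\<Sum>i\<in>UNIV. (A $ i \<bullet> x)\<^sup>2)"
    by (simp add: norm_vec_def L2_set_def sum_nonneg matrix_vector_mul_component)
  also have "\<dots> \<le> (\<Sum>i\<in>UNIV. (norm (A $ i) * norm x)\<^sup>2)"
    by (intro sum_mono) (metis Cauchy_Schwarz_ineq2 abs_ge_zero power2_abs power_mono)
  also have "\<dots> = (norm A * norm x)\<^sup>2"
    by (simp add: norm_vec_def[of A] L2_set_def sum_nonneg power_mult_distrib sum_distrib_right)
  finally show ?thesis by (rule power2_le_imp_le) simp
qed

lemma matrix_vector_measurable:
  fixes A :: "vec3 \<Rightarrow> mat3"
  assumes "A \<in> borel_measurable M" "u \<in> borel_measurable M"
  shows "(\<lambda>x. A x *v u x) \<in> borel_measurable M"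
proof -
  have "continuous_on UNIV (\<lambda>p :: mat3 \<times> vec3. fst p *v snd p)"
    by (simp add: matrix_vector_mult_def[abs_def]) (intro continuous_intros)
  from borel_measurable_continuous_Pair[OF assms this] show ?thesis by simp
qed

lemma integrable_lebesgue_on_subset:
  fixes f :: "vec3 \<Rightarrow> 'b::euclidean_space"
  assumes "integrable (lebesgue_on A) f" "B \<subseteq> A" "A \<in> sets lebesgue" "B \<in> sets lebesgue"
  shows "integrable (lebesgue_on B) f"
proof -
  have "set_integrable lebesgue A f"
    using assms by (simp add: set_integrable_def integrable_restrict_space)
  then have "set_integrable lebesgue B f" using assms set_integrable_subset by blast
  then show ?thesis using assms by (simp add: set_integrable_def integrable_restrict_space)
qed

text \<open>Evaluating the form at \<open>\<eta> - A \<eta> / M\<close> gives \<open>|A \<eta>|\<^sup>2 \<le> M (\<eta> \<bullet> A \<eta>)\<close>. For the permittivity, this turns the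
  bounds on the quadratic form, which hold uniformly in time, into a uniform operator bound.\<close>

lemma psd_matrix_bound:
  fixes A :: mat3
  assumes sym: "\<And>\<xi> \<eta>. \<xi> \<bullet> (A *v \<eta>) = \<eta> \<bullet> (A *v \<xi>)"
    and psd: "\<And>\<xi>. 0 \<le> \<xi> \<bullet> (A *v \<xi>)" and upper: "\<And>\<xi>. \<xi> \<bullet> (A *v \<xi>) \<le> M * (norm \<xi>)\<^sup>2" and M: "M > 0"
  shows "norm (A *v \<eta>) \<le> M * norm \<eta>"
proof -
  let ?\<xi> = "A *v \<eta>"
  have "0 \<le> (\<eta> - (1 / M) *\<^sub>R ?\<xi>) \<bullet> (A *v (\<eta> - (1 / M) *\<^sub>R ?\<xi>))" by (rule psd)
  also have "\<dots> = \<eta> \<bullet> ?\<xi> - (2 / M) * (norm ?\<xi>)\<^sup>2 + (1 / M)\<^sup>2 * (?\<xi> \<bullet> (A *v ?\<xi>))"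
    using sym[of \<eta> ?\<xi>]
    by (simp add: matrix_vector_mult_diff_distrib matrix_vector_mult_scaleR inner_diff_left inner_diff_right
        power2_norm_eq_inner power2_eq_square[of "1 / M"] algebra_simps)
  also have "\<dots> \<le> M * (norm \<eta>)\<^sup>2 - (2 / M) * (norm ?\<xi>)\<^sup>2 + (1 / M)\<^sup>2 * (M * (norm ?\<xi>)\<^sup>2)"
    using upper[of \<eta>] upper[of ?\<xi>] M by (intro add_mono diff_mono mult_left_mono) auto
  also have "\<dots> = M * (norm \<eta>)\<^sup>2 - (norm ?\<xi>)\<^sup>2 / M"
    using M by (simp add: power2_eq_square field_simps)
  finally have "(norm ?\<xi>)\<^sup>2 / M \<le> M * (norm \<eta>)\<^sup>2" by simp
  then have "(norm ?\<xi>)\<^sup>2 \<le> M * (norm \<eta>)\<^sup>2 * M" using M by (simp only: pos_divide_le_eq)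
  also have "\<dots> = (M * norm \<eta>)\<^sup>2" by (simp add: power2_eq_square)
  finally show ?thesis by (rule power2_le_imp_le) (use M in simp)
qed

lemma symmetric_matrix_inner:
  fixes A :: mat3
  assumes "transpose A = A"
  shows "\<xi> \<bullet> (A *v \<eta>) = \<eta> \<bullet> (A *v \<xi>)"
proof -
  have "\<xi> \<bullet> (A *v \<eta>) = (transpose A *v \<xi>) \<bullet> \<eta>"
    unfolding transpose_matrix_vector dot_lmul_matrix ..
  also have "\<dots> = \<eta> \<bullet> (A *v \<xi>)" unfolding assms by (rule inner_commute)
  finally show ?thesis .
qed

text \<open>The infimum in the definition of the essential supremum is attained, as countably many null sets
  form a null set.\<close>

lemma Linf_norm_AE:
  assumes "\<exists>c. AE x in lebesgue_on \<Omega>. norm (g x) \<le> c"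
  shows "AE x in lebesgue_on \<Omega>. norm (g x) \<le> Linf_norm \<Omega> g"
proof -
  let ?C = "{c. 0 \<le> c \<and> (AE x in lebesgue_on \<Omega>. norm (g x) \<le> c)}"
  obtain c where c: "AE x in lebesgue_on \<Omega>. norm (g x) \<le> c" using assms by blast
  have "AE x in lebesgue_on \<Omega>. norm (g x) \<le> max c 0" using c by eventually_elim auto
  then have ne: "?C \<noteq> {}" by force
  have bdd: "bdd_below ?C" by (rule bdd_belowI[of _ 0]) auto
  have "AE x in lebesgue_on \<Omega>. norm (g x) < Inf ?C + 1 / real (Suc n)" for n
  proof -
    have "Inf ?C < Inf ?C + 1 / real (Suc n)" by simp
    then obtain c where "c \<in> ?C" "c < Inf ?C + 1 / real (Suc n)"
      using cInf_less_iff[OF ne bdd] by blast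
    then show ?thesis by (auto elim: eventually_mono)
  qed
  then have "AE x in lebesgue_on \<Omega>. \<forall>n. norm (g x) < Inf ?C + 1 / real (Suc n)"
    by (simp add: AE_all_countable)
  then show ?thesis
  proof eventually_elim
    case (elim x)
    show ?case unfolding Linf_norm_def
    proof (rule field_le_epsilon)
      fix e :: real assume "e > 0"
      then obtain n where "1 / real (Suc n) < e" using nat_approx_posE by blast
      with elim[rule_format, of n] show "norm (g x) \<le> Inf ?C + e" by linarith
    qed
  qed
qed

lemma Linf_sym_bounded: "g \<in> Linf_sym \<Omega> \<Longrightarrow> AE x in lebesgue_on \<Omega>. norm (g x) \<le> Linf_norm \<Omega> g"
  by (intro Linf_norm_AE) (auto simp: Linf_sym_def)

lemma Linf_sym_L2:
  assumes "\<Omega> \<in> lmeasurable" "g \<in> Linf_sym \<Omega>"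
  shows "g \<in> L2 \<Omega>"
  using L2_bounded[OF assms(1) _ Linf_sym_bounded[OF assms(2)]] assms(2) by (simp add: Linf_sym_def)

definition weighted_inner :: "vec3 set \<Rightarrow> (vec3 \<Rightarrow> mat3) \<Rightarrow> field \<Rightarrow> field \<Rightarrow> real" where
  "weighted_inner \<Omega> A u v = L2_inner \<Omega> (\<lambda>x. A x *v u x) v"

lemma matrix_vector_L2:
  assumes "A \<in> Linf_sym \<Omega>" "u \<in> L2 \<Omega>"
  shows "(\<lambda>x. A x *v u x) \<in> L2 \<Omega>"
proof (rule L2_dominated[OF assms(2)])
  show "(\<lambda>x. A x *v u x) \<in> borel_measurable (lebesgue_on \<Omega>)"
    using assms by (intro matrix_vector_measurable) (auto simp: Linf_sym_def L2D)
  show "AE x in lebesgue_on \<Omega>. norm (A x *v u x) \<le> Linf_norm \<Omega> A * norm (u x)"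
    using Linf_sym_bounded[OF assms(1)]
    by eventually_elim (meson norm_matrix_vector_le mult_right_mono norm_ge_zero order_trans)
qed

lemma weighted_inner_commute:
  assumes A: "A \<in> Linf_sym \<Omega>" and u: "u \<in> L2 \<Omega>" and v: "v \<in> L2 \<Omega>"
  shows "weighted_inner \<Omega> A u v = weighted_inner \<Omega> A v u"
  unfolding weighted_inner_def L2_inner_def
proof (rule integral_cong_AE)
  show "(\<lambda>x. (A x *v u x) \<bullet> v x) \<in> borel_measurable (lebesgue_on \<Omega>)"
    "(\<lambda>x. (A x *v v x) \<bullet> u x) \<in> borel_measurable (lebesgue_on \<Omega>)"
    by (intro borel_measurable_inner L2D(1) matrix_vector_L2[OF A] u v)+
  have "AE x in lebesgue_on \<Omega>. transpose (A x) = A x" using A by (simp add: Linf_sym_def)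
  then show "AE x in lebesgue_on \<Omega>. (A x *v u x) \<bullet> v x = (A x *v v x) \<bullet> u x"
    by eventually_elim (metis symmetric_matrix_inner inner_commute)
qed

lemma weighted_inner_add_scaleR_left:
  assumes A: "A \<in> Linf_sym \<Omega>" and u: "u \<in> L2 \<Omega>" "v \<in> L2 \<Omega>" "w \<in> L2 \<Omega>"
  shows "weighted_inner \<Omega> A (\<lambda>x. u x + c *\<^sub>R v x) w = weighted_inner \<Omega> A u w + c * weighted_inner \<Omega> A v w"
  unfolding weighted_inner_def
  using L2_inner_add_scaleR_left[OF matrix_vector_L2[OF A u(1)] matrix_vector_L2[OF A u(2)] u(3)]
  by (simp add: matrix_vector_right_distrib matrix_vector_mult_scaleR)

text \<open>The polarization identity behind the energy law of the implicit Euler step: the last term is the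
  numerical dissipation.\<close>

lemma weighted_inner_diff:
  assumes A: "A \<in> Linf_sym \<Omega>" and u: "u \<in> L2 \<Omega>" "v \<in> L2 \<Omega>"
  shows "weighted_inner \<Omega> A (\<lambda>x. u x - v x) u =
    1/2 * weighted_inner \<Omega> A u u - 1/2 * weighted_inner \<Omega> A v v
    + 1/2 * weighted_inner \<Omega> A (\<lambda>x. u x - v x) (\<lambda>x. u x - v x)"
proof -
  note d = L2_diff[OF u]
  have 1: "weighted_inner \<Omega> A (\<lambda>x. u x - v x) w = weighted_inner \<Omega> A u w - weighted_inner \<Omega> A v w" if "w \<in> L2 \<Omega>" for w
    using weighted_inner_add_scaleR_left[OF A u that, of "-1"] by simp
  show ?thesis
    using weighted_inner_commute[OF A u(1) d] weighted_inner_commute[OF A u(2) d] weighted_inner_commute[OF A u]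
    by (simp add: 1 u d field_simps)
qed

lemma weighted_inner_lower:
  assumes A: "A \<in> Linf_sym \<Omega>" and w: "w \<in> L2 \<Omega>"
    and low: "AE x in lebesgue_on \<Omega>. \<forall>\<xi>. c * (norm \<xi>)\<^sup>2 \<le> \<xi> \<bullet> (A x *v \<xi>)"
  shows "c * (L2_norm \<Omega> w)\<^sup>2 \<le> weighted_inner \<Omega> A w w"
proof -
  have "(LINT x|lebesgue_on \<Omega>. c * (norm (w x))\<^sup>2) \<le> (LINT x|lebesgue_on \<Omega>. (A x *v w x) \<bullet> w x)"
  proof (rule integral_mono_AE)
    show "integrable (lebesgue_on \<Omega>) (\<lambda>x. (A x *v w x) \<bullet> w x)"
      by (intro L2_integrable_inner matrix_vector_L2 A w)
    show "AE x in lebesgue_on \<Omega>. c * (norm (w x))\<^sup>2 \<le> (A x *v w x) \<bullet> w x"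
      using low by eventually_elim (simp add: inner_commute)
  qed (use L2D(2)[OF w] in simp)
  then show ?thesis by (simp add: weighted_inner_def L2_inner_def L2_norm_def)
qed

lemma weighted_inner_upper:
  assumes A: "A \<in> Linf_sym \<Omega>" and w: "w \<in> L2 \<Omega>"
    and up: "AE x in lebesgue_on \<Omega>. \<forall>\<xi>. \<xi> \<bullet> (A x *v \<xi>) \<le> c * (norm \<xi>)\<^sup>2"
  shows "weighted_inner \<Omega> A w w \<le> c * (L2_norm \<Omega> w)\<^sup>2"
proof -
  have "(LINT x|lebesgue_on \<Omega>. (A x *v w x) \<bullet> w x) \<le> (LINT x|lebesgue_on \<Omega>. c * (norm (w x))\<^sup>2)"
  proof (rule integral_mono_AE)
    show "integrable (lebesgue_on \<Omega>) (\<lambda>x. (A x *v w x) \<bullet> w x)"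
      by (intro L2_integrable_inner matrix_vector_L2 A w)
    show "AE x in lebesgue_on \<Omega>. (A x *v w x) \<bullet> w x \<le> c * (norm (w x))\<^sup>2"
      using up by eventually_elim (simp add: inner_commute)
  qed (use L2D(2)[OF w] in simp)
  then show ?thesis by (simp add: weighted_inner_def L2_inner_def L2_norm_def)
qed

section \<open>Smooth bump functions\<close>

text \<open>This class of functions, with polynomials \<open>s\<close> and \<open>p\<close>, is closed under partial derivatives, which
  is why the power of \<open>s\<close> in the denominator is included.\<close>

definition bump :: "'a::euclidean_space set \<Rightarrow> ('a \<Rightarrow> real) \<Rightarrow> real \<Rightarrow> nat \<Rightarrow> ('a \<Rightarrow> real) \<Rightarrow> 'a \<Rightarrow> real" where
  "bump U s c k p x = (if x \<in> U then p x * exp (- c / s x) / s x ^ k else 0)"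

lemma real_polynomial_function_deriv:
  assumes "real_polynomial_function (p :: 'a::real_normed_vector \<Rightarrow> real)"
  shows "\<exists>p'. (\<forall>x. (p has_derivative p' x) (at x)) \<and> (\<forall>v. real_polynomial_function (\<lambda>x. p' x v))"
  using assms
proof induction
  case (linear f)
  then show ?case
    by (intro exI[of _ "\<lambda>_. f"]) (auto intro: bounded_linear_imp_has_derivative)
next
  case (const c)
  show ?case
    by (intro exI[of _ "\<lambda>_ _. 0"]) auto
next
  case (add f g)
  then obtain f' g' where "\<forall>x. (f has_derivative f' x) (at x)" "\<forall>v. real_polynomial_function (\<lambda>x. f' x v)"
    "\<forall>x. (g has_derivative g' x) (at x)" "\<forall>v. real_polynomial_function (\<lambda>x. g' x v)"
    by blast
  then show ?case
    by (intro exI[of _ "\<lambda>x v. f' x v + g' x v"]) (auto intro: has_derivative_add)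
next
  case (mult f g)
  then obtain f' g' where "\<forall>x. (f has_derivative f' x) (at x)" "\<forall>v. real_polynomial_function (\<lambda>x. f' x v)"
    "\<forall>x. (g has_derivative g' x) (at x)" "\<forall>v. real_polynomial_function (\<lambda>x. g' x v)"
    by blast
  then show ?case
    using mult.hyps
    by (intro exI[of _ "\<lambda>x v. f x * g' x v + f' x v * g x"]) (auto intro!: has_derivative_mult real_polynomial_function.intros(3,4))
qed

text \<open>One term of the exponential series of \<open>c / s\<close>.\<close>

lemma exp_inverse_bound:
  fixes c s :: real
  assumes "c > 0" "s > 0"
  shows "exp (- c / s) / s ^ n \<le> fact n / c ^ n"
proof -
  have "(\<Sum>i\<in>{n}. (c / s) ^ i /\<^sub>R fact i) \<le> exp (c / s)"
    unfolding exp_def using assms by (intro sum_le_suminf summable_exp_generic) auto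
  then have "(c / s) ^ n / fact n \<le> exp (c / s)"
    by (simp add: divide_inverse mult.commute)
  then have "(c / s) ^ n / fact n * exp (- c / s) \<le> exp (c / s) * exp (- c / s)"
    by (intro mult_right_mono) auto
  also have "\<dots> = 1"
    by (simp flip: exp_add)
  finally have "(c / s) ^ n * exp (- c / s) \<le> fact n"
    by (simp add: pos_divide_le_eq)
  then have "c ^ n * exp (- c / s) / s ^ n \<le> fact n"
    by (simp add: power_divide)
  then show ?thesis
    using assms by (simp add: pos_le_divide_eq mult.commute)
qed

text \<open>The factor \<open>exp (- c / s)\<close> beats every negative power of \<open>s\<close>. The square on the right makes the
  derivative vanish wherever \<open>s\<close> does.\<close>

lemma bump_quadratic_bound:
  assumes "c > 0" and "s x > 0"
  shows "\<bar>bump U s c k p x\<bar> \<le> \<bar>p x\<bar> * (fact (k + 2) / c ^ (k + 2)) * (s x)\<^sup>2"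
proof (cases "x \<in> U")
  case True
  have "exp (- c / s x) / s x ^ k = exp (- c / s x) / s x ^ (k + 2) * (s x)\<^sup>2"
    using assms by (simp add: power_add power2_eq_square)
  also have "\<dots> \<le> fact (k + 2) / c ^ (k + 2) * (s x)\<^sup>2"
    using exp_inverse_bound[OF assms, of "k + 2"] by (intro mult_right_mono) auto
  finally have "\<bar>p x\<bar> * (exp (- c / s x) / s x ^ k) \<le> \<bar>p x\<bar> * (fact (k + 2) / c ^ (k + 2) * (s x)\<^sup>2)"
    by (intro mult_left_mono) auto
  then show ?thesis
    using True assms(2) by (simp add: bump_def abs_mult mult.assoc)
next
  case False
  then show ?thesis using assms by (simp add: bump_def)
qed

text \<open>Inside of \<open>U\<close> this is the product rule, and outside of the closure both sides vanish. At the
  boundary \<open>s\<close> vanishes, so the function is bounded by the square of the distance.\<close>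

lemma bump_has_derivative:
  fixes p s :: "'a::euclidean_space \<Rightarrow> real"
  assumes U: "open U" and s_pos: "\<And>x. x \<in> U \<Longrightarrow> s x > 0" and s_zero: "\<And>x. x \<in> frontier U \<Longrightarrow> s x = 0"
    and c: "c > 0"
    and s': "\<And>x. (s has_derivative s' x) (at x)"
    and p': "\<And>x. (p has_derivative p' x) (at x)"
  shows "(bump U s c k p has_derivative
    (\<lambda>v. bump U s c (k + 2) (\<lambda>x. p' x v * (s x)\<^sup>2 - real k * (p x * s' x v * s x) + c * (p x * s' x v)) x)) (at x)"
proof -
  consider "x \<in> U" | "x \<in> frontier U" | "x \<notin> closure U"
    using U by (auto simp: frontier_def interior_open)
  then show ?thesis
  proof cases
    case 1
    let ?g = "\<lambda>x. p x * exp (- c / s x) / s x ^ k"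
    have ne: "s x \<noteq> 0" using s_pos[OF 1] by simp
    have "(?g has_derivative (\<lambda>v. (p' x v * (s x)\<^sup>2 - real k * (p x * s' x v * s x) + c * (p x * s' x v)) * exp (- c / s x) / s x ^ (k + 2))) (at x)"
      apply (rule has_derivative_eq_rhs)
       apply (rule derivative_eq_intros p' s' refl ne power_not_zero | simp add: ne)+
      apply (rule ext)
      apply (cases k)
      using ne apply (simp_all add: field_simps power2_eq_square power_add)
      done
    then have "(bump U s c k p has_derivative (\<lambda>v. (p' x v * (s x)\<^sup>2 - real k * (p x * s' x v * s x) + c * (p x * s' x v)) * exp (- c / s x) / s x ^ (k + 2))) (at x)"
      by (rule has_derivative_transform_within_open[OF _ U 1]) (simp add: bump_def)
    then show ?thesis
      using 1 by (simp add: bump_def)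
  next
    case 2
    then have x: "x \<notin> U" "s x = 0" using U s_zero by (auto simp: frontier_def interior_open)
    obtain B where B: "B > 0" "\<And>v. norm (s' x v) \<le> norm v * B"
      using has_derivative_bounded_linear[OF s'] bounded_linear.pos_bounded by metis
    have "\<exists>d>0. \<forall>y. norm (y - x) < d \<longrightarrow> norm (s y - s x - s' x (y - x)) \<le> 1 * norm (y - x)"
      using s'[of x] unfolding has_derivative_at_alt by (meson zero_less_one)
    then obtain d1 where d1: "d1 > 0" "\<And>y. norm (y - x) < d1 \<Longrightarrow> norm (s y - s x - s' x (y - x)) \<le> norm (y - x)"
      by auto
    have "isCont p x" using p' has_derivative_continuous by blast
    then obtain d2 where d2: "d2 > 0" "\<And>y. norm (y - x) < d2 \<Longrightarrow> \<bar>p y - p x\<bar> < 1"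
      unfolding continuous_at_eps_delta dist_norm real_norm_def by (meson zero_less_one)
    define C where "C = (\<bar>p x\<bar> + 1) * (fact (k + 2) / c ^ (k + 2)) * (B + 1)\<^sup>2"
    have "C \<ge> 0" using c by (simp add: C_def)
    \<comment> \<open>By differentiability at \<open>x\<close>, \<open>s y\<close> is at most of the order of the distance.\<close>
    have ev: "\<bar>bump U s c k p y\<bar> \<le> C * (norm (y - x))\<^sup>2" if y: "norm (y - x) < d1" "norm (y - x) < d2" for y
    proof (cases "y \<in> U")
      case True
      have "\<bar>s y\<bar> \<le> (B + 1) * norm (y - x)"
        using d1(2)[OF y(1)] B(2)[of "y - x"] x(2) by (auto simp: algebra_simps)
      then have "(s y)\<^sup>2 \<le> ((B + 1) * norm (y - x))\<^sup>2"
        by (meson abs_le_square_iff abs_ge_self order_trans)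
      then have "\<bar>p y\<bar> * (fact (k + 2) / c ^ (k + 2)) * (s y)\<^sup>2 \<le>
          (\<bar>p x\<bar> + 1) * (fact (k + 2) / c ^ (k + 2)) * ((B + 1) * norm (y - x))\<^sup>2"
        using d2(2)[OF y(2)] c by (intro mult_mono mult_right_mono) auto
      also have "\<dots> = C * (norm (y - x))\<^sup>2"
        by (simp only: C_def power_mult_distrib mult.assoc)
      finally show ?thesis
        using bump_quadratic_bound[of c s y U k p, OF c s_pos[OF True]] by simp
    qed (use \<open>C \<ge> 0\<close> in \<open>simp add: bump_def\<close>)
    have "(bump U s c k p has_derivative (\<lambda>v. 0)) (at x)"
      unfolding has_derivative_at_alt
    proof (intro conjI allI impI)
      fix e :: real assume e: "e > 0"
      show "\<exists>d>0. \<forall>y. norm (y - x) < d \<longrightarrow> norm (bump U s c k p y - bump U s c k p x - 0) \<le> e * norm (y - x)"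
      proof (intro exI conjI allI impI)
        show "min (min d1 d2) (e / (C + 1)) > 0" using d1 d2 e \<open>C \<ge> 0\<close> by simp
        fix y assume y: "norm (y - x) < min (min d1 d2) (e / (C + 1))"
        have "C * norm (y - x) \<le> (C + 1) * (e / (C + 1))"
          using y \<open>C \<ge> 0\<close> by (intro mult_mono) auto
        then have "C * norm (y - x) \<le> e" using \<open>C \<ge> 0\<close> by simp
        then have "C * norm (y - x) * norm (y - x) \<le> e * norm (y - x)"
          by (rule mult_right_mono) simp
        with ev[of y] y show "norm (bump U s c k p y - bump U s c k p x - 0) \<le> e * norm (y - x)"
          using x by (simp add: bump_def[of U s c k p x] power2_eq_square mult.assoc)
      qed
    qed simp
    then show ?thesis using x by (simp add: bump_def)
  next
    case 3
    then have "x \<notin> U" using closure_subset by blast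
    have "(bump U s c k p has_derivative (\<lambda>v. 0)) (at x)"
      by (rule has_derivative_transform_within_open[of "\<lambda>_. 0" _ _ _ "- closure U"])
        (use 3 closure_subset[of U] in \<open>auto simp: bump_def\<close>)
    then show ?thesis using \<open>x \<notin> U\<close> by (simp add: bump_def)
  qed
qed

text \<open>By coinduction: all partial derivatives have the same form again.\<close>

lemma smooth_bump:
  fixes p s :: "'a::euclidean_space \<Rightarrow> real" and e :: "'b::real_normed_vector"
  assumes U: "open U" and s_pos: "\<And>x. x \<in> U \<Longrightarrow> s x > 0" and s_zero: "\<And>x. x \<in> frontier U \<Longrightarrow> s x = 0"
    and c: "c > 0" and s: "real_polynomial_function s" and p: "real_polynomial_function p"
  shows "smooth (\<lambda>x. bump U s c k p x *\<^sub>R e)"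
proof -
  obtain s' where s': "\<And>x. (s has_derivative s' x) (at x)" "\<And>v. real_polynomial_function (\<lambda>x. s' x v)"
    using real_polynomial_function_deriv[OF s] by blast
  show ?thesis
    using p
  proof (coinduction arbitrary: k p)
    case smooth
    obtain p' where p': "\<And>x. (p has_derivative p' x) (at x)" "\<And>v. real_polynomial_function (\<lambda>x. p' x v)"
      using real_polynomial_function_deriv[OF smooth] by blast
    define q where "q v x = p' x v * (s x)\<^sup>2 - real k * (p x * s' x v * s x) + c * (p x * s' x v)" for v x
    have q: "real_polynomial_function (q v)" for v
      unfolding q_def using p' s' s smooth by (intro real_polynomial_function.intros(2-4) real_polynomial_function_diff real_polynomial_function_power) auto
    have deriv: "((\<lambda>x. bump U s c k p x *\<^sub>R e) has_derivative (\<lambda>v. bump U s c (k + 2) (q v) x *\<^sub>R e)) (at x)" for x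
      using has_derivative_scaleR_left[OF bump_has_derivative[OF U s_pos s_zero c s'(1) p'(1)]]
      by (simp add: q_def[abs_def])
    show ?case
    proof (intro exI conjI allI disjI1)
      show "(\<lambda>x. bump U s c k p x *\<^sub>R e) = (\<lambda>x. bump U s c k p x *\<^sub>R e)" ..
      show "(\<lambda>x. bump U s c k p x *\<^sub>R e) differentiable at x" for x
        using deriv by (auto simp: differentiable_def)
      show "(\<lambda>x. frechet_derivative (\<lambda>x. bump U s c k p x *\<^sub>R e) (at x) v) = (\<lambda>x. bump U s c (k + 2) (q v) x *\<^sub>R e)" for v
        using frechet_derivative_at[OF deriv] by metis
      show "real_polynomial_function (q v)" for v by (rule q)
    qed
  qed
qed

text \<open>The function \<open>s\<close> is positive in the box and vanishes on its faces. As \<open>c\<close> tends to \<open>0\<close>, these test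
  functions approximate the indicator function of the box.\<close>

definition box_bump :: "'a::euclidean_space \<Rightarrow> 'a \<Rightarrow> real \<Rightarrow> 'a \<Rightarrow> real" where
  "box_bump a b c = bump (box a b) (\<lambda>x. \<Prod>i\<in>Basis. ((x - a) \<bullet> i) * ((b - x) \<bullet> i)) c 0 (\<lambda>_. 1)"

lemma box_bump_eq:
  "box_bump a b c x = indicator (box a b) x * exp (- c / (\<Prod>i\<in>Basis. ((x - a) \<bullet> i) * ((b - x) \<bullet> i)))"
  by (simp add: box_bump_def bump_def)

lemma box_profile_pos: "x \<in> box a b \<Longrightarrow> (\<Prod>i\<in>Basis. ((x - a) \<bullet> i) * ((b - x) \<bullet> i)) > 0"
  by (intro prod_pos) (auto simp: mem_box inner_diff_left)

lemma smooth_box_bump: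
  fixes e :: "'b::real_normed_vector"
  assumes "c > 0"
  shows "smooth (\<lambda>x. box_bump a b c x *\<^sub>R e)"
  unfolding box_bump_def
proof (rule smooth_bump)
  let ?s = "\<lambda>x. \<Prod>i\<in>Basis. ((x - a) \<bullet> i) * ((b - x) \<bullet> i)"
  show "?s x > 0" if "x \<in> box a b" for x
    using that by (rule box_profile_pos)
  show "?s x = 0" if "x \<in> frontier (box a b)" for x
  proof -
    have "x \<in> cbox a b" "x \<notin> box a b"
      using that by (auto simp: frontier_box split: if_splits)
    then obtain i where "i \<in> Basis" "x \<bullet> i = a \<bullet> i \<or> x \<bullet> i = b \<bullet> i"
      unfolding mem_box by (metis order_le_less)
    then show ?thesis
      by (intro prod_zero) (auto simp: inner_diff_left intro!: bexI[of _ i])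
  qed
  have "bounded_linear (\<lambda>x::'a. x \<bullet> i)" for i by (rule bounded_linear_inner_left)
  then show "real_polynomial_function ?s"
    unfolding inner_diff_left
    by (intro real_polynomial_function_prod real_polynomial_function_diff
        real_polynomial_function.intros) auto
qed (use assms in auto)

lemma box_bump_bounds: "c > 0 \<Longrightarrow> 0 \<le> box_bump a b c x \<and> box_bump a b c x \<le> indicator (box a b) x"
  using box_profile_pos[of x a b] by (auto simp: box_bump_eq indicator_def)

lemma box_bump_pos: "x \<in> box a b \<Longrightarrow> box_bump a b c x > 0"
  by (simp add: box_bump_eq)

lemma box_bump_test_function:
  fixes e :: "'b::real_normed_vector"
  assumes "c > 0" "cbox a b \<subseteq> U"
  shows "(\<lambda>x. box_bump a b c x *\<^sub>R e) \<in> test_functions U"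
proof -
  have "closure {x. box_bump a b c x *\<^sub>R e \<noteq> 0} \<subseteq> cbox a b"
    by (intro closure_minimal) (auto simp: box_bump_eq indicator_def box_subset_cbox[THEN subsetD] split: if_splits)
  moreover from this have "bounded (closure {x. box_bump a b c x *\<^sub>R e \<noteq> 0})"
    using bounded_subset[OF bounded_cbox] by blast
  ultimately show ?thesis
    unfolding test_functions_def using smooth_box_bump[OF assms(1), of a b e] assms(2)
    by (auto simp: compact_eq_bounded_closed)
qed

lemma box_bump_tendsto_indicator:
  "(\<lambda>n. box_bump a b (1 / real (Suc n)) x) \<longlonglongrightarrow> indicator (box a b) x"
proof -
  have "(\<lambda>n. (- 1 / S) * inverse (real (Suc n))) \<longlonglongrightarrow> (- 1 / S) * 0" for S :: real
    by (intro tendsto_mult_left LIMSEQ_inverse_real_of_nat)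
  then have "(\<lambda>n. - (1 / real (Suc n)) / S) \<longlonglongrightarrow> 0" for S :: real
    by (simp add: field_simps)
  from tendsto_exp[OF this] have "(\<lambda>n. exp (- (1 / real (Suc n)) / S)) \<longlonglongrightarrow> 1" for S :: real
    by simp
  from tendsto_mult_left[OF this, of "indicator (box a b) x"] show ?thesis
    unfolding box_bump_eq mult_1_right .
qed

lemma smooth_imp_differentiable: "smooth f \<Longrightarrow> f differentiable (at x)"
  by (erule smooth.cases) blast

lemma smooth_frechet: "smooth f \<Longrightarrow> smooth (\<lambda>x. frechet_derivative f (at x) v)"
  by (erule smooth.cases) blast

lemma smooth_imp_continuous: "smooth f \<Longrightarrow> continuous_on S f"
  by (meson continuous_at_imp_continuous_on differentiable_imp_continuous_within smooth_imp_differentiable)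

text \<open>Derivatives of smooth functions are continuous, being differentiable themselves.\<close>

lemma smooth_frechet_continuous: "smooth f \<Longrightarrow> continuous_on S (\<lambda>x. frechet_derivative f (at x) v)"
  by (intro smooth_imp_continuous smooth_frechet)

lemma box_bump_measurable [measurable]:
  assumes "c > 0"
  shows "box_bump a b c \<in> borel_measurable borel"
  using smooth_imp_continuous[OF smooth_box_bump[of c a b "1::real"], of UNIV] assms
  by (intro borel_measurable_continuous_onI) simp

section \<open>The fundamental lemma of the calculus of variations\<close>

text \<open>The boxes form a \<open>\<pi>\<close>-system that generates the Borel sets, so the integral over every Borel set
  vanishes, in particular over \<open>{W > 0}\<close> and \<open>{W < 0}\<close>. The support condition makes the integral over
  the whole space one of the integrals over boxes.\<close>

lemma AE_zero_if_box_integrals_zero: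
  fixes W :: "'a::euclidean_space \<Rightarrow> real"
  assumes int: "integrable lborel W"
    and zero: "\<And>a b. (LINT x:box a b|lborel. W x) = 0"
    and supp: "\<And>x. x \<notin> box p q \<Longrightarrow> W x = 0"
  shows "AE x in lborel. W x = 0"
proof -
  have sint: "set_integrable lborel A W" if "A \<in> sets borel" for A
    unfolding set_integrable_def using int that by (intro integrable_mult_indicator) auto
  have total: "(LINT x|lborel. W x) = 0"
  proof -
    have "(LINT x:box p q|lborel. W x) = (LINT x|lborel. W x)"
      unfolding set_lebesgue_integral_def using supp
      by (intro Bochner_Integration.integral_cong) (auto simp: indicator_def)
    then show ?thesis using zero by simp
  qed
  have all: "(LINT x:A|lborel. W x) = 0" if "A \<in> sets borel" for A
  proof -
    have borel: "sets borel = sigma_sets (UNIV :: 'a set) (range (\<lambda>(a, b). box a b))"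
      unfolding borel_eq_box by (simp add: sets_measure_of)
    have "Int_stable (range (\<lambda>(a, b). box a b :: 'a set))"
      by (auto simp: Int_stable_def box_Int_box)
    moreover have "range (\<lambda>(a, b). box a b) \<subseteq> Pow (UNIV :: 'a set)" by simp
    moreover have "A \<in> sigma_sets UNIV (range (\<lambda>(a, b). box a b))" using that borel by simp
    ultimately show ?thesis
    proof (induction rule: sigma_sets_induct_disjoint)
      case (basic A)
      then show ?case using zero by auto
    next
      case empty
      show ?case by (simp add: set_lebesgue_integral_def)
    next
      case (compl A)
      then have A: "A \<in> sets borel" by (simp add: borel)
      have "(LINT x:A \<union> (UNIV - A)|lborel. W x) = (LINT x:A|lborel. W x) + (LINT x:UNIV - A|lborel. W x)"
        by (intro set_integral_Un sint) (use A in auto)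
      then show ?case using compl total by (simp add: set_lebesgue_integral_def)
    next
      case (union A)
      then have A: "range A \<subseteq> sets borel" by (simp add: borel)
      have "(LINT x:(\<Union>(range A))|lborel. W x) = (\<Sum>i. (LINT x:(A i)|lborel. W x))"
        using union(1) A
        by (intro lebesgue_integral_countable_add sint) (auto simp: disjoint_family_on_def)
      then show ?case using union by simp
    qed
  qed
  have meas: "W \<in> borel_measurable borel" using int by (simp add: borel_measurable_integrable)
  have half: "AE x in lborel. indicator A x * (s * W x) = 0"
    if "A = {x. s * W x > 0}" for A and s :: real
  proof -
    have A: "A \<in> sets borel" using that meas by simp
    have "(LINT x|lborel. indicator A x * (s * W x)) = s * (LINT x:A|lborel. W x)"
      unfolding set_lebesgue_integral_def by (simp add: mult.left_commute flip: integral_mult_right_zero)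
    then have "(LINT x|lborel. indicator A x * (s * W x)) = 0" using all[OF A] by simp
    moreover have "integrable lborel (\<lambda>x. indicator A x * (s * W x))"
      using integrable_mult_indicator[of A lborel "\<lambda>x. s * W x"] A int by simp
    moreover have "AE x in lborel. 0 \<le> indicator A x * (s * W x)"
      using that by (auto simp: indicator_def)
    ultimately show ?thesis
      using integral_nonneg_eq_0_iff_AE by blast
  qed
  show ?thesis
    using half[OF refl, of 1] half[OF refl, of "-1"]
    by eventually_elim (auto simp: indicator_def split: if_splits)
qed

text \<open>The fundamental lemma of the calculus of variations. By dominated convergence the hypothesis
  passes from the bump functions to the indicator functions of boxes compactly contained in \<open>\<Omega>\<close>.\<close>

lemma AE_zero_if_test_integrals_zero:
  fixes w :: "'a::euclidean_space \<Rightarrow> real"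
  assumes \<Omega>: "open \<Omega>" and int: "integrable (lebesgue_on \<Omega>) w"
    and zero: "\<And>a b c. cbox a b \<subseteq> \<Omega> \<Longrightarrow> c > 0 \<Longrightarrow> (LINT x|lebesgue_on \<Omega>. box_bump a b c x * w x) = 0"
  shows "AE x in lebesgue_on \<Omega>. w x = 0"
proof -
  have sets: "\<Omega> \<in> sets lebesgue" using \<Omega> by auto
  define w0 where "w0 x = indicator \<Omega> x * w x" for x
  have int0: "integrable lebesgue w0"
    using int sets by (simp add: w0_def[abs_def] integrable_restrict_space)
  obtain w' where w': "w' \<in> borel_measurable lborel" "AE x in lborel. w0 x = w' x"
    using completion_ex_borel_measurable_real[of w0 lborel] int0 by blast
  have w'_AE: "AE x in lebesgue. w0 x = w' x"
    using w'(2) by (rule AE_completion)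
  have int': "integrable lborel w'"
  proof -
    have "integrable lebesgue w'"
      using int0 w'(1) w'_AE by (intro integrable_cong_AE_imp[OF int0]) (auto simp: measurable_completion)
    then show ?thesis using w'(1) by (simp add: integrable_completion)
  qed
  have box0: "(LINT x:box a b|lborel. w' x) = 0" if ab: "cbox a b \<subseteq> \<Omega>" for a b
  proof -
    have bint: "(LINT x|lborel. box_bump a b (1 / real (Suc n)) x * w' x) = 0" for n
    proof -
      have bm: "box_bump a b (1 / real (Suc n)) \<in> borel_measurable borel"
        by (intro box_bump_measurable) simp
      have "(LINT x|lborel. box_bump a b (1 / real (Suc n)) x * w' x) = (LINT x|lebesgue. box_bump a b (1 / real (Suc n)) x * w' x)"
        using bm w' by (intro integral_completion[symmetric]) auto
      also have "\<dots> = (LINT x|lebesgue. box_bump a b (1 / real (Suc n)) x * w0 x)"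
        using w'_AE bm w' borel_measurable_integrable[OF int0]
        by (intro integral_cong_AE borel_measurable_times) (auto simp: measurable_completion)
      also have "\<dots> = (LINT x|lebesgue_on \<Omega>. box_bump a b (1 / real (Suc n)) x * w x)"
        using sets by (simp add: integral_restrict_space w0_def mult.left_commute)
      finally show ?thesis using zero[OF ab, of "1 / real (Suc n)"] by simp
    qed
    have "(\<lambda>n. LINT x|lborel. box_bump a b (1 / real (Suc n)) x * w' x) \<longlonglongrightarrow> (LINT x|lborel. indicator (box a b) x * w' x)"
    proof (rule integral_dominated_convergence)
      show "integrable lborel (\<lambda>x. \<bar>w' x\<bar>)" using int' by simp
      show "(\<lambda>x. box_bump a b (1 / real (Suc n)) x * w' x) \<in> borel_measurable lborel" for n
        using w'(1) box_bump_measurable[of "1 / real (Suc n)" a b] by simp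
      show "AE x in lborel. (\<lambda>n. box_bump a b (1 / real (Suc n)) x * w' x) \<longlonglongrightarrow> indicator (box a b) x * w' x"
        by (intro AE_I2 tendsto_mult_right box_bump_tendsto_indicator)
      have "\<bar>box_bump a b (1 / real (Suc n)) x\<bar> \<le> 1" for n x
        using box_bump_bounds[of "1 / real (Suc n)" a b x] order_trans[OF _ indicator_le_1[of "box a b" x]] by fastforce
      then show "AE x in lborel. norm (box_bump a b (1 / real (Suc n)) x * w' x) \<le> \<bar>w' x\<bar>" for n
        by (auto simp: abs_mult intro!: mult_left_le_one_le)
    qed (use w' in auto)
    then show ?thesis
      unfolding bint set_lebesgue_integral_def by (simp add: LIMSEQ_const_iff)
  qed
  \<comment> \<open>The faces of a box are null sets, so closed boxes can be used to exhaust \<open>\<Omega>\<close>.\<close>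
  have local: "AE x in lborel. x \<in> cbox p q \<longrightarrow> w' x = 0" if pq: "cbox p q \<subseteq> \<Omega>" for p q
  proof -
    have "AE x in lborel. indicator (box p q) x * w' x = 0"
    proof (rule AE_zero_if_box_integrals_zero)
      show "integrable lborel (\<lambda>x. indicator (box p q) x * w' x)"
        using integrable_mult_indicator[OF _ int', of "box p q"] by simp
      show "indicator (box p q) x * w' x = 0" if "x \<notin> box p q" for x using that by simp
      show "(LINT x:box a b|lborel. indicator (box p q) x * w' x) = 0" for a b
      proof -
        obtain a' b' where ab': "box a b \<inter> box p q = box a' b'"
          by (auto simp: box_Int_box)
        have "(LINT x:box a b|lborel. indicator (box p q) x * w' x) = (LINT x:box a' b'|lborel. w' x)"
          unfolding set_lebesgue_integral_def ab'[symmetric]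
          by (intro Bochner_Integration.integral_cong) (auto simp: indicator_def)
        also have "\<dots> = 0"
        proof (cases "box a' b' = {}")
          case False
          then have "cbox a' b' = closure (box a' b')" by simp
          also have "\<dots> \<subseteq> closure (box p q)" by (intro closure_mono) (use ab' in blast)
          also have "\<dots> \<subseteq> cbox p q" by (intro closure_minimal) (auto simp: box_subset_cbox[THEN subsetD])
          finally show ?thesis using pq by (intro box0) auto
        qed (simp add: set_lebesgue_integral_def)
        finally show ?thesis .
      qed
    qed
    moreover have "AE x in lborel. x \<notin> cbox p q - box p q"
      by (intro AE_not_in) (simp add: null_sets_def emeasure_lborel_cbox_eq emeasure_lborel_box_eq emeasure_Diff box_subset_cbox)
    ultimately show ?thesis by eventually_elim auto
  qed
  obtain \<D> where \<D>: "countable \<D>" "\<D> \<subseteq> Pow \<Omega>" "\<And>X. X \<in> \<D> \<Longrightarrow> \<exists>a b. X = cbox a b" "\<Union>\<D> = \<Omega>"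
    using open_countable_Union_open_cbox[OF \<Omega>] by metis
  have "AE x in lborel. \<forall>X\<in>\<D>. x \<in> X \<longrightarrow> w' x = 0"
  proof (subst AE_ball_countable[OF \<D>(1)], intro ballI)
    fix X assume X: "X \<in> \<D>"
    obtain a b where "X = cbox a b" using \<D>(3)[OF X] by blast
    then show "AE x in lborel. x \<in> X \<longrightarrow> w' x = 0" using local[of a b] \<D>(4) X by blast
  qed
  then have "AE x in lborel. x \<in> \<Omega> \<longrightarrow> w' x = 0"
    by eventually_elim (use \<D> in blast)
  then have "AE x in lebesgue. x \<in> \<Omega> \<longrightarrow> w' x = 0" by (rule AE_completion)
  with w'_AE have "AE x in lebesgue. x \<in> \<Omega> \<longrightarrow> w x = 0"
    by eventually_elim (auto simp: w0_def)
  then show ?thesis using sets by (simp add: AE_restrict_space_iff)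
qed

section \<open>Weak curls\<close>

text \<open>Uniqueness makes \<^const>\<open>curl\<close>, which is defined by choice, linear up to null sets.\<close>

lemma weak_curl_unique:
  assumes \<Omega>: "open \<Omega>" "bounded \<Omega>" and w: "w \<in> L2 \<Omega>" "w' \<in> L2 \<Omega>"
    and "has_weak_curl \<Omega> u w" "has_weak_curl \<Omega> u w'"
  shows "AE x in lebesgue_on \<Omega>. w x = w' x"
proof -
  have lm: "\<Omega> \<in> lmeasurable" using \<Omega> by (intro lmeasurable_open)
  define d where "d x = w x - w' x" for x
  have d: "d \<in> L2 \<Omega>" unfolding d_def[abs_def] using w by (rule L2_diff)
  have *: "AE x in lebesgue_on \<Omega>. d x \<bullet> i = 0" if "i \<in> Basis" for i
  proof (rule AE_zero_if_test_integrals_zero[OF \<Omega>(1)])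
    have i: "(\<lambda>_. i) \<in> L2 \<Omega>" by (rule L2_bounded[OF lm]) auto
    show "integrable (lebesgue_on \<Omega>) (\<lambda>x. d x \<bullet> i)" by (rule L2_integrable_inner[OF d i])
    fix a b and c :: real assume ab: "cbox a b \<subseteq> \<Omega>" "c > 0"
    let ?\<phi> = "\<lambda>x. box_bump a b c x *\<^sub>R i"
    have \<phi>: "?\<phi> \<in> test_functions \<Omega>" using ab by (intro box_bump_test_function)
    have "?\<phi> \<in> L2 \<Omega>"
    proof (rule L2_bounded[OF lm])
      show "?\<phi> \<in> borel_measurable (lebesgue_on \<Omega>)"
        using smooth_imp_continuous[OF smooth_box_bump[OF ab(2), of a b i], of UNIV]
        by (intro measurable_restrict_space1 measurable_completion) (simp add: borel_measurable_continuous_onI)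
      have "\<bar>box_bump a b c x\<bar> \<le> 1" for x
        using box_bump_bounds[OF ab(2), of a b x] order_trans[OF _ indicator_le_1[of "box a b" x]] by fastforce
      then show "AE x in lebesgue_on \<Omega>. norm (?\<phi> x) \<le> 1" using that by simp
    qed
    then have "L2_inner \<Omega> d ?\<phi> = L2_inner \<Omega> w ?\<phi> - L2_inner \<Omega> w' ?\<phi>"
      using L2_inner_add_scaleR_left[OF w, of ?\<phi> "-1"] by (simp add: d_def[abs_def])
    also have "\<dots> = 0" using assms(5,6) \<phi> by (simp add: has_weak_curl_def)
    finally show "(LINT x|lebesgue_on \<Omega>. box_bump a b c x * (d x \<bullet> i)) = 0"
      by (simp add: L2_inner_def)
  qed
  then have "AE x in lebesgue_on \<Omega>. \<forall>i\<in>Basis. d x \<bullet> i = 0"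
    by (intro AE_finite_allI) auto
  then show ?thesis
    by eventually_elim (auto simp: d_def intro: euclidean_eqI[THEN eq_iff_diff_eq_0[THEN iffD2]] simp: euclidean_eq_iff[of "_ - _" 0])
qed

lemma classical_curl_L2:
  assumes \<Omega>: "open \<Omega>" "bounded \<Omega>" and \<phi>: "\<phi> \<in> test_functions \<Omega>"
  shows "classical_curl \<phi> \<in> L2 \<Omega>"
proof -
  have lm: "\<Omega> \<in> lmeasurable" using \<Omega> by (intro lmeasurable_open)
  have sm: "smooth \<phi>" using \<phi> by (simp add: test_functions_def)
  have cont: "continuous_on UNIV (classical_curl \<phi>)"
    unfolding classical_curl_def[abs_def]
    by (intro continuous_on_sum continuous_on_cross continuous_on_const smooth_frechet_continuous[OF sm])
  then have "compact (classical_curl \<phi> ` closure \<Omega>)"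
    using \<Omega> by (intro compact_continuous_image) (auto intro: continuous_on_subset)
  then obtain C where C: "\<And>x. x \<in> closure \<Omega> \<Longrightarrow> norm (classical_curl \<phi> x) \<le> C"
    using compact_imp_bounded bounded_iff by (metis imageI)
  show ?thesis
  proof (rule L2_bounded[OF lm])
    show "classical_curl \<phi> \<in> borel_measurable (lebesgue_on \<Omega>)"
      using cont by (intro measurable_restrict_space1 measurable_completion) (simp add: borel_measurable_continuous_onI)
    show "AE x in lebesgue_on \<Omega>. norm (classical_curl \<phi> x) \<le> C"
      using C closure_subset by (intro AE_I2) (auto simp: space_restrict_space)
  qed
qed

lemma curl_in_L2: "u \<in> Hcurl \<Omega> \<Longrightarrow> curl \<Omega> u \<in> L2 \<Omega>"
  and has_weak_curl_curl: "u \<in> Hcurl \<Omega> \<Longrightarrow> has_weak_curl \<Omega> u (curl \<Omega> u)"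
proof -
  assume "u \<in> Hcurl \<Omega>"
  then have "\<exists>w. w \<in> L2 \<Omega> \<and> has_weak_curl \<Omega> u w" by (auto simp: Hcurl_def)
  from someI_ex[OF this] show "curl \<Omega> u \<in> L2 \<Omega>" "has_weak_curl \<Omega> u (curl \<Omega> u)"
    by (auto simp: curl_def)
qed

lemma has_weak_curl_add_scaleR:
  assumes \<Omega>: "open \<Omega>" "bounded \<Omega>" and u: "u \<in> L2 \<Omega>" "v \<in> L2 \<Omega>" "w \<in> L2 \<Omega>" "z \<in> L2 \<Omega>"
    and "has_weak_curl \<Omega> u w" "has_weak_curl \<Omega> v z"
  shows "has_weak_curl \<Omega> (\<lambda>x. u x + c *\<^sub>R v x) (\<lambda>x. w x + c *\<^sub>R z x)"
  unfolding has_weak_curl_def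
proof
  fix \<phi> :: field assume \<phi>: "\<phi> \<in> test_functions \<Omega>"
  have lm: "\<Omega> \<in> lmeasurable" using \<Omega> by (intro lmeasurable_open)
  have sm: "smooth \<phi>" using \<phi> by (simp add: test_functions_def)
  have "compact (\<phi> ` closure \<Omega>)"
    using \<Omega> by (intro compact_continuous_image smooth_imp_continuous[OF sm]) auto
  then obtain C where C: "\<And>x. x \<in> closure \<Omega> \<Longrightarrow> norm (\<phi> x) \<le> C"
    using compact_imp_bounded bounded_iff by (metis imageI)
  have "\<phi> \<in> L2 \<Omega>"
  proof (rule L2_bounded[OF lm])
    show "\<phi> \<in> borel_measurable (lebesgue_on \<Omega>)"
      using smooth_imp_continuous[OF sm]
      by (intro measurable_restrict_space1 measurable_completion) (simp add: borel_measurable_continuous_onI)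
    show "AE x in lebesgue_on \<Omega>. norm (\<phi> x) \<le> C"
      using C closure_subset by (intro AE_I2) (auto simp: space_restrict_space)
  qed
  then show "L2_inner \<Omega> (\<lambda>x. u x + c *\<^sub>R v x) (classical_curl \<phi>) = L2_inner \<Omega> (\<lambda>x. w x + c *\<^sub>R z x) \<phi>"
    using assms(7,8) \<phi> u classical_curl_L2[OF \<Omega> \<phi>]
    by (simp add: L2_inner_add_scaleR_left has_weak_curl_def)
qed

lemma Hcurl_add_scaleR:
  assumes \<Omega>: "open \<Omega>" "bounded \<Omega>" and u: "u \<in> Hcurl \<Omega>" "v \<in> Hcurl \<Omega>"
  shows "(\<lambda>x. u x + c *\<^sub>R v x) \<in> Hcurl \<Omega>"
proof -
  have "(\<lambda>x. curl \<Omega> u x + c *\<^sub>R curl \<Omega> v x) \<in> L2 \<Omega>" "(\<lambda>x. u x + c *\<^sub>R v x) \<in> L2 \<Omega>"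
    using u by (auto intro!: L2_add_scaleR curl_in_L2 simp: Hcurl_def)
  moreover have "has_weak_curl \<Omega> (\<lambda>x. u x + c *\<^sub>R v x) (\<lambda>x. curl \<Omega> u x + c *\<^sub>R curl \<Omega> v x)"
    using u by (intro has_weak_curl_add_scaleR[OF \<Omega>] curl_in_L2 has_weak_curl_curl) (auto simp: Hcurl_def)
  ultimately show ?thesis unfolding Hcurl_def by blast
qed

lemma curl_add_scaleR:
  assumes \<Omega>: "open \<Omega>" "bounded \<Omega>" and u: "u \<in> Hcurl \<Omega>" "v \<in> Hcurl \<Omega>"
  shows "AE x in lebesgue_on \<Omega>. curl \<Omega> (\<lambda>x. u x + c *\<^sub>R v x) x = curl \<Omega> u x + c *\<^sub>R curl \<Omega> v x"
proof (rule weak_curl_unique[OF \<Omega>])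
  note uv = Hcurl_add_scaleR[OF \<Omega> u, of c]
  show "curl \<Omega> (\<lambda>x. u x + c *\<^sub>R v x) \<in> L2 \<Omega>" "has_weak_curl \<Omega> (\<lambda>x. u x + c *\<^sub>R v x) (curl \<Omega> (\<lambda>x. u x + c *\<^sub>R v x))"
    using curl_in_L2[OF uv] has_weak_curl_curl[OF uv] .
  show "(\<lambda>x. curl \<Omega> u x + c *\<^sub>R curl \<Omega> v x) \<in> L2 \<Omega>"
    using u by (intro L2_add_scaleR curl_in_L2)
  show "has_weak_curl \<Omega> (\<lambda>x. u x + c *\<^sub>R v x) (\<lambda>x. curl \<Omega> u x + c *\<^sub>R curl \<Omega> v x)"
    using u by (intro has_weak_curl_add_scaleR[OF \<Omega>] curl_in_L2 has_weak_curl_curl) (auto simp: Hcurl_def)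
qed

section \<open>Weak time derivatives\<close>

lemma L2_inner_bounded_by:
  fixes g \<psi> :: "vec3 \<Rightarrow> 'b::euclidean_space"
  assumes lm: "\<Omega> \<in> lmeasurable" and \<psi>: "\<psi> \<in> L2 \<Omega>"
    and g: "AE x in lebesgue_on \<Omega>. norm (g x) \<le> C"
  shows "\<bar>L2_inner \<Omega> g \<psi>\<bar> \<le> C * (LINT x|lebesgue_on \<Omega>. norm (\<psi> x))"
proof -
  have "\<bar>L2_inner \<Omega> g \<psi>\<bar> \<le> (LINT x|lebesgue_on \<Omega>. C * norm (\<psi> x))"
    unfolding L2_inner_def
  proof (rule abs_integral_le)
    show "integrable (lebesgue_on \<Omega>) (\<lambda>x. C * norm (\<psi> x))"
      using L2_integrable_norm[OF lm \<psi>] by simp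
    show "AE x in lebesgue_on \<Omega>. \<bar>g x \<bullet> \<psi> x\<bar> \<le> C * norm (\<psi> x)"
      using g by eventually_elim (meson Cauchy_Schwarz_ineq2 mult_right_mono norm_ge_zero order_trans)
  qed
  then show ?thesis by simp
qed

text \<open>Each component of \<open>g\<close> is tested with the indicator function of the set where it exceeds \<open>C\<close>; the
  factor \<open>DIM('b)\<close> comes from passing from components to the norm.\<close>

lemma AE_bounded_if_L2_inner_bounded:
  fixes g :: "vec3 \<Rightarrow> 'b::euclidean_space"
  assumes lm: "\<Omega> \<in> lmeasurable" and g: "g \<in> L2 \<Omega>"
    and bound: "\<And>\<psi>. \<psi> \<in> L2 \<Omega> \<Longrightarrow> \<bar>L2_inner \<Omega> g \<psi>\<bar> \<le> C * (LINT x|lebesgue_on \<Omega>. norm (\<psi> x))"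
  shows "AE x in lebesgue_on \<Omega>. norm (g x) \<le> real DIM('b) * C"
proof -
  have half: "AE x in lebesgue_on \<Omega>. g x \<bullet> (s *\<^sub>R e) \<le> C" if e: "e \<in> Basis" "\<bar>s\<bar> = 1" for e s
  proof -
    define A where "A = {x. x \<in> \<Omega> \<and> g x \<bullet> (s *\<^sub>R e) > C}"
    have A: "A \<in> sets (lebesgue_on \<Omega>)"
    proof -
      have "{x \<in> space (lebesgue_on \<Omega>). g x \<bullet> (s *\<^sub>R e) > C} \<in> sets (lebesgue_on \<Omega>)"
        using L2D(1)[OF g] by (intro borel_measurable_less borel_measurable_inner) auto
      then show ?thesis by (simp add: A_def space_restrict_space)
    qed
    define \<psi> where "\<psi> x = indicator A x *\<^sub>R (s *\<^sub>R e)" for x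
    have n\<psi>: "norm (\<psi> x) = indicator A x" for x using e by (simp add: \<psi>_def abs_mult)
    have \<psi>: "\<psi> \<in> L2 \<Omega>"
    proof (rule L2_bounded[OF lm])
      show "\<psi> \<in> borel_measurable (lebesgue_on \<Omega>)" unfolding \<psi>_def[abs_def] using A by auto
      show "AE x in lebesgue_on \<Omega>. norm (\<psi> x) \<le> 1" unfolding n\<psi> by simp
    qed
    have intA: "integrable (lebesgue_on \<Omega>) (indicator A :: _ \<Rightarrow> real)"
      using L2_integrable_norm[OF lm \<psi>] by (simp add: n\<psi>)
    have intg: "integrable (lebesgue_on \<Omega>) (\<lambda>x. g x \<bullet> \<psi> x)"
      by (rule L2_integrable_inner[OF g \<psi>])
    have "(LINT x|lebesgue_on \<Omega>. g x \<bullet> \<psi> x - C * indicator A x) \<le> 0"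
      using bound[OF \<psi>] intA intg by (simp add: L2_inner_def n\<psi>)
    moreover have nn: "0 \<le> g x \<bullet> \<psi> x - C * indicator A x" for x
      by (auto simp: \<psi>_def A_def indicator_def)
    then have "0 \<le> (LINT x|lebesgue_on \<Omega>. g x \<bullet> \<psi> x - C * indicator A x)"
      by (rule Bochner_Integration.integral_nonneg)
    ultimately have "(LINT x|lebesgue_on \<Omega>. g x \<bullet> \<psi> x - C * indicator A x) = 0"
      by simp
    moreover have "integrable (lebesgue_on \<Omega>) (\<lambda>x. g x \<bullet> \<psi> x - C * indicator A x)"
      using intA intg by simp
    ultimately have "AE x in lebesgue_on \<Omega>. g x \<bullet> \<psi> x - C * indicator A x = 0"
      using integral_nonneg_eq_0_iff_AE nn by blast
    then show ?thesis
    proof (rule lebesgue_on_mono)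
      fix x assume "g x \<bullet> \<psi> x - C * indicator A x = 0" "x \<in> \<Omega>"
      then show "g x \<bullet> (s *\<^sub>R e) \<le> C"
        by (cases "x \<in> A") (auto simp: \<psi>_def A_def)
    qed
  qed
  have "AE x in lebesgue_on \<Omega>. \<forall>e\<in>Basis. \<bar>g x \<bullet> e\<bar> \<le> C"
  proof (intro AE_finite_allI)
    fix e :: 'b assume e: "e \<in> Basis"
    show "AE x in lebesgue_on \<Omega>. \<bar>g x \<bullet> e\<bar> \<le> C"
      using half[OF e abs_one] half[OF e abs_neg_one] by eventually_elim auto
  qed auto
  then show ?thesis
  proof eventually_elim
    case (elim x)
    have "norm (g x) \<le> (\<Sum>e\<in>Basis. \<bar>g x \<bullet> e\<bar>)" by (rule norm_le_l1)
    also have "\<dots> \<le> real DIM('b) * C" using elim by (intro sum_bounded_above) auto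
    finally show ?case .
  qed
qed

lemma continuous_L2_inner:
  assumes lm: "\<Omega> \<in> lmeasurable" and \<psi>: "\<psi> \<in> L2 \<Omega>"
    and u: "time_continuous_on I (Linf_sym \<Omega>) (Linf_norm \<Omega>) u"
  shows "continuous_on I (\<lambda>t. L2_inner \<Omega> (u t) \<psi>)"
  unfolding continuous_on_def
proof
  fix t assume t: "t \<in> I"
  let ?K = "LINT x|lebesgue_on \<Omega>. norm (\<psi> x)"
  have mem: "u s \<in> Linf_sym \<Omega>" if "s \<in> I" for s
    using u that by (auto simp: time_continuous_on_def)
  have "((\<lambda>s. Linf_norm \<Omega> (\<lambda>x. u s x - u t x) * ?K) \<longlongrightarrow> 0 * ?K) (at t within I)"
    using u t by (intro tendsto_mult_right) (auto simp: time_continuous_on_def)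
  then have lim: "((\<lambda>s. Linf_norm \<Omega> (\<lambda>x. u s x - u t x) * ?K) \<longlongrightarrow> 0) (at t within I)"
    unfolding mult_zero_left .
  have "eventually (\<lambda>s. norm (L2_inner \<Omega> (u s) \<psi> - L2_inner \<Omega> (u t) \<psi>) \<le> Linf_norm \<Omega> (\<lambda>x. u s x - u t x) * ?K) (at t within I)"
    unfolding eventually_at_filter
  proof (intro always_eventually allI impI)
    fix s assume "s \<in> I"
    note us = mem[OF this] and ut = mem[OF t]
    have "L2_inner \<Omega> (u s) \<psi> - L2_inner \<Omega> (u t) \<psi> = L2_inner \<Omega> (\<lambda>x. u s x - u t x) \<psi>"
      using L2_inner_add_scaleR_left[OF Linf_sym_L2[OF lm us] Linf_sym_L2[OF lm ut] \<psi>, of "-1"] by simp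
    moreover have "\<exists>c. AE x in lebesgue_on \<Omega>. norm (u s x - u t x) \<le> c"
    proof
      show "AE x in lebesgue_on \<Omega>. norm (u s x - u t x) \<le> Linf_norm \<Omega> (u s) + Linf_norm \<Omega> (u t)"
        using Linf_sym_bounded[OF us] Linf_sym_bounded[OF ut]
        by eventually_elim (meson add_mono norm_triangle_ineq4 order_trans)
    qed
    ultimately show "norm (L2_inner \<Omega> (u s) \<psi> - L2_inner \<Omega> (u t) \<psi>) \<le> Linf_norm \<Omega> (\<lambda>x. u s x - u t x) * ?K"
      using L2_inner_bounded_by[OF lm \<psi> Linf_norm_AE, of "\<lambda>x. u s x - u t x"] by simp
  qed
  from Lim_null_comparison[OF this lim]
  have "((\<lambda>s. L2_inner \<Omega> (u s) \<psi> - L2_inner \<Omega> (u t) \<psi>) \<longlongrightarrow> 0) (at t within I)" .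
  then show "((\<lambda>s. L2_inner \<Omega> (u s) \<psi>) \<longlongrightarrow> L2_inner \<Omega> (u t) \<psi>) (at t within I)"
    by (rule LIM_zero_cancel)
qed

lemma compact_support_integrable:
  fixes F :: "real \<Rightarrow> real"
  assumes "continuous_on {a..b} F" "\<And>t. t \<notin> {a..b} \<Longrightarrow> F t = 0" "{a..b} \<subseteq> S" "S \<in> sets lebesgue"
  shows "integrable (lebesgue_on S) F"
    and "(LINT t|lebesgue_on S. F t) = (LINT t|lborel. indicator {a..b} t *\<^sub>R F t)"
proof -
  have eq: "indicator S t * F t = indicator {a..b} t * F t" for t
    using assms(2,3) by (auto simp: indicator_def)
  have int: "integrable lborel (\<lambda>t. indicator {a..b} t *\<^sub>R F t)"
    using borel_integrable_compact[OF _ assms(1)] by simp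
  then show "integrable (lebesgue_on S) F"
    using assms(4) by (simp add: integrable_restrict_space eq integrable_completion borel_measurable_integrable)
  show "(LINT t|lebesgue_on S. F t) = (LINT t|lborel. indicator {a..b} t *\<^sub>R F t)"
    using assms(4) int by (simp add: integral_restrict_space eq integral_completion borel_measurable_integrable)
qed

lemma integral_deriv_box_bump_zero:
  assumes c: "c > 0" and ab: "{a..b} \<subseteq> {0<..}" "a < b"
  shows "(LINT t|lebesgue_on {0<..}. deriv (box_bump a b c) t) = 0"
proof -
  let ?\<phi> = "box_bump a b c"
  have sm: "smooth ?\<phi>" using smooth_box_bump[OF c, of a b "1::real"] by simp
  have deriv: "(?\<phi> has_field_derivative deriv ?\<phi> t) (at t)" for t
    using smooth_imp_differentiable[OF sm, of t] by (simp add: DERIV_deriv_iff_real_differentiable)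
  have "deriv ?\<phi> t = frechet_derivative ?\<phi> (at t) 1" for t
    using frechet_derivative_at[OF deriv[of t, unfolded has_field_derivative_def]] by (metis mult.right_neutral)
  then have cont: "continuous_on S (deriv ?\<phi>)" for S
    using smooth_frechet_continuous[OF sm, of S 1] by simp
  have out: "deriv ?\<phi> t = 0" if "t \<notin> {a..b}" for t
  proof -
    have "(?\<phi> has_field_derivative 0) (at t)"
      by (rule has_field_derivative_transform_within_open[of "\<lambda>_. 0" 0 t "- {a..b}"])
        (use that in \<open>auto simp: box_bump_eq box_real indicator_def\<close>)
    then show ?thesis by (rule DERIV_imp_deriv)
  qed
  have "(LINT t|lebesgue_on {0<..}. deriv ?\<phi> t) = (LINT t|lborel. indicator {a..b} t *\<^sub>R deriv ?\<phi> t)"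
    by (rule compact_support_integrable[OF cont out ab(1)]) auto
  also have "\<dots> = ?\<phi> b - ?\<phi> a"
    using ab deriv cont
    by (intro integral_FTC_atLeastAtMost)
      (auto intro: has_vector_derivative_at_within simp: has_real_derivative_iff_has_vector_derivative)
  also have "\<dots> = 0" by (simp add: box_bump_eq box_real)
  finally show ?thesis .
qed

text \<open>If \<open>|G|\<close> exceeded \<open>C\<close> at some point, it would do so, with a fixed sign, on an interval, and a bump
  function supported there would violate the bound.\<close>

lemma bounded_if_bump_integrals_bounded:
  fixes G :: "real \<Rightarrow> real"
  assumes T: "T \<ge> 0" and G: "continuous_on {T<..} G"
    and bound: "\<And>a b. T < a \<Longrightarrow> a < b \<Longrightarrow>
      \<bar>LINT t|lebesgue_on {0<..}. box_bump a b 1 t * G t\<bar> \<le> C * (LINT t|lebesgue_on {0<..}. box_bump a b 1 t)"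
    and t: "t > T"
  shows "\<bar>G t\<bar> \<le> C"
proof (rule ccontr)
  assume "\<not> \<bar>G t\<bar> \<le> C"
  moreover define s where "s = sgn (G t)"
  ultimately have s: "s * G t > C" "\<bar>s\<bar> \<le> 1" by (auto simp: abs_sgn mult.commute sgn_if split: if_splits)
  have "open ({T<..} \<inter> (\<lambda>x. s * G x) -` {C<..})"
    by (intro continuous_open_preimage continuous_on_mult_left G) auto
  then obtain d where d: "d > 0" "\<And>x. dist x t < d \<Longrightarrow> T < x \<and> s * G x > C"
    using s t unfolding open_dist by auto
  define a b where "a = t - d / 2" and "b = t + d / 2"
  have ab: "T < x \<and> s * G x > C" if "x \<in> {a..b}" for x
    by (rule d(2)) (use that d(1) in \<open>auto simp: a_def b_def dist_real_def abs_if\<close>)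
  have less: "a < b" and t_in: "t \<in> {a<..<b}" using d(1) by (auto simp: a_def b_def)
  have Ta: "T < a" using ab[of a] less by auto
  let ?\<phi> = "box_bump a b 1"
  have \<phi>_cont: "continuous_on S ?\<phi>" for S
    using smooth_imp_continuous[OF smooth_box_bump[of 1 a b "1::real"]] by simp
  have \<phi>_out: "?\<phi> x = 0" if "x \<notin> {a..b}" for x
    using that by (auto simp: box_bump_eq box_real indicator_def)
  have sub: "{a..b} \<subseteq> {0<..}" using Ta T by auto
  have Gc: "continuous_on {a..b} G" using G by (rule continuous_on_subset) (use ab in auto)
  have int1: "integrable (lebesgue_on {0<..}) ?\<phi>"
    by (rule compact_support_integrable[OF \<phi>_cont \<phi>_out sub]) auto
  have int2: "integrable (lebesgue_on {0<..}) (\<lambda>x. ?\<phi> x * G x)"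
    by (rule compact_support_integrable[OF _ _ sub]) (auto simp: \<phi>_out intro!: continuous_on_mult \<phi>_cont Gc)
  let ?F = "\<lambda>x. ?\<phi> x * (s * G x - C)"
  have intF: "integrable (lebesgue_on {0<..}) ?F"
    using integrable_mult_right[OF int2, of s] integrable_mult_right[OF int1, of C]
    by (simp add: algebra_simps)
  have eqF: "(LINT x|lebesgue_on {0<..}. ?F x) = s * (LINT x|lebesgue_on {0<..}. ?\<phi> x * G x) - C * (LINT x|lebesgue_on {0<..}. ?\<phi> x)"
    using Bochner_Integration.integral_diff[OF integrable_mult_right[OF int2, of s] integrable_mult_right[OF int1, of C]]
    by (simp add: algebra_simps)
  have "s * (LINT x|lebesgue_on {0<..}. ?\<phi> x * G x) \<le> \<bar>s\<bar> * \<bar>LINT x|lebesgue_on {0<..}. ?\<phi> x * G x\<bar>"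
    by (simp flip: abs_mult)
  also have "\<dots> \<le> \<bar>LINT x|lebesgue_on {0<..}. ?\<phi> x * G x\<bar>"
    using s(2) by (intro mult_left_le_one_le) auto
  also have "\<dots> \<le> C * (LINT x|lebesgue_on {0<..}. ?\<phi> x)" by (rule bound[OF Ta less])
  finally have "(LINT x|lebesgue_on {0<..}. ?F x) \<le> 0" using eqF by simp
  moreover have nn: "0 \<le> ?F x" for x
    using ab[of x] box_bump_bounds[of 1 a b x] \<phi>_out[of x] by (cases "x \<in> {a..b}") auto
  then have "0 \<le> (LINT x|lebesgue_on {0<..}. ?F x)"
    by (rule Bochner_Integration.integral_nonneg)
  ultimately have "(LINT x|lebesgue_on {0<..}. ?F x) = 0" by simp
  then have "AE x in lebesgue_on {0<..}. ?F x = 0"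
    using integral_nonneg_eq_0_iff_AE[OF intF] nn by simp
  then have "AE x in lebesgue. x \<in> {0<..} \<longrightarrow> ?F x = 0"
    by (simp add: AE_restrict_space_iff)
  then have "AE x in lebesgue. x \<in> - {a<..<b}"
  proof eventually_elim
    case (elim x)
    show ?case
    proof (rule ComplI)
      assume x: "x \<in> {a<..<b}"
      then have "?\<phi> x > 0" by (intro box_bump_pos) (simp add: box_real)
      with elim ab[of x] x T show False by auto
    qed
  qed
  then have "t \<in> - {a<..<b}" by (intro mem_closed_if_AE_lebesgue) auto
  with t_in show False by auto
qed

lemma dt_properties:
  assumes "u \<in> time_sobolev \<Omega> (Linf_sym \<Omega>) (Linf_norm \<Omega>) 2 \<L>"
  shows "time_continuous_on {0<..} (Linf_sym \<Omega>) (Linf_norm \<Omega>) (dt \<Omega> u)"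
    and "has_weak_time_deriv \<Omega> u (dt \<Omega> u)"
proof -
  obtain D where D: "D 0 = u"
    "\<forall>j<2. time_continuous_on {0<..} (Linf_sym \<Omega>) (Linf_norm \<Omega>) (D j) \<and> has_weak_time_deriv \<Omega> (D j) (D (Suc j))"
    using assms by (auto simp: time_sobolev_def)
  have "time_continuous_on {0<..} (Linf_sym \<Omega>) (Linf_norm \<Omega>) (D 1) \<and> has_weak_time_deriv \<Omega> u (D 1)"
    using D(1) D(2)[rule_format, of 0] D(2)[rule_format, of 1] by simp
  from someI[of "\<lambda>g. time_continuous_on {0<..} (Linf_sym \<Omega>) (Linf_norm \<Omega>) g \<and> has_weak_time_deriv \<Omega> u g", OF this]
  show "time_continuous_on {0<..} (Linf_sym \<Omega>) (Linf_norm \<Omega>) (dt \<Omega> u)" "has_weak_time_deriv \<Omega> u (dt \<Omega> u)"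
    unfolding dt_def by auto
qed

text \<open>The weak derivative moves the time derivative onto the bump function, so bounds on \<^const>\<open>dt\<close> can
  be read off from the pairings of \<open>u\<close> itself with derivatives of bump functions.\<close>

lemma dt_bounded_if_pairings_bounded:
  assumes lm: "\<Omega> \<in> lmeasurable"
    and u: "u \<in> time_sobolev \<Omega> (Linf_sym \<Omega>) (Linf_norm \<Omega>) 2 \<L>" and T: "T \<ge> 0"
    and bound: "\<And>a b \<psi>. T < a \<Longrightarrow> a < b \<Longrightarrow> \<psi> \<in> L2 \<Omega> \<Longrightarrow>
      \<bar>LINT t|lebesgue_on {0<..}. deriv (box_bump a b 1) t * L2_inner \<Omega> (u t) \<psi>\<bar>
        \<le> C * (LINT x|lebesgue_on \<Omega>. norm (\<psi> x)) * (LINT t|lebesgue_on {0<..}. box_bump a b 1 t)"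
    and t: "t > T"
  shows "AE x in lebesgue_on \<Omega>. norm (dt \<Omega> u t x) \<le> real DIM(mat3) * C"
proof (rule AE_bounded_if_L2_inner_bounded[OF lm])
  note dt = dt_properties[OF u]
  have "dt \<Omega> u t \<in> Linf_sym \<Omega>" using dt(1) t T by (auto simp: time_continuous_on_def)
  then show "dt \<Omega> u t \<in> L2 \<Omega>" by (rule Linf_sym_L2[OF lm])
  fix \<psi> :: "vec3 \<Rightarrow> mat3" assume \<psi>: "\<psi> \<in> L2 \<Omega>"
  show "\<bar>L2_inner \<Omega> (dt \<Omega> u t) \<psi>\<bar> \<le> C * (LINT x|lebesgue_on \<Omega>. norm (\<psi> x))"
  proof (rule bounded_if_bump_integrals_bounded[OF T _ _ t])
    show "continuous_on {T<..} (\<lambda>t. L2_inner \<Omega> (dt \<Omega> u t) \<psi>)"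
      by (rule continuous_on_subset[OF continuous_L2_inner[OF lm \<psi> dt(1)]]) (use T in auto)
    fix a b :: real assume ab: "T < a" "a < b"
    have "cbox a b \<subseteq> {0<..}" using ab T by auto
    from box_bump_test_function[OF zero_less_one this, of "1::real"]
    have "box_bump a b 1 \<in> test_functions {0<..}" by simp
    then have "(LINT t|lebesgue_on {0<..}. box_bump a b 1 t * L2_inner \<Omega> (dt \<Omega> u t) \<psi>)
      = - (LINT t|lebesgue_on {0<..}. deriv (box_bump a b 1) t * L2_inner \<Omega> (u t) \<psi>)"
      using dt(2) \<psi> by (simp add: has_weak_time_deriv_def)
    then show "\<bar>LINT t|lebesgue_on {0<..}. box_bump a b 1 t * L2_inner \<Omega> (dt \<Omega> u t) \<psi>\<bar>
      \<le> C * (LINT x|lebesgue_on \<Omega>. norm (\<psi> x)) * (LINT t|lebesgue_on {0<..}. box_bump a b 1 t)"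
      using bound[OF ab \<psi>] by simp
  qed
qed

text \<open>The essentially bounded weak derivative supplied by \<open>u1\<close> and \<open>dt \<Omega> u\<close> have the same pairings with
  test functions, so the bound carries over; continuity makes it hold at every time.\<close>

lemma dt_uniformly_bounded:
  assumes lm: "\<Omega> \<in> lmeasurable"
    and u2: "u \<in> time_sobolev \<Omega> (Linf_sym \<Omega>) (Linf_norm \<Omega>) 2 \<L>"
    and u1: "u \<in> time_sobolev \<Omega> (Linf_sym \<Omega>) (Linf_norm \<Omega>) 1 (Linf_time (Linf_sym \<Omega>) (Linf_norm \<Omega>) {0<..})"
  shows "\<exists>C\<ge>0. \<forall>t>0. AE x in lebesgue_on \<Omega>. norm (dt \<Omega> u t x) \<le> C"
proof -
  obtain D where D0: "D 0 = u" "\<forall>j\<le>1. D j \<in> Linf_time (Linf_sym \<Omega>) (Linf_norm \<Omega>) {0<..}"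
    "\<forall>j<1. has_weak_time_deriv \<Omega> (D j) (D (Suc j))"
    using u1 unfolding time_sobolev_def by blast
  then have D: "D 0 = u" "D 1 \<in> Linf_time (Linf_sym \<Omega>) (Linf_norm \<Omega>) {0<..}"
    "has_weak_time_deriv \<Omega> (D 0) (D 1)"
    by auto
  obtain C where C: "AE t in lebesgue_on {0<..}. Linf_norm \<Omega> (D 1 t) \<le> C"
    and mem: "AE t in lebesgue_on {0<..}. D 1 t \<in> Linf_sym \<Omega>"
    using D(2) by (auto simp: Linf_time_def strongly_measurable_on_def)
  have "AE x in lebesgue_on \<Omega>. norm (dt \<Omega> u t x) \<le> real DIM(mat3) * max C 0" if t: "t > 0" for t
  proof (rule dt_bounded_if_pairings_bounded[OF lm u2 order_refl _ t])
    fix a b :: real and \<psi> :: "vec3 \<Rightarrow> mat3" assume ab: "0 < a" "a < b" and \<psi>: "\<psi> \<in> L2 \<Omega>"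
    let ?K = "LINT x|lebesgue_on \<Omega>. norm (\<psi> x)"
    have "cbox a b \<subseteq> {0<..}" using ab by auto
    from box_bump_test_function[OF zero_less_one this, of "1::real"]
    have "box_bump a b 1 \<in> test_functions {0<..}" by simp
    then have "(LINT t|lebesgue_on {0<..}. deriv (box_bump a b 1) t * L2_inner \<Omega> (u t) \<psi>)
      = - (LINT t|lebesgue_on {0<..}. box_bump a b 1 t * L2_inner \<Omega> (D 1 t) \<psi>)"
      using D \<psi> by (simp add: has_weak_time_deriv_def)
    also have "\<bar>\<dots>\<bar> = \<bar>LINT t|lebesgue_on {0<..}. box_bump a b 1 t * L2_inner \<Omega> (D 1 t) \<psi>\<bar>" by simp
    also have "\<dots> \<le> (LINT t|lebesgue_on {0<..}. max C 0 * ?K * box_bump a b 1 t)"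
    proof (rule abs_integral_le)
      have "integrable (lebesgue_on {0<..}) (box_bump a b 1)"
        using smooth_imp_continuous[OF smooth_box_bump[of 1 a b "1::real"]] ab
        by (intro compact_support_integrable[of a b]) (auto simp: box_bump_eq box_real indicator_def)
      then show "integrable (lebesgue_on {0<..}) (\<lambda>t. max C 0 * ?K * box_bump a b 1 t)" by simp
      show "AE t in lebesgue_on {0<..}. \<bar>box_bump a b 1 t * L2_inner \<Omega> (D 1 t) \<psi>\<bar> \<le> max C 0 * ?K * box_bump a b 1 t"
        using C mem
      proof eventually_elim
        case (elim t)
        have "AE x in lebesgue_on \<Omega>. norm (D 1 t x) \<le> max C 0"
          using Linf_sym_bounded[OF elim(2)] by eventually_elim (use elim(1) in simp)
        from L2_inner_bounded_by[OF lm \<psi> this] show ?case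
          using box_bump_bounds[of 1 a b t] by (simp add: abs_mult mult.commute mult_left_mono)
      qed
    qed
    finally show "\<bar>LINT t|lebesgue_on {0<..}. deriv (box_bump a b 1) t * L2_inner \<Omega> (u t) \<psi>\<bar>
      \<le> max C 0 * ?K * (LINT t|lebesgue_on {0<..}. box_bump a b 1 t)" by simp
  qed
  then show ?thesis by (intro exI[of _ "real DIM(mat3) * max C 0"]) auto
qed

text \<open>The derivative of a bump function has integral \<open>0\<close>, so all pairings vanish beyond \<open>T\<close>.\<close>

lemma dt_zero_if_eventually_constant:
  assumes lm: "\<Omega> \<in> lmeasurable"
    and u: "u \<in> time_sobolev \<Omega> (Linf_sym \<Omega>) (Linf_norm \<Omega>) 2 \<L>"
    and uinf: "uinf \<in> Linf_sym \<Omega>" and T: "T \<ge> 0"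
    and mem: "\<And>t. t > T \<Longrightarrow> u t \<in> Linf_sym \<Omega>"
    and const: "\<And>t. t \<ge> T \<Longrightarrow> AE x in lebesgue_on \<Omega>. u t x = uinf x"
    and t: "t > T"
  shows "AE x in lebesgue_on \<Omega>. dt \<Omega> u t x = 0"
proof -
  have "AE x in lebesgue_on \<Omega>. norm (dt \<Omega> u t x) \<le> real DIM(mat3) * 0"
  proof (rule dt_bounded_if_pairings_bounded[OF lm u T _ t])
    fix a b :: real and \<psi> :: "vec3 \<Rightarrow> mat3" assume ab: "T < a" "a < b" and \<psi>: "\<psi> \<in> L2 \<Omega>"
    let ?\<phi> = "box_bump a b 1"
    have out: "deriv ?\<phi> t = 0" if "t < a" for t
    proof -
      have "(?\<phi> has_field_derivative 0) (at t)"
        by (rule has_field_derivative_transform_within_open[of "\<lambda>_. 0" 0 t "{..<a}"])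
          (use that in \<open>auto simp: box_bump_eq box_real indicator_def\<close>)
      then show ?thesis by (rule DERIV_imp_deriv)
    qed
    have eq: "deriv ?\<phi> t * L2_inner \<Omega> (u t) \<psi> = deriv ?\<phi> t * L2_inner \<Omega> uinf \<psi>" for t
    proof (cases "t < a")
      case False
      then have "t > T" using ab by simp
      then have "L2_inner \<Omega> (u t) \<psi> = L2_inner \<Omega> uinf \<psi>"
        using const[of t] mem[of t] uinf L2D(1)[OF \<psi>]
        by (intro L2_inner_cong_AE) (auto simp: Linf_sym_def)
      then show ?thesis by simp
    qed (simp add: out)
    have "(LINT t|lebesgue_on {0<..}. deriv ?\<phi> t) = 0"
      using ab T by (intro integral_deriv_box_bump_zero) auto
    then have "(LINT t|lebesgue_on {0<..}. deriv ?\<phi> t * L2_inner \<Omega> (u t) \<psi>) = 0"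
      unfolding eq by simp
    then show "\<bar>LINT t|lebesgue_on {0<..}. deriv ?\<phi> t * L2_inner \<Omega> (u t) \<psi>\<bar>
      \<le> 0 * (LINT x|lebesgue_on \<Omega>. norm (\<psi> x)) * (LINT t|lebesgue_on {0<..}. ?\<phi> t)"
      by simp
  qed
  then show ?thesis by simp
qed

section \<open>Hausdorff measure of Lipschitz surfaces and of segments\<close>

text \<open>An upper bound for the two-dimensional content by finite covers of small diameter. Unlike for
  \<^const>\<open>hausdorff2\<close>, whose covers are sequences, finite unions are handled by appending lists.\<close>

definition square_content_le :: "vec3 set \<Rightarrow> real \<Rightarrow> bool" where
  "square_content_le A c \<longleftrightarrow> (\<forall>\<delta>>0. \<exists>Us. A \<subseteq> \<Union>(set Us) \<and>
     (\<forall>U\<in>set Us. bounded U \<and> diameter U \<le> \<delta>) \<and> (\<Sum>U\<leftarrow>Us. (diameter U)\<^sup>2) \<le> c)"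

lemma square_content_le_mono: "square_content_le A c \<Longrightarrow> B \<subseteq> A \<Longrightarrow> c \<le> c' \<Longrightarrow> square_content_le B c'"
  unfolding square_content_le_def by (meson order_trans)

lemma square_content_le_Un:
  assumes "square_content_le A c" "square_content_le B c'"
  shows "square_content_le (A \<union> B) (c + c')"
  unfolding square_content_le_def
proof (intro allI impI)
  fix \<delta> :: real assume \<delta>: "\<delta> > 0"
  obtain Us where Us: "A \<subseteq> \<Union>(set Us)" "\<forall>U\<in>set Us. bounded U \<and> diameter U \<le> \<delta>" "(\<Sum>U\<leftarrow>Us. (diameter U)\<^sup>2) \<le> c"
    using assms(1) \<delta> unfolding square_content_le_def by meson
  obtain Vs where Vs: "B \<subseteq> \<Union>(set Vs)" "\<forall>U\<in>set Vs. bounded U \<and> diameter U \<le> \<delta>" "(\<Sum>U\<leftarrow>Vs. (diameter U)\<^sup>2) \<le> c'"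
    using assms(2) \<delta> unfolding square_content_le_def by meson
  show "\<exists>Us. A \<union> B \<subseteq> \<Union>(set Us) \<and> (\<forall>U\<in>set Us. bounded U \<and> diameter U \<le> \<delta>) \<and> (\<Sum>U\<leftarrow>Us. (diameter U)\<^sup>2) \<le> c + c'"
    using Us Vs by (intro exI[of _ "Us @ Vs"]) auto
qed

lemma square_content_le_Union:
  assumes "finite \<F>" "\<And>A. A \<in> \<F> \<Longrightarrow> \<exists>c. square_content_le A c"
  shows "\<exists>c. square_content_le (\<Union>\<F>) c"
  using assms
proof (induction rule: finite_induct)
  case empty
  have "square_content_le {} 0" unfolding square_content_le_def by (intro allI impI exI[of _ "[]"]) auto
  then show ?case by auto
next
  case (insert A \<F>)
  then show ?case using square_content_le_Un by (metis Union_insert insertCI)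
qed

lemma hausdorff2_le:
  assumes "square_content_le A c"
  shows "hausdorff2 A \<le> ennreal (pi / 4 * c)"
  unfolding hausdorff2_def
proof (rule SUP_least)
  fix \<delta> :: real assume "\<delta> \<in> {0<..}"
  then have \<delta>: "\<delta> > 0" by simp
  obtain Us where Us: "A \<subseteq> \<Union>(set Us)" "\<forall>U\<in>set Us. bounded U \<and> diameter U \<le> \<delta>" "(\<Sum>U\<leftarrow>Us. (diameter U)\<^sup>2) \<le> c"
    using assms \<delta> unfolding square_content_le_def by meson
  define U where "U i = (if i < length Us then Us ! i else {})" for i
  have "hausdorff2_pre \<delta> A \<le> (\<Sum>i. ennreal (pi / 4 * (diameter (U i))\<^sup>2))"
    unfolding hausdorff2_pre_def
  proof (rule INF_lower, safe)
    fix x assume "x \<in> A"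
    then obtain V where "V \<in> set Us" "x \<in> V" using Us(1) by auto
    then show "x \<in> (\<Union>i. U i)" by (auto simp: in_set_conv_nth U_def)
  qed (use Us(2) \<delta> in \<open>auto simp: U_def\<close>)
  also have "\<dots> = (\<Sum>i<length Us. ennreal (pi / 4 * (diameter (U i))\<^sup>2))"
    by (intro suminf_finite) (auto simp: U_def)
  also have "\<dots> = ennreal (\<Sum>i<length Us. pi / 4 * (diameter (Us ! i))\<^sup>2)"
    by (subst sum_ennreal[symmetric]) (auto simp: U_def)
  also have "(\<Sum>i<length Us. pi / 4 * (diameter (Us ! i))\<^sup>2) = pi / 4 * (\<Sum>U\<leftarrow>Us. (diameter U)\<^sup>2)"
    by (simp add: sum_list_sum_nth atLeast0LessThan sum_distrib_left)
  also have "ennreal \<dots> \<le> ennreal (pi / 4 * c)"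
    using Us(3) by (intro ennreal_leI mult_left_mono) auto
  finally show "hausdorff2_pre \<delta> A \<le> ennreal (pi / 4 * c)" .
qed

text \<open>The grid has \<open>N + 1\<close> cells, so that the right end point \<open>a + l\<close> is covered as well.\<close>

lemma exists_grid_cell:
  fixes u a l :: real
  assumes "a \<le> u" "u \<le> a + l" "l > 0" "N > 0"
  shows "\<exists>i\<in>set [0..<Suc N]. real i * (l / real N) \<le> u - a \<and> u - a \<le> (real i + 1) * (l / real N)"
proof (intro bexI conjI)
  let ?w = "l / real N" and ?i = "nat \<lfloor>(u - a) / (l / real N)\<rfloor>"
  have w: "?w > 0" using assms by simp
  have nonneg: "(u - a) / ?w \<ge> 0" using assms w by (intro divide_nonneg_pos) auto
  have i: "real ?i \<le> (u - a) / ?w" "(u - a) / ?w \<le> real ?i + 1"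
    using nonneg by (auto simp: of_nat_nat intro: less_imp_le real_of_int_floor_add_one_gt)
  show "real ?i * ?w \<le> u - a" "u - a \<le> (real ?i + 1) * ?w"
    using i by (simp_all only: pos_le_divide_eq[OF w] pos_divide_le_eq[OF w])
  have "(u - a) / ?w \<le> l / ?w" using assms w by (intro divide_right_mono) auto
  also have "\<dots> = real N" using assms by simp
  finally have "real ?i \<le> real N" using i(1) by linarith
  then show "?i \<in> set [0..<Suc N]" by (simp add: less_Suc_eq_le del: upt_Suc)
qed

text \<open>The image of a square of side \<open>l\<close> under a Lipschitz map: a grid of \<open>(N + 1)\<^sup>2\<close> cells is mapped to
  sets of diameter at most \<open>2 K l / N\<close>, and the sum of the squares stays bounded in \<open>N\<close>.\<close>

lemma square_content_le_surface:
  fixes f :: "real \<Rightarrow> real \<Rightarrow> vec3"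
  assumes lip: "\<And>u v u' v'. norm (f u v - f u' v') \<le> K * (\<bar>u - u'\<bar> + \<bar>v - v'\<bar>)"
    and A: "\<And>x. x \<in> A \<Longrightarrow> \<exists>u\<in>{a..a+l}. \<exists>v\<in>{b..b+l}. x = f u v" and l: "l > 0"
  shows "square_content_le A (16 * K\<^sup>2 * l\<^sup>2)"
  unfolding square_content_le_def
proof (intro allI impI)
  fix \<delta> :: real assume \<delta>: "\<delta> > 0"
  have K: "K \<ge> 0" using order_trans[OF norm_ge_zero lip[of 0 0 1 0]] by simp
  obtain N where "real N > max 1 (2 * K * l / \<delta>)"
    using reals_Archimedean2 by blast
  then have N: "real N > 2 * K * l / \<delta>" "N > 0" by auto
  define w where "w = l / real N"
  have w: "w > 0" using l N by (simp add: w_def)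
  define cell where "cell p = {f u v |u v. real (fst p) * w \<le> u - a \<and> u - a \<le> (real (fst p) + 1) * w
    \<and> real (snd p) * w \<le> v - b \<and> v - b \<le> (real (snd p) + 1) * w}" for p :: "nat \<times> nat"
  have close: "norm (x - y) \<le> 2 * K * w" if "x \<in> cell p" "y \<in> cell p" for x y p
  proof -
    obtain u v u' v' where uv: "x = f u v" "y = f u' v'" "\<bar>u - u'\<bar> \<le> w" "\<bar>v - v'\<bar> \<le> w"
      using \<open>x \<in> cell p\<close> \<open>y \<in> cell p\<close> unfolding cell_def
      by (auto simp: algebra_simps abs_le_iff)
    have "norm (x - y) \<le> K * (\<bar>u - u'\<bar> + \<bar>v - v'\<bar>)" using lip uv by simp
    also have "\<dots> \<le> K * (w + w)" using uv K by (intro mult_left_mono) auto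
    finally show ?thesis by simp
  qed
  have diam: "0 \<le> diameter (cell p) \<and> bounded (cell p) \<and> diameter (cell p) \<le> 2 * K * w" for p
  proof (intro conjI)
    show "bounded (cell p)"
      unfolding bounded_two_points dist_norm using close by blast
    then show "0 \<le> diameter (cell p)" by (rule diameter_ge_0)
    show "diameter (cell p) \<le> 2 * K * w" using close K w by (intro diameter_le) auto
  qed
  have "2 * K * w \<le> \<delta>" using N \<delta> by (simp add: w_def field_simps)
  let ?Us = "map cell (List.product [0..<Suc N] [0..<Suc N])"
  have "A \<subseteq> \<Union>(set ?Us)"
  proof
    fix x assume "x \<in> A"
    then obtain u v where uv: "u \<in> {a..a+l}" "v \<in> {b..b+l}" "x = f u v" using A by blast
    have "\<exists>i\<in>set [0..<Suc N]. real i * w \<le> u - a \<and> u - a \<le> (real i + 1) * w"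
      unfolding w_def by (rule exists_grid_cell) (use uv l N(2) in auto)
    then obtain i where i: "i \<in> set [0..<Suc N]" "real i * w \<le> u - a" "u - a \<le> (real i + 1) * w"
      by blast
    have "\<exists>j\<in>set [0..<Suc N]. real j * w \<le> v - b \<and> v - b \<le> (real j + 1) * w"
      unfolding w_def by (rule exists_grid_cell) (use uv l N(2) in auto)
    then obtain j where j: "j \<in> set [0..<Suc N]" "real j * w \<le> v - b" "v - b \<le> (real j + 1) * w"
      by blast
    have "x \<in> cell (i, j)" unfolding cell_def using i j uv by auto
    moreover have "cell (i, j) \<in> set ?Us" using i(1) j(1) by (simp only: set_map set_product) blast
    ultimately show "x \<in> \<Union>(set ?Us)" by blast
  qed
  moreover have "(\<Sum>U\<leftarrow>?Us. (diameter U)\<^sup>2) \<le> 16 * K\<^sup>2 * l\<^sup>2"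
  proof -
    have "(\<Sum>U\<leftarrow>?Us. (diameter U)\<^sup>2) \<le> (\<Sum>p\<leftarrow>List.product [0..<Suc N] [0..<Suc N]. (2 * K * w)\<^sup>2)"
      unfolding map_map o_def using diam by (intro sum_list_mono power_mono) auto
    also have "\<dots> = (real N + 1)\<^sup>2 * (2 * K * w)\<^sup>2"
      by (simp add: sum_list_triv length_product power2_eq_square algebra_simps)
    also have "\<dots> \<le> (2 * real N)\<^sup>2 * (2 * K * w)\<^sup>2"
      using N(2) by (intro mult_right_mono power_mono) auto
    also have "\<dots> = 16 * K\<^sup>2 * l\<^sup>2" using N(2) by (simp add: w_def power2_eq_square)
    finally show ?thesis .
  qed
  moreover have "\<forall>U\<in>set ?Us. bounded U \<and> diameter U \<le> \<delta>"
    using diam \<open>2 * K * w \<le> \<delta>\<close> by (auto intro: order_trans)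
  ultimately show "\<exists>Us. A \<subseteq> \<Union>(set Us) \<and> (\<forall>U\<in>set Us. bounded U \<and> diameter U \<le> \<delta>) \<and> (\<Sum>U\<leftarrow>Us. (diameter U)\<^sup>2) \<le> 16 * K\<^sup>2 * l\<^sup>2"
    by blast
qed

text \<open>A segment is covered by \<open>N + 1\<close> pieces whose squared diameters are of order \<open>1 / N\<^sup>2\<close>.\<close>

lemma square_content_le_segment:
  assumes "c > 0"
  shows "square_content_le (closed_segment p q) c"
  unfolding square_content_le_def
proof (intro allI impI)
  fix \<delta> :: real assume \<delta>: "\<delta> > 0"
  define K where "K = norm (q - p)"
  have K: "K \<ge> 0" by (simp add: K_def)
  obtain N where "real N > max 1 (max (K / \<delta>) (2 * K\<^sup>2 / c))"
    using reals_Archimedean2 by blast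
  then have N: "real N > K / \<delta>" "real N > 2 * K\<^sup>2 / c" "N > 0"
    by auto
  define w where "w = 1 / real N"
  have w: "w > 0" using N by (simp add: w_def)
  define cell where "cell i = {p + s *\<^sub>R (q - p) |s. real i * w \<le> s \<and> s \<le> (real i + 1) * w}" for i :: nat
  have close: "norm (x - y) \<le> K * w" if xy: "x \<in> cell i" "y \<in> cell i" for x y i
  proof -
    obtain s s' where s: "x = p + s *\<^sub>R (q - p)" "y = p + s' *\<^sub>R (q - p)"
      and "real i * w \<le> s" "s \<le> (real i + 1) * w" "real i * w \<le> s'" "s' \<le> (real i + 1) * w"
      using xy unfolding cell_def by blast
    then have "\<bar>s - s'\<bar> \<le> w" by (simp add: algebra_simps abs_le_iff)
    have "x - y = (s - s') *\<^sub>R (q - p)" unfolding s by (simp add: scaleR_left_diff_distrib)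
    then have "norm (x - y) = \<bar>s - s'\<bar> * K" by (simp add: K_def)
    also have "\<dots> \<le> w * K" using \<open>\<bar>s - s'\<bar> \<le> w\<close> K by (rule mult_right_mono)
    finally show ?thesis by (simp add: mult.commute)
  qed
  have diam: "0 \<le> diameter (cell i) \<and> bounded (cell i) \<and> diameter (cell i) \<le> K * w" for i
  proof (intro conjI)
    show "bounded (cell i)"
      unfolding bounded_two_points dist_norm using close by blast
    then show "0 \<le> diameter (cell i)" by (rule diameter_ge_0)
    show "diameter (cell i) \<le> K * w" using close K w by (intro diameter_le) auto
  qed
  have "K * w \<le> \<delta>" using N \<delta> by (simp add: w_def field_simps)
  let ?Us = "map cell [0..<Suc N]"
  have "closed_segment p q \<subseteq> \<Union>(set ?Us)"
  proof
    fix x assume "x \<in> closed_segment p q"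
    then obtain s where s: "0 \<le> s" "s \<le> 1" "x = (1 - s) *\<^sub>R p + s *\<^sub>R q" by (auto simp: in_segment)
    then have x: "x = p + s *\<^sub>R (q - p)" by (simp add: algebra_simps)
    have "\<exists>i\<in>set [0..<Suc N]. real i * w \<le> s - 0 \<and> s - 0 \<le> (real i + 1) * w"
      unfolding w_def by (rule exists_grid_cell) (use s N(3) in auto)
    then obtain i where i: "i \<in> set [0..<Suc N]" "real i * w \<le> s" "s \<le> (real i + 1) * w"
      unfolding diff_0_right by blast
    have "x \<in> cell i" unfolding cell_def using i x by blast
    then show "x \<in> \<Union>(set ?Us)" using i(1) unfolding set_map by blast
  qed
  moreover have "(\<Sum>U\<leftarrow>?Us. (diameter U)\<^sup>2) \<le> c"
  proof -
    have "(\<Sum>U\<leftarrow>?Us. (diameter U)\<^sup>2) \<le> (\<Sum>p\<leftarrow>[0..<Suc N]. (K * w)\<^sup>2)"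
      unfolding map_map o_def using diam by (intro sum_list_mono power_mono) auto
    also have "\<dots> = (real N + 1) * (K * w)\<^sup>2"
      by (simp add: sum_list_triv algebra_simps)
    also have "\<dots> \<le> (2 * real N) * (K * w)\<^sup>2"
      using N(3) by (intro mult_right_mono) auto
    also have "\<dots> = 2 * K\<^sup>2 / real N" using N(3) by (simp add: w_def power2_eq_square)
    also have "\<dots> \<le> c" using N assms by (simp add: field_simps)
    finally show ?thesis .
  qed
  moreover have "\<forall>U\<in>set ?Us. bounded U \<and> diameter U \<le> \<delta>"
    using diam \<open>K * w \<le> \<delta>\<close> by (auto intro: order_trans)
  ultimately show "\<exists>Us. closed_segment p q \<subseteq> \<Union>(set Us) \<and> (\<forall>U\<in>set Us. bounded U \<and> diameter U \<le> \<delta>) \<and> (\<Sum>U\<leftarrow>Us. (diameter U)\<^sup>2) \<le> c"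
    by blast
qed

text \<open>By definition of \<^const>\<open>measure_of\<close>, the measure either has the values of \<^const>\<open>hausdorff2\<close> or vanishes
  identically; the upper bound holds in both cases.\<close>

lemma emeasure_surface_le:
  assumes "B \<in> sets borel" "B \<subseteq> frontier \<Omega>"
  shows "B \<in> sets (measure_of (frontier \<Omega>) {B \<in> sets borel. B \<subseteq> frontier \<Omega>} hausdorff2)"
    and "emeasure (measure_of (frontier \<Omega>) {B \<in> sets borel. B \<subseteq> frontier \<Omega>} hausdorff2) B \<le> hausdorff2 B"
proof -
  let ?A = "{B \<in> sets borel. B \<subseteq> frontier \<Omega>}"
  have B: "B \<in> sigma_sets (frontier \<Omega>) ?A" using assms by (intro sigma_sets.Basic) simp
  then show "B \<in> sets (measure_of (frontier \<Omega>) ?A hausdorff2)"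
    by (subst sets_measure_of) auto
  show "emeasure (measure_of (frontier \<Omega>) ?A hausdorff2) B \<le> hausdorff2 B"
    by (subst emeasure_measure_of_conv) simp
qed

lemma hausdorff2_segment: "A \<subseteq> closed_segment p q \<Longrightarrow> hausdorff2 A = 0"
proof -
  assume A: "A \<subseteq> closed_segment p q"
  have "hausdorff2 A \<le> ennreal (pi / 4 * c)" if "c > 0" for c
    using square_content_le_mono[OF square_content_le_segment[OF that] A order_refl] by (rule hausdorff2_le)
  from this[of "4 / pi * e" for e] have "hausdorff2 A \<le> 0 + ennreal e" if "e > 0" for e
    using that by simp
  from ennreal_le_epsilon[OF this] have "hausdorff2 A \<le> 0" by simp
  then show ?thesis by simp
qed

lemma surface_AE_not_in_segment:
  "AE x in surface_measure \<Omega>. x \<notin> closed_segment p q"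
proof -
  let ?M = "measure_of (frontier \<Omega>) {B \<in> sets borel. B \<subseteq> frontier \<Omega>} hausdorff2"
  let ?B = "closed_segment p q \<inter> frontier \<Omega>"
  have B: "?B \<in> sets borel" by (intro sets.Int borel_closed closed_segment frontier_closed)
  have "?B \<in> null_sets ?M"
    using emeasure_surface_le[OF B] hausdorff2_segment[of ?B p q] by (auto simp: null_sets_def)
  then have "AE x in ?M. x \<notin> ?B" by (rule AE_not_in)
  moreover have "AE x in ?M. x \<in> frontier \<Omega>"
    by (rule AE_I2) (simp add: space_measure_of_conv)
  ultimately have "AE x in ?M. x \<notin> closed_segment p q" by eventually_elim auto
  then show ?thesis unfolding surface_measure_def by (rule AE_completion)
qed

section \<open>The boundary of a meshed Lipschitz domain\<close>

text \<open>In a chart, \<open>\<Omega>\<close> lies above the graph of \<open>g\<close> and its frontier on the graph; the points below the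
  graph form an open set disjoint from \<open>\<Omega>\<close>.\<close>

lemma lipschitz_chart_properties:
  fixes A :: "vec3 \<Rightarrow> vec3" and g :: "real \<times> real \<Rightarrow> real"
  assumes \<Omega>: "open \<Omega>" and U: "open U" and A: "orthogonal_transformation A" and g: "L-lipschitz_on UNIV g"
    and chart: "\<Omega> \<inter> U = {x \<in> U. g (A x $ 1, A x $ 2) < A x $ 3}"
  shows "z \<in> frontier \<Omega> \<Longrightarrow> z \<in> U \<Longrightarrow> A z $ 3 = g (A z $ 1, A z $ 2)"
    and "z \<in> U \<Longrightarrow> A z $ 3 < g (A z $ 1, A z $ 2) \<Longrightarrow> z \<notin> closure \<Omega>"
proof -
  have lin: "bounded_linear A" using A orthogonal_transformation_linear linear_conv_bounded_linear by blast
  have contA: "continuous_on S (\<lambda>x. A x $ i)" for S i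
    by (intro continuous_on_component linear_continuous_on lin)
  have contg: "continuous_on S g" for S
    using lipschitz_on_continuous_on[OF g] continuous_on_subset by blast
  have "continuous_on S (\<lambda>x. g (A x $ 1, A x $ 2))" for S
    by (rule continuous_on_compose2[OF contg[of UNIV]]) (auto intro!: continuous_on_Pair contA)
  then have op: "open {x. A x $ 3 < g (A x $ 1, A x $ 2)}"
    by (intro open_Collect_less contA)
  show below: "z \<notin> closure \<Omega>" if "z \<in> U" "A z $ 3 < g (A z $ 1, A z $ 2)" for z
  proof -
    have "open (U \<inter> {x. A x $ 3 < g (A x $ 1, A x $ 2)})" using U op by blast
    moreover have "(U \<inter> {x. A x $ 3 < g (A x $ 1, A x $ 2)}) \<inter> \<Omega> = {}"
    proof -
      have "g (A x $ 1, A x $ 2) < A x $ 3" if "x \<in> \<Omega>" "x \<in> U" for x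
        using chart that by blast
      then show ?thesis by fastforce
    qed
    ultimately show ?thesis using that open_Int_closure_eq_empty by blast
  qed
  show "A z $ 3 = g (A z $ 1, A z $ 2)" if "z \<in> frontier \<Omega>" "z \<in> U"
  proof -
    have "z \<notin> \<Omega>" "z \<in> closure \<Omega>" using that \<Omega> by (auto simp: frontier_def interior_open)
    then have "\<not> g (A z $ 1, A z $ 2) < A z $ 3" using chart that by blast
    with below[of z] \<open>z \<in> closure \<Omega>\<close> that show ?thesis by fastforce
  qed
qed

text \<open>A boundary point can be moved below the graph of its chart by an arbitrarily small amount, and
  thus out of the closure. Consequently the interiors of the tetrahedra, whose union is only
  known to fill the closure of \<open>\<Omega>\<close>, lie inside of \<open>\<Omega>\<close>.\<close>

lemma lipschitz_domain_regular_open: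
  assumes \<Omega>: "open \<Omega>" and lip: "lipschitz_boundary \<Omega>"
  shows "interior (closure \<Omega>) = \<Omega>"
proof
  show "\<Omega> \<subseteq> interior (closure \<Omega>)" using \<Omega> by (intro interior_maximal closure_subset)
  show "interior (closure \<Omega>) \<subseteq> \<Omega>"
  proof
    fix x assume x: "x \<in> interior (closure \<Omega>)"
    show "x \<in> \<Omega>"
    proof (rule ccontr)
      assume "x \<notin> \<Omega>"
      then have xf: "x \<in> frontier \<Omega>" using x \<Omega> interior_subset[of "closure \<Omega>"] by (auto simp: frontier_def interior_open)
      then obtain U A L g where U: "open U" "x \<in> U" and A: "orthogonal_transformation (A :: vec3 \<Rightarrow> vec3)"
        and g: "L-lipschitz_on UNIV (g :: real \<times> real \<Rightarrow> real)"
        and chart: "\<Omega> \<inter> U = {x \<in> U. g (A x $ 1, A x $ 2) < A x $ 3}"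
        using lip unfolding lipschitz_boundary_def by meson
      have "open (U \<inter> interior (closure \<Omega>))" using U by auto
      then obtain r where r: "r > 0" "ball x r \<subseteq> U \<inter> interior (closure \<Omega>)"
        using U x openE[of _ x] by (metis IntI)
      \<comment> \<open>The point \<open>y\<close> lies below \<open>x\<close> in the coordinates of the chart.\<close>
      define y where "y = x - inv A ((r / 2) *\<^sub>R axis 3 1)"
      have lin: "linear A" "bij A" and linv: "orthogonal_transformation (inv A)"
        using A orthogonal_transformation_linear orthogonal_transformation_bij orthogonal_transformation_inv by auto
      have "norm (inv A ((r / 2) *\<^sub>R axis 3 1)) = r / 2"
        using orthogonal_transformation_norm[OF linv] r by simp
      then have y: "y \<in> ball x r" using r by (simp add: y_def dist_norm)
      have Ay: "A y = A x - (r / 2) *\<^sub>R axis 3 1"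
        using lin by (simp add: y_def linear_diff bij_is_surj surj_f_inv_f)
      have "A x $ 3 = g (A x $ 1, A x $ 2)"
        by (rule lipschitz_chart_properties(1)[OF \<Omega> U(1) A g chart xf U(2)])
      then have "A y $ 3 < g (A y $ 1, A y $ 2)" using r(1) by (simp add: Ay axis_def)
      with y r(2) have "y \<notin> closure \<Omega>"
        by (intro lipschitz_chart_properties(2)[OF \<Omega> U(1) A g chart]) auto
      then show False using y r(2) interior_subset by blast
    qed
  qed
qed

text \<open>The frontier is compact and locally a Lipschitz image of a square.\<close>

lemma hausdorff2_frontier_finite:
  assumes \<Omega>: "open \<Omega>" "bounded \<Omega>" and lip: "lipschitz_boundary \<Omega>"
  shows "hausdorff2 (frontier \<Omega>) < \<infinity>"
proof -
  have loc: "\<exists>V c. open V \<and> p \<in> V \<and> square_content_le (V \<inter> frontier \<Omega>) c" if p: "p \<in> frontier \<Omega>" for p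
  proof -
    obtain U A L g where U: "open U" "p \<in> U" and A: "orthogonal_transformation (A :: vec3 \<Rightarrow> vec3)"
      and g: "L-lipschitz_on UNIV (g :: real \<times> real \<Rightarrow> real)"
      and chart: "\<Omega> \<inter> U = {x \<in> U. g (A x $ 1, A x $ 2) < A x $ 3}"
      using lip p unfolding lipschitz_boundary_def by meson
    have bij: "bij A" and linv: "orthogonal_transformation (inv A)"
      using A orthogonal_transformation_bij orthogonal_transformation_inv by auto
    define f where "f u v = inv A (vector [u, v, g (u, v)])" for u v
    let ?V = "U \<inter> ball p 1"
    have "square_content_le (?V \<inter> frontier \<Omega>) (16 * (L + 1)\<^sup>2 * 2\<^sup>2)"
    proof (rule square_content_le_surface)
      fix u v u' v'
      have L: "L \<ge> 0" using g by (rule lipschitz_on_nonneg)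
      have "norm (f u v - f u' v') = norm (inv A (vector [u, v, g (u, v)] - vector [u', v', g (u', v')]))"
        using orthogonal_transformation_linear[OF linv] by (simp add: f_def linear_diff)
      also have "\<dots> = norm (vector [u, v, g (u, v)] - vector [u', v', g (u', v')] :: vec3)"
        by (rule orthogonal_transformation_norm[OF linv])
      also have "\<dots> \<le> (\<Sum>i\<in>UNIV. \<bar>(vector [u, v, g (u, v)] - vector [u', v', g (u', v')] :: vec3) $ i\<bar>)"
        by (rule norm_le_l1_cart)
      also have "\<dots> = \<bar>u - u'\<bar> + \<bar>v - v'\<bar> + \<bar>g (u, v) - g (u', v')\<bar>"
        by (simp add: sum_3)
      finally have "norm (f u v - f u' v') \<le> \<bar>u - u'\<bar> + \<bar>v - v'\<bar> + \<bar>g (u, v) - g (u', v')\<bar>" .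
      moreover have "\<bar>g (u, v) - g (u', v')\<bar> \<le> L * dist (u, v) (u', v')"
        using lipschitz_onD[OF g, of "(u, v)" "(u', v')"] by (simp add: dist_real_def)
      moreover have "dist (u, v) (u', v') \<le> \<bar>u - u'\<bar> + \<bar>v - v'\<bar>"
        unfolding dist_Pair_Pair dist_real_def using sqrt_sum_squares_le_sum_abs by (metis abs_abs)
      then have "L * dist (u, v) (u', v') \<le> L * (\<bar>u - u'\<bar> + \<bar>v - v'\<bar>)"
        using L by (rule mult_left_mono)
      ultimately show "norm (f u v - f u' v') \<le> (L + 1) * (\<bar>u - u'\<bar> + \<bar>v - v'\<bar>)"
        by (simp add: distrib_right)
    next
      fix z assume z: "z \<in> ?V \<inter> frontier \<Omega>"
      have g3: "A z $ 3 = g (A z $ 1, A z $ 2)"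
        using z by (intro lipschitz_chart_properties(1)[OF \<Omega>(1) U(1) A g chart]) auto
      have "vector [A z $ 1, A z $ 2, A z $ 3] = A z"
        by (simp add: vec_eq_iff forall_3)
      then have zf: "z = f (A z $ 1) (A z $ 2)"
        unfolding f_def g3[symmetric] using bij by (simp add: bij_is_inj)
      have comp: "\<bar>A z $ i - A p $ i\<bar> \<le> 1" for i
      proof -
        have "\<bar>A z $ i - A p $ i\<bar> \<le> norm (A z - A p)"
          using component_le_norm_cart[of "A z - A p" i] by simp
        also have "\<dots> = norm (z - p)"
          using A orthogonal_transformation_linear[OF A] orthogonal_transformation_norm[OF A, of "z - p"] by (simp add: linear_diff)
        finally show ?thesis using z by (simp add: dist_norm norm_minus_commute)
      qed
      show "\<exists>u\<in>{A p $ 1 - 1..A p $ 1 - 1 + 2}. \<exists>v\<in>{A p $ 2 - 1..A p $ 2 - 1 + 2}. z = f u v"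
        using zf comp[of 1] comp[of 2] by (intro bexI[of _ "A z $ 1"] bexI[of _ "A z $ 2"]) auto
    qed simp
    then show ?thesis using U by (intro exI[of _ ?V]) auto
  qed
  define \<C> where "\<C> = {V. open V \<and> (\<exists>c. square_content_le (V \<inter> frontier \<Omega>) c)}"
  have "compact (frontier \<Omega>)" using \<Omega>(2) by (rule compact_frontier_bounded)
  moreover have "frontier \<Omega> \<subseteq> \<Union>\<C>" "\<forall>V\<in>\<C>. open V" using loc unfolding \<C>_def by blast+
  ultimately obtain \<D> where \<D>: "\<D> \<subseteq> \<C>" "finite \<D>" "frontier \<Omega> \<subseteq> \<Union>\<D>"
    unfolding compact_eq_Heine_Borel by meson
  have "\<exists>c. square_content_le (\<Union>((\<lambda>V. V \<inter> frontier \<Omega>) ` \<D>)) c"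
    using \<D> by (intro square_content_le_Union) (auto simp: \<C>_def)
  then obtain c where "square_content_le (\<Union>((\<lambda>V. V \<inter> frontier \<Omega>) ` \<D>)) c" ..
  then have "square_content_le (frontier \<Omega>) c"
    by (rule square_content_le_mono) (use \<D>(3) in auto)
  then show ?thesis using hausdorff2_le by (metis ennreal_less_top infinity_ennreal_def order_le_less_trans)
qed

lemma finite_surface_measure:
  assumes "open \<Omega>" "bounded \<Omega>" "lipschitz_boundary \<Omega>"
  shows "finite_measure (surface_measure \<Omega>)"
proof
  let ?M = "measure_of (frontier \<Omega>) {B \<in> sets borel. B \<subseteq> frontier \<Omega>} hausdorff2"
  have space: "space ?M = frontier \<Omega>" by (simp add: space_measure_of_conv)
  have "frontier \<Omega> \<in> sets borel" by (simp add: borel_closed frontier_closed)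
  then have "emeasure ?M (frontier \<Omega>) < \<infinity>" "frontier \<Omega> \<in> sets ?M"
    using emeasure_surface_le[of "frontier \<Omega>" \<Omega>] hausdorff2_frontier_finite[OF assms] by auto
  then show "emeasure (surface_measure \<Omega>) (space (surface_measure \<Omega>)) \<noteq> \<infinity>"
    unfolding surface_measure_def by (simp add: space)
qed

text \<open>A point \<open>y\<close> of the half ball lies on the segment from \<open>z\<close> to a point \<open>p\<close> of the hyperplane, and \<open>p\<close> is
  close to \<open>x\<close> if \<open>y\<close> is.\<close>

lemma half_ball_in_convex:
  fixes K :: "vec3 set"
  assumes K: "convex K" and z: "z \<in> K" "a \<bullet> z < \<beta>" and x: "a \<bullet> x = \<beta>"
    and r0: "r0 > 0" "\<And>y. y \<in> ball x r0 \<Longrightarrow> a \<bullet> y = \<beta> \<Longrightarrow> y \<in> K"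
  shows "\<exists>r>0. \<forall>y \<in> ball x r. a \<bullet> y \<le> \<beta> \<longrightarrow> y \<in> K"
proof -
  define s where "s = \<beta> - a \<bullet> z"
  have s: "s > 0" using z by (simp add: s_def)
  \<comment> \<open>The map from \<open>y\<close> to \<open>p\<close> enlarges the distance from \<open>x\<close> at most by the factor \<open>M\<close>.\<close>
  define M where "M = 2 * (1 + norm a * norm (z - x) / s)"
  have M: "M \<ge> 2" using s by (simp add: M_def)
  define r where "r = min (s / (2 * (norm a + 1))) (r0 / M)"
  have na: "norm a + 1 > 0" by (simp add: add_nonneg_pos)
  have r: "r > 0" using s r0 M na by (simp add: r_def)
  have "y \<in> K" if y: "y \<in> ball x r" and ay: "a \<bullet> y \<le> \<beta>" for y
  proof -
    define l where "l = (\<beta> - a \<bullet> y) / s"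
    have ny: "norm (y - x) < r" using y by (simp add: dist_norm norm_minus_commute)
    have "\<beta> - a \<bullet> y = a \<bullet> (x - y)" using x by (simp add: inner_diff_right)
    also have "\<dots> \<le> norm a * norm (y - x)" using Cauchy_Schwarz_ineq2[of a "x - y"] by (simp add: norm_minus_commute)
    finally have le: "\<beta> - a \<bullet> y \<le> norm a * norm (y - x)" .
    have l0: "l \<ge> 0" using ay s by (simp add: l_def)
    have l1: "l \<le> norm a * norm (y - x) / s" using le s by (simp add: l_def divide_right_mono)
    have "norm a * norm (y - x) \<le> norm a * r" using ny by (intro mult_left_mono) auto
    also have "\<dots> \<le> (norm a + 1) * (s / (2 * (norm a + 1)))"
      using r unfolding r_def by (intro mult_mono) auto
    also have "\<dots> = s / 2" using na by (simp add: field_simps)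
    finally have "norm a * norm (y - x) / s \<le> 1 / 2" using s by (simp add: field_simps)
    with l1 have l2: "l \<le> 1 / 2" by (rule order_trans)
    \<comment> \<open>The weight \<open>l\<close> is chosen such that \<open>p\<close> lies in the hyperplane.\<close>
    define p where "p = (1 / (1 - l)) *\<^sub>R (y - l *\<^sub>R z)"
    have yp: "y = (1 - l) *\<^sub>R p + l *\<^sub>R z" using l2 by (simp add: p_def)
    have "a \<bullet> y = (1 - l) * (a \<bullet> p) + l * (a \<bullet> z)" by (subst yp) (simp add: inner_add_right)
    moreover have "l * (a \<bullet> z) = l * \<beta> - l * s" by (simp add: s_def algebra_simps)
    moreover have "l * s = \<beta> - a \<bullet> y" using s by (simp add: l_def)
    ultimately have "(1 - l) * (a \<bullet> p) = (1 - l) * \<beta>" by (simp add: algebra_simps)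
    then have ap: "a \<bullet> p = \<beta>" using l2 by simp
    have "p - x = (1 / (1 - l)) *\<^sub>R ((y - x) - l *\<^sub>R (z - x))"
    proof -
      have "(1 - l) *\<^sub>R (p - x) = (y - x) - l *\<^sub>R (z - x)"
        by (subst yp) (simp add: algebra_simps)
      then show ?thesis using l2 by (simp flip: \<open>(1 - l) *\<^sub>R (p - x) = _\<close>)
    qed
    then have "norm (p - x) = (1 / (1 - l)) * norm ((y - x) - l *\<^sub>R (z - x))" using l2 by simp
    also have "\<dots> \<le> 2 * (norm (y - x) + l * norm (z - x))"
    proof (rule mult_mono)
      show "1 / (1 - l) \<le> 2" using l2 by (simp add: field_simps)
      show "norm ((y - x) - l *\<^sub>R (z - x)) \<le> norm (y - x) + l * norm (z - x)"
        using norm_triangle_ineq4[of "y - x" "l *\<^sub>R (z - x)"] l0 by simp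
    qed auto
    also have "l * norm (z - x) \<le> norm a * norm (y - x) / s * norm (z - x)"
      using l1 by (rule mult_right_mono) simp
    also have "2 * (norm (y - x) + \<dots>) = M * norm (y - x)" by (simp add: M_def algebra_simps)
    also have "\<dots> < M * r" using ny M by simp
    also have "\<dots> \<le> M * (r0 / M)" using M by (intro mult_left_mono) (auto simp: r_def)
    also have "\<dots> = r0" using M by simp
    finally have "p \<in> K" using ap by (intro r0(2)) (auto simp: dist_norm norm_minus_commute)
    then show "y \<in> K" unfolding yp using K z(1) l0 l2 by (intro convexD) auto
  qed
  then show ?thesis using r by blast
qed

lemma simplex_convex: "n simplex S \<Longrightarrow> convex S"
  by (intro polytope_imp_convex simplex_imp_polytope)

text \<open>The intersection is a common proper face.\<close>

lemma mesh_intersection_dim: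
  assumes tri: "triangulation \<T>" "\<forall>K\<in>\<T>. 3 simplex K" and K: "K \<in> \<T>" "K' \<in> \<T>" "K \<noteq> (K' :: vec3 set)"
  shows "aff_dim (K \<inter> K') \<le> 2" "interior K \<inter> interior K' = {}"
proof -
  have face: "K \<inter> K' face_of K" "K \<inter> K' face_of K'"
    using tri(1) K Int_commute[of K K'] unfolding triangulation_def by fastforce+
  have conv: "convex K" "convex K'" using tri(2) K simplex_convex by blast+
  have dim: "aff_dim K = 3" "aff_dim K' = 3" using tri(2) K aff_dim_simplex by blast+
  show d: "aff_dim (K \<inter> K') \<le> 2"
  proof (cases "K \<inter> K' = K")
    case True
    then have "K \<inter> K' \<noteq> K'" using K(3) by blast
    from face_of_aff_dim_lt[OF conv(2) face(2) this] show ?thesis unfolding dim by linarith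
  next
    case False
    from face_of_aff_dim_lt[OF conv(1) face(1) this] show ?thesis unfolding dim by linarith
  qed
  show "interior K \<inter> interior K' = {}"
  proof (rule ccontr)
    assume "interior K \<inter> interior K' \<noteq> {}"
    then have "interior (K \<inter> K') \<noteq> {}" by (simp add: interior_Int)
    then have "aff_dim (K \<inter> K') = 3" using aff_dim_nonempty_interior[of "K \<inter> K'"] by simp
    with d show False by simp
  qed
qed

text \<open>Near \<open>x\<close>, each of \<open>K\<close> and \<open>K'\<close> contains one of the two half balls cut off by the plane of the common
  facet. It is not the same one, for then the intersection would be three-dimensional.\<close>

lemma relative_interior_of_common_facet:
  fixes K K' :: "vec3 set"
  assumes conv: "convex K" "convex K'" and dim: "aff_dim K = 3" "aff_dim K' = 3" "aff_dim (K \<inter> K') = 2"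
    and x: "x \<in> rel_interior (K \<inter> K')"
  shows "x \<in> interior (K \<union> K')"
proof -
  let ?P = "K \<inter> K'"
  obtain a \<beta> where a: "a \<noteq> 0" "affine hull ?P = {y. a \<bullet> y = \<beta>}"
    using aff_dim_eq_hyperplane[of ?P] dim(3) by auto
  have xP: "x \<in> ?P" using x rel_interior_subset by blast
  have ax: "a \<bullet> x = \<beta>" using xP a(2) hull_subset[of ?P affine] by blast
  obtain r0 where r0: "r0 > 0" "ball x r0 \<inter> affine hull ?P \<subseteq> ?P"
    using x unfolding mem_rel_interior_ball by blast
  have off: "\<exists>z\<in>C. a \<bullet> z \<noteq> \<beta>" if "aff_dim C = 3" for C
  proof (rule ccontr)
    assume "\<not> (\<exists>z\<in>C. a \<bullet> z \<noteq> \<beta>)"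
    then have "C \<subseteq> {y. a \<bullet> y = \<beta>}" by auto
    from aff_dim_subset[OF this] show False using that aff_dim_hyperplane[OF a(1), of \<beta>] by simp
  qed
  have half: "\<exists>r>0. (\<forall>y\<in>ball x r. a \<bullet> y \<le> \<beta> \<longrightarrow> y \<in> C) \<or> (\<forall>y\<in>ball x r. a \<bullet> y \<ge> \<beta> \<longrightarrow> y \<in> C)"
    if C: "convex C" "aff_dim C = 3" "?P \<subseteq> C" for C
  proof -
    obtain z where z: "z \<in> C" "a \<bullet> z \<noteq> \<beta>" using off[OF C(2)] by blast
    have in_C: "y \<in> C" if "y \<in> ball x r0" "a \<bullet> y = \<beta>" for y
      using that r0(2) a(2) C(3) by blast
    show ?thesis
    proof (cases "a \<bullet> z < \<beta>")
      case True
      show ?thesis using half_ball_in_convex[OF C(1) z(1) True ax r0(1) in_C] by blast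
    next
      case False
      then have "(- a) \<bullet> z < - \<beta>" using z by simp
      from half_ball_in_convex[OF C(1) z(1) this _ r0(1)] show ?thesis
        using ax in_C by (simp add: inner_minus_left) blast
    qed
  qed
  obtain r where r: "r > 0" "(\<forall>y\<in>ball x r. a \<bullet> y \<le> \<beta> \<longrightarrow> y \<in> K) \<or> (\<forall>y\<in>ball x r. a \<bullet> y \<ge> \<beta> \<longrightarrow> y \<in> K)"
    using half[OF conv(1) dim(1)] by auto
  obtain r' where r': "r' > 0" "(\<forall>y\<in>ball x r'. a \<bullet> y \<le> \<beta> \<longrightarrow> y \<in> K') \<or> (\<forall>y\<in>ball x r'. a \<bullet> y \<ge> \<beta> \<longrightarrow> y \<in> K')"
    using half[OF conv(2) dim(2)] by auto
  define d where "d = min r r'"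
  have d: "d > 0" using r r' by (simp add: d_def)
  \<comment> \<open>Every open half ball leaves the intersection, which is contained in the plane.\<close>
  have notP: "\<exists>y\<in>ball x d. a \<bullet> y < \<beta> \<and> y \<notin> ?P" "\<exists>y\<in>ball x d. a \<bullet> y > \<beta> \<and> y \<notin> ?P"
  proof -
    define t where "t = d / (2 * norm a)"
    have t: "t > 0" "t * norm a < d" using d a(1) by (auto simp: t_def)
    have aa: "a \<bullet> a > 0" using a(1) by simp
    have hull: "y \<notin> ?P" if "a \<bullet> y \<noteq> \<beta>" for y
      using that a(2) hull_subset[of ?P affine] by blast
    have "x - t *\<^sub>R a \<in> ball x d" "x + t *\<^sub>R a \<in> ball x d" using t by (auto simp: dist_norm)
    moreover have "a \<bullet> (x - t *\<^sub>R a) < \<beta>" "a \<bullet> (x + t *\<^sub>R a) > \<beta>"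
      using t aa ax by (auto simp: inner_diff_right inner_add_right)
    ultimately show "\<exists>y\<in>ball x d. a \<bullet> y < \<beta> \<and> y \<notin> ?P" "\<exists>y\<in>ball x d. a \<bullet> y > \<beta> \<and> y \<notin> ?P"
      using hull by (metis less_irrefl)+
  qed
  have sub: "ball x d \<subseteq> ball x r" "ball x d \<subseteq> ball x r'" by (auto simp: d_def)
  have "ball x d \<subseteq> K \<union> K'"
  proof (cases "\<forall>y\<in>ball x r. a \<bullet> y \<le> \<beta> \<longrightarrow> y \<in> K")
    case True
    then have "\<not> (\<forall>y\<in>ball x r'. a \<bullet> y \<le> \<beta> \<longrightarrow> y \<in> K')"
      using notP(1) sub by (meson IntI less_imp_le subsetD)
    then have "\<forall>y\<in>ball x r'. a \<bullet> y \<ge> \<beta> \<longrightarrow> y \<in> K'" using r'(2) by blast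
    then show ?thesis using True sub by (meson UnI1 UnI2 linear subsetD subsetI)
  next
    case False
    then have 1: "\<forall>y\<in>ball x r. a \<bullet> y \<ge> \<beta> \<longrightarrow> y \<in> K" using r(2) by blast
    then have "\<not> (\<forall>y\<in>ball x r'. a \<bullet> y \<ge> \<beta> \<longrightarrow> y \<in> K')"
      using notP(2) sub by (meson IntI less_imp_le subsetD)
    then have "\<forall>y\<in>ball x r'. a \<bullet> y \<le> \<beta> \<longrightarrow> y \<in> K'" using r'(2) by blast
    then show ?thesis using 1 sub by (meson UnI1 UnI2 linear subsetD subsetI)
  qed
  then show ?thesis using d by (meson centre_in_ball interior_maximal open_ball subsetD)
qed

lemma surface_AE_not_in_low_dim:
  assumes "compact C" "convex C" "aff_dim C \<le> 1"
  shows "AE x in surface_measure \<Omega>. x \<notin> C"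
proof (cases "C = {}")
  case False
  then obtain p q where "C = closed_segment p q"
    using compact_convex_collinear_segment assms collinear_aff_dim by metis
  then show ?thesis using surface_AE_not_in_segment by simp
qed simp

text \<open>A boundary point in two tetrahedra lies on an edge: otherwise it would be in the relative interior
  of a common facet and thus, as \<open>\<Omega>\<close> is the interior of its closure, in \<open>\<Omega>\<close>. The edges are null sets of
  the surface measure. Near all other boundary points, \<open>\<Omega>\<close> is part of the interior of one tetrahedron,
  which is what makes the traces of finite element functions exist.\<close>

lemma surface_AE_in_single_element:
  assumes \<Omega>: "open \<Omega>" "lipschitz_boundary \<Omega>" and mesh: "tetrahedral_mesh \<Omega> \<T>"
  shows "AE x in surface_measure \<Omega>. \<exists>K\<in>\<T>. \<exists>r>0. x \<in> frontier \<Omega> \<and> \<Omega> \<inter> ball x r \<subseteq> interior K"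
proof -
  have tri: "triangulation \<T>" "\<forall>K\<in>\<T>. 3 simplex K" and cover: "\<Union>\<T> = closure \<Omega>" and fin: "finite \<T>"
    using mesh by (auto simp: tetrahedral_mesh_def triangulation_def)
  have poly: "polytope K" if "K \<in> \<T>" for K using tri(2) that simplex_imp_polytope by blast
  have edge: "AE x in surface_measure \<Omega>. x \<in> K \<inter> K' \<longrightarrow> aff_dim (K \<inter> K') = 2 \<and> x \<in> rel_interior (K \<inter> K')"
    if KK: "K \<in> \<T>" "K' \<in> \<T>" "K \<noteq> K'" for K K'
  proof -
    let ?P = "K \<inter> K'"
    have P: "polytope ?P" using KK poly polytope_Int by blast
    have le: "aff_dim ?P \<le> 2" using mesh_intersection_dim[OF tri KK] by simp
    show ?thesis
    proof (cases "aff_dim ?P = 2")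
      case False
      then have "AE x in surface_measure \<Omega>. x \<notin> ?P"
        using P le by (intro surface_AE_not_in_low_dim polytope_imp_compact polytope_imp_convex) auto
      then show ?thesis by eventually_elim auto
    next
      case True
      have "AE x in surface_measure \<Omega>. \<forall>F\<in>{F. F facet_of ?P}. x \<notin> F"
      proof (intro AE_finite_allI)
        show "finite {F. F facet_of ?P}" using finite_polytope_facets[OF P] by simp
        fix F assume "F \<in> {F. F facet_of ?P}"
        then have "F face_of ?P" "aff_dim F = 1" using True by (auto simp: facet_of_def)
        then show "AE x in surface_measure \<Omega>. x \<notin> F"
          using face_of_polytope_polytope[OF P]
          by (intro surface_AE_not_in_low_dim polytope_imp_compact polytope_imp_convex) auto
      qed
      then show ?thesis
      proof eventually_elim
        case (elim x)
        then have "x \<notin> rel_frontier ?P"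
          using rel_frontier_of_polyhedron[OF polytope_imp_polyhedron[OF P]] by auto
        then show ?case using True closure_subset[of ?P] by (auto simp: rel_frontier_def)
      qed
    qed
  qed
  have "AE x in surface_measure \<Omega>. \<forall>K\<in>\<T>. \<forall>K'\<in>\<T>. K \<noteq> K' \<longrightarrow> x \<in> K \<inter> K' \<longrightarrow> aff_dim (K \<inter> K') = 2 \<and> x \<in> rel_interior (K \<inter> K')"
    using fin edge by (intro AE_finite_allI) auto
  moreover have "AE x in surface_measure \<Omega>. x \<in> frontier \<Omega>"
    unfolding surface_measure_def by (rule AE_completion, rule AE_I2) (simp add: space_measure_of_conv)
  ultimately show ?thesis
  proof eventually_elim
    case (elim x)
    have x: "x \<in> closure \<Omega>" "x \<notin> \<Omega>" using elim(2) \<Omega>(1) by (auto simp: frontier_def interior_open)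
    then obtain K where K: "K \<in> \<T>" "x \<in> K" using cover by blast
    have uniq: "x \<notin> K'" if K': "K' \<in> \<T>" "K' \<noteq> K" for K'
    proof
      assume "x \<in> K'"
      then have P: "aff_dim (K \<inter> K') = 2" "x \<in> rel_interior (K \<inter> K')"
        using elim(1) K K' by blast+
      have "x \<in> interior (K \<union> K')"
        using tri(2) K(1) K'(1) by (intro relative_interior_of_common_facet P simplex_convex aff_dim_simplex) auto
      also have "\<dots> \<subseteq> interior (closure \<Omega>)" using cover K K' by (intro interior_mono) auto
      finally show False using x lipschitz_domain_regular_open[OF \<Omega>] by simp
    qed
    have "closed (\<Union>(\<T> - {K}))" using fin poly polytope_imp_closed by (intro closed_Union) blast+
    moreover have "x \<notin> \<Union>(\<T> - {K})" using uniq by blast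
    ultimately obtain r where r: "r > 0" "ball x r \<subseteq> - \<Union>(\<T> - {K})"
      by (metis ComplI openE open_Compl)
    have "\<Omega> \<inter> ball x r \<subseteq> K" using r(2) cover closure_subset[of \<Omega>] by blast
    then have "\<Omega> \<inter> ball x r \<subseteq> interior K" using \<Omega>(1) by (intro interior_maximal) auto
    then show ?case using K r elim(2) by blast
  qed
qed

section \<open>Finite-dimensional spaces of functions\<close>

text \<open>On an open set, the functions \<open>a + b \<times> x\<close> form a space of dimension six, on which all norms are
  equivalent: the mean-square norm is a continuous function of \<open>(a, b)\<close> and positive on the unit
  sphere, hence bounded below there.\<close>

lemma rigid_motion_coefficients_bounded:
  fixes V :: "vec3 set"
  assumes V: "open V" "bounded V" "V \<noteq> {}"
  shows "\<exists>C\<ge>0. \<forall>a b. \<forall>x\<in>V. norm (a + cross3 b x) \<le> C * L2_norm V (\<lambda>x. a + cross3 b x)"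
proof -
  define f where "f p x = fst p + cross3 (snd p) x" for p :: "vec3 \<times> vec3" and x
  have lm: "V \<in> lmeasurable" using V by (intro lmeasurable_open)
  obtain R where R: "R > 0" "\<And>x. x \<in> V \<Longrightarrow> norm x \<le> R" using V(2) bounded_pos by blast
  have cross: "norm (cross3 b x) \<le> norm b * norm x" for b x :: vec3
  proof -
    have "(norm (cross3 b x))\<^sup>2 \<le> (norm b * norm x)\<^sup>2"
      using norm_cross_dot[of b x] zero_le_power2[of "b \<bullet> x"] by linarith
    then show ?thesis by (rule power2_le_imp_le) simp
  qed
  have f_le: "norm (f p x) \<le> (1 + R) * norm p" if "x \<in> V" for p x
  proof -
    have "norm (f p x) \<le> norm (fst p) + norm (snd p) * norm x"
      unfolding f_def using norm_triangle_ineq[of "fst p"] cross[of "snd p" x] by (meson add_left_mono order_trans)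
    also have "\<dots> \<le> norm p + norm p * R"
      using norm_fst_le[of "fst p" "snd p"] norm_snd_le[of "snd p" "fst p"] R that by (intro add_mono mult_mono) auto
    finally show ?thesis by (simp add: algebra_simps)
  qed
  have f_cont: "continuous_on S (f p)" for p S
    unfolding f_def by (intro continuous_intros continuous_on_cross)
  have f_AE: "AE x in lebesgue_on V. norm (f p x) \<le> (1 + R) * norm p * norm (1::real)" for p
    using f_le by (intro AE_I2) (simp add: space_restrict_space)
  have f_meas: "f p \<in> borel_measurable (lebesgue_on V)" for p
    using f_cont by (intro measurable_restrict_space1 measurable_completion) (simp add: borel_measurable_continuous_onI)
  have fL2: "f p \<in> L2 V" for p
    using L2_bounded[OF lm f_meas, of p "(1 + R) * norm p"] f_AE[of p] by simp
  have one: "(\<lambda>_. 1::real) \<in> L2 V" by (rule L2_bounded[OF lm]) auto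
  define D where "D = (1 + R) * L2_norm V (\<lambda>_. 1::real)"
  have D: "D \<ge> 0" using R by (simp add: D_def)
  have N_le: "L2_norm V (f p) \<le> D * norm p" for p
    using L2_norm_mono[OF one fL2 f_AE] R by (simp add: D_def mult.commute mult.left_commute)
  have f_diff: "f p x - f q x = f (p - q) x" for p q x
    by (simp add: f_def Cross3.left_diff_distrib)
  have tri: "L2_norm V (f p) \<le> L2_norm V (f q) + D * norm (p - q)" for p q
    using L2_triangle[OF fL2[of q] fL2[of "p - q"]] N_le[of "p - q"] by (simp flip: f_diff)
  have "D-lipschitz_on UNIV (\<lambda>p. L2_norm V (f p))"
  proof (rule lipschitz_onI)
    fix p q show "dist (L2_norm V (f p)) (L2_norm V (f q)) \<le> D * dist p q"
      using tri[of p q] tri[of q p] by (simp add: dist_norm norm_minus_commute abs_le_iff)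
  qed (rule D)
  then have "continuous_on (sphere 0 1) (\<lambda>p. L2_norm V (f p))"
    using lipschitz_on_continuous_on continuous_on_subset by blast
  moreover have "sphere (0 :: vec3 \<times> vec3) 1 \<noteq> {}" by simp
  ultimately obtain p0 where p0: "p0 \<in> sphere 0 1" "\<And>p. p \<in> sphere 0 1 \<Longrightarrow> L2_norm V (f p0) \<le> L2_norm V (f p)"
    using continuous_attains_inf[OF compact_sphere] by metis
  define m where "m = L2_norm V (f p0)"
  have "m \<noteq> 0"
  proof
    assume "m = 0"
    then have "(LINT x|lebesgue_on V. (norm (f p0 x))\<^sup>2) = 0" by (simp add: m_def L2_norm_def)
    then have "AE x in lebesgue_on V. (norm (f p0 x))\<^sup>2 = 0"
      using integral_nonneg_eq_0_iff_AE[OF L2D(2)[OF fL2]] by simp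
    then have AE0: "AE x\<in>V in lebesgue. x \<in> {x. f p0 x = 0}"
      using V(1) by (simp add: AE_restrict_space_iff)
    have "closed {x. f p0 x = 0}" by (rule closed_Collect_eq[OF f_cont continuous_on_const])
    then have zero: "f p0 x = 0" if "x \<in> V" for x
      using mem_closed_if_AE_lebesgue_open[OF V(1) _ AE0 that] by blast
    \<comment> \<open>Both \<open>a + b \<times> x0\<close> and its increments \<open>b \<times> e\<close> vanish.\<close>
    obtain x0 where "x0 \<in> V" using V(3) by auto
    moreover from openE[OF V(1) this] obtain r where "r > 0" "ball x0 r \<subseteq> V" by blast
    ultimately have x0: "x0 \<in> V" "r > 0" "ball x0 r \<subseteq> V" by auto
    have crossz: "cross3 (snd p0) e = 0" if "norm e = 1" for e
    proof -
      have "x0 + (r / 2) *\<^sub>R e \<in> V" using x0 that by (intro subsetD[OF x0(3)]) (simp add: dist_norm)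
      moreover have "cross3 (snd p0) ((r / 2) *\<^sub>R e) = f p0 (x0 + (r / 2) *\<^sub>R e) - f p0 x0"
        by (simp add: f_def cross_add_right)
      ultimately have "cross3 (snd p0) ((r / 2) *\<^sub>R e) = 0" using zero[OF x0(1)] zero by simp
      then show ?thesis using x0(2) by (simp add: cross_mult_right)
    qed
    have "snd p0 = 0"
    proof (rule ccontr)
      assume ne: "snd p0 \<noteq> 0"
      have e: "cross3 (snd p0) (axis 1 1) = 0" "cross3 (snd p0) (axis 2 1) = 0"
        by (auto intro!: crossz simp: norm_axis_1)
      then show False using ne by (auto simp: cross3_def vec_eq_iff forall_3 axis_def)
    qed
    then have "p0 = 0" using zero[OF x0(1)] by (simp add: f_def prod_eq_iff)
    then show False using p0(1) by simp
  qed
  then have m: "m > 0" by (simp add: m_def order_less_le)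
  have low: "m * norm p \<le> L2_norm V (f p)" for p
  proof (cases "p = 0")
    case False
    have "f ((1 / norm p) *\<^sub>R p) x = (1 / norm p) *\<^sub>R f p x" for x
      by (simp add: f_def cross_mult_left scaleR_add_right)
    then have "L2_norm V (f ((1 / norm p) *\<^sub>R p)) = (1 / norm p) * L2_norm V (f p)"
      by (simp add: L2_norm_def power_divide real_sqrt_divide)
    moreover have "m \<le> L2_norm V (f ((1 / norm p) *\<^sub>R p))"
      unfolding m_def using False by (intro p0(2)) simp
    then have "m * norm p \<le> L2_norm V (f ((1 / norm p) *\<^sub>R p)) * norm p" by (rule mult_right_mono) simp
    ultimately show ?thesis using False by simp
  qed simp
  show ?thesis
  proof (intro exI[of _ "(1 + R) / m"] conjI allI ballI)
    show "(1 + R) / m \<ge> 0" using m R by simp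
    fix a b x assume x: "x \<in> V"
    have "norm (a + cross3 b x) \<le> (1 + R) * norm (a, b)" using f_le[OF x, of "(a, b)"] by (simp add: f_def)
    also have "\<dots> \<le> (1 + R) * (L2_norm V (f (a, b)) / m)"
      using low[of "(a, b)"] m R by (intro mult_left_mono) (auto simp: field_simps)
    finally show "norm (a + cross3 b x) \<le> (1 + R) / m * L2_norm V (\<lambda>x. a + cross3 b x)"
      by (simp add: f_def[abs_def])
  qed
qed

text \<open>A bounded selection of coordinates. The application takes for \<open>X\<close> the values of the functionals \<open>I\<close>
  on a space of fields, and the \<open>e j\<close> as the values on finitely many fields; thus it yields a bounded
  right inverse of the map given by the functionals.

  By induction on \<open>I\<close>: either the functional \<open>k\<close> vanishes on the common kernel of the others, and nothing
  has to be added, or an element \<open>z\<close> of this kernel with \<open>z k \<noteq> 0\<close> serves to correct the value at \<open>k\<close>.\<close>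

lemma finite_dimensional_representation:
  fixes X :: "('i \<Rightarrow> real) set"
  assumes fin: "finite I" and ne: "X \<noteq> {}" and X: "\<And>x y c. x \<in> X \<Longrightarrow> y \<in> X \<Longrightarrow> (\<lambda>i. x i + c * y i) \<in> X"
  shows "\<exists>(M::nat) e C. C \<ge> 0 \<and> (\<forall>j<M. e j \<in> X) \<and>
    (\<forall>x\<in>X. \<exists>c. (\<forall>i\<in>I. x i = (\<Sum>j<M. c j * e j i)) \<and> (\<forall>j<M. \<bar>c j\<bar> \<le> C * (\<Sum>i\<in>I. \<bar>x i\<bar>)))"
  using fin
proof (induction I rule: finite_induct)
  case empty
  show ?case by (intro exI[of _ "0::nat"] exI[of _ "\<lambda>_. undefined"] exI[of _ "0::real"]) auto
next
  case (insert k I)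
  obtain M :: nat and e C where C: "C \<ge> 0" and e: "\<forall>j<M. e j \<in> X"
    and rep: "\<forall>x\<in>X. \<exists>c. (\<forall>i\<in>I. x i = (\<Sum>j<M. c j * e j i)) \<and> (\<forall>j<M. \<bar>c j\<bar> \<le> C * (\<Sum>i\<in>I. \<bar>x i\<bar>))"
    using insert.IH by blast
  have comb: "(\<lambda>i. x i - (\<Sum>j<n. c j * e j i)) \<in> X" if "x \<in> X" "n \<le> M" for x c n
    using that(2)
  proof (induction n)
    case (Suc n)
    then have "(\<lambda>i. x i - (\<Sum>j<n. c j * e j i)) \<in> X" "e n \<in> X" using e by auto
    from X[OF this, of "- c n"] show ?case by (simp add: algebra_simps)
  qed (use that in simp)
  have sum_I: "(\<Sum>i\<in>I. \<bar>x i\<bar>) \<le> (\<Sum>i\<in>insert k I. \<bar>x i\<bar>)" for x :: "'i \<Rightarrow> real"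
    using insert.hyps by simp
  show ?case
  proof (cases "\<exists>z\<in>X. (\<forall>i\<in>I. z i = 0) \<and> z k \<noteq> 0")
    case False
    show ?thesis
    proof (rule exI[of _ M], rule exI[of _ e], rule exI[of _ C], intro conjI ballI)
      show "C \<ge> 0" "\<forall>j<M. e j \<in> X" by fact+
      fix x assume x: "x \<in> X"
      obtain c where c: "\<forall>i\<in>I. x i = (\<Sum>j<M. c j * e j i)" "\<forall>j<M. \<bar>c j\<bar> \<le> C * (\<Sum>i\<in>I. \<bar>x i\<bar>)"
        using rep x by blast
      have "x k - (\<Sum>j<M. c j * e j k) = 0"
        using False comb[OF x order_refl, of c] c(1) by auto
      then have "\<forall>i\<in>insert k I. x i = (\<Sum>j<M. c j * e j i)" using c(1) by simp
      moreover have "\<forall>j<M. \<bar>c j\<bar> \<le> C * (\<Sum>i\<in>insert k I. \<bar>x i\<bar>)"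
        using c(2) mult_left_mono[OF sum_I[of x] C] by (meson order_trans)
      ultimately show "\<exists>c. (\<forall>i\<in>insert k I. x i = (\<Sum>j<M. c j * e j i)) \<and> (\<forall>j<M. \<bar>c j\<bar> \<le> C * (\<Sum>i\<in>insert k I. \<bar>x i\<bar>))"
        by blast
    qed
  next
    case True
    then obtain z where z: "z \<in> X" "\<forall>i\<in>I. z i = 0" "z k \<noteq> 0" by blast
    define e' where "e' = e(M := z)"
    define S where "S = (\<Sum>j<M. \<bar>e j k\<bar>)"
    have S: "S \<ge> 0" by (simp add: S_def sum_nonneg)
    \<comment> \<open>The bound for the coefficient of the new element \<open>z\<close> comes from the value at \<open>k\<close> left by the others.\<close>
    define C' where "C' = max C ((1 + C * S) / \<bar>z k\<bar>)"
    show ?thesis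
    proof (rule exI[of _ "Suc M"], rule exI[of _ e'], rule exI[of _ C'], intro conjI ballI)
      show "C' \<ge> 0" using C by (simp add: C'_def)
      show "\<forall>j<Suc M. e' j \<in> X" using e z by (auto simp: e'_def less_Suc_eq)
      fix x assume x: "x \<in> X"
      let ?N = "\<Sum>i\<in>I. \<bar>x i\<bar>" and ?N' = "\<Sum>i\<in>insert k I. \<bar>x i\<bar>"
      obtain c where c: "\<forall>i\<in>I. x i = (\<Sum>j<M. c j * e j i)" "\<forall>j<M. \<bar>c j\<bar> \<le> C * ?N"
        using rep x by blast
      define d where "d = (x k - (\<Sum>j<M. c j * e j k)) / z k"
      define c' where "c' = c(M := d)"
      have sum: "(\<Sum>j<Suc M. c' j * e' j i) = (\<Sum>j<M. c j * e j i) + d * z i" for i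
        by (simp add: c'_def e'_def)
      have rep': "\<forall>i\<in>insert k I. x i = (\<Sum>j<Suc M. c' j * e' j i)"
        unfolding sum using c(1) z by (auto simp: d_def)
      have "\<bar>\<Sum>j<M. c j * e j k\<bar> \<le> (\<Sum>j<M. C * ?N * \<bar>e j k\<bar>)"
        using c(2) by (intro order_trans[OF sum_abs] sum_mono) (simp add: abs_mult mult_right_mono)
      also have "\<dots> = C * S * ?N" by (simp add: S_def sum_distrib_left mult.commute mult.left_commute)
      also have "\<dots> \<le> C * S * ?N'" using sum_I C S by (intro mult_left_mono) auto
      finally have "\<bar>x k - (\<Sum>j<M. c j * e j k)\<bar> \<le> \<bar>x k\<bar> + C * S * ?N'" by linarith
      also have "\<bar>x k\<bar> \<le> ?N'" using insert.hyps by (simp add: sum_nonneg)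
      finally have "\<bar>x k - (\<Sum>j<M. c j * e j k)\<bar> \<le> (1 + C * S) * ?N'" by (simp add: algebra_simps)
      then have d: "\<bar>d\<bar> \<le> (1 + C * S) / \<bar>z k\<bar> * ?N'"
        using z(3) by (simp add: d_def field_simps)
      have N'0: "?N' \<ge> 0" by (intro sum_nonneg) auto
      have "\<forall>j<Suc M. \<bar>c' j\<bar> \<le> C' * ?N'"
      proof (intro allI impI)
        fix j assume "j < Suc M"
        show "\<bar>c' j\<bar> \<le> C' * ?N'"
        proof (cases "j = M")
          case True
          have "(1 + C * S) / \<bar>z k\<bar> * ?N' \<le> C' * ?N'" using N'0 by (intro mult_right_mono) (auto simp: C'_def)
          then show ?thesis using d True by (simp add: c'_def)
        next
          case False
          have "\<bar>c j\<bar> \<le> C * ?N" using c(2) False \<open>j < Suc M\<close> by simp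
          also have "\<dots> \<le> C * ?N'" using sum_I C by (intro mult_left_mono) auto
          also have "\<dots> \<le> C' * ?N'" using N'0 by (intro mult_right_mono) (auto simp: C'_def)
          finally show ?thesis using False by (simp add: c'_def)
        qed
      qed
      with rep' show "\<exists>c. (\<forall>i\<in>insert k I. x i = (\<Sum>j<Suc M. c j * e' j i)) \<and> (\<forall>j<Suc M. \<bar>c j\<bar> \<le> C' * ?N')"
        by blast
    qed
  qed
qed

section \<open>Elementwise means\<close>

locale mesh_domain =
  fixes \<Omega> :: "vec3 set" and \<T> :: "vec3 set set"
  assumes open_domain: "open \<Omega>" and bounded_domain: "bounded \<Omega>"
    and lipschitz: "lipschitz_boundary \<Omega>" and mesh: "tetrahedral_mesh \<Omega> \<T>"
begin

lemma lmeasurable_domain: "\<Omega> \<in> lmeasurable"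
  using open_domain bounded_domain by (intro lmeasurable_open)

lemma sets_domain: "\<Omega> \<in> sets lebesgue"
  using lmeasurable_domain by (rule fmeasurableD)

lemma mesh_facts:
  shows triangulation_mesh: "triangulation \<T>" and simplex_mesh: "\<forall>K\<in>\<T>. 3 simplex K"
    and Union_mesh: "\<Union>\<T> = closure \<Omega>" and finite_mesh: "finite \<T>"
  using mesh by (auto simp: tetrahedral_mesh_def triangulation_def)

context
  fixes K assumes K: "K \<in> \<T>"
begin

lemma interior_subset_domain: "interior K \<subseteq> \<Omega>"
proof -
  have "interior K \<subseteq> interior (closure \<Omega>)" using Union_mesh K by (intro interior_mono) auto
  then show ?thesis using lipschitz_domain_regular_open[OF open_domain lipschitz] by simp
qed

lemma sets_interior: "interior K \<in> sets lebesgue"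
  by simp

lemma polytope_element: "polytope K"
  using simplex_mesh K simplex_imp_polytope by blast

lemma interior_nonempty: "interior K \<noteq> {}"
proof -
  have "aff_dim K = int DIM(vec3)" using simplex_mesh K aff_dim_simplex by fastforce
  then have "rel_interior K = interior K" by (rule interior_rel_interior)
  moreover have "K \<noteq> {}" using \<open>aff_dim K = int DIM(vec3)\<close> by auto
  ultimately show ?thesis using rel_interior_eq_empty polytope_imp_convex[OF polytope_element] by metis
qed

lemma measure_element:
  "measure lebesgue K > 0" "measure lebesgue (interior K) = measure lebesgue K"
proof -
  have bd: "bounded K" using polytope_element by (rule polytope_imp_bounded)
  show eq: "measure lebesgue (interior K) = measure lebesgue K"
    using bd polytope_imp_convex[OF polytope_element] by (intro measure_interior negligible_convex_frontier)
  have "interior K \<in> lmeasurable" using bd by (intro lmeasurable_open bounded_interior) auto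
  then have "measure lebesgue (interior K) \<noteq> 0"
    using negligible_iff_measure0 open_not_negligible[OF open_interior interior_nonempty] by blast
  then show "measure lebesgue K > 0" using eq by (simp add: order_less_le)
qed

lemma lmeasurable_interior: "interior K \<in> lmeasurable"
  using polytope_imp_bounded[OF polytope_element] by (intro lmeasurable_open bounded_interior) auto

lemma AE_interior:
  assumes "AE x in lebesgue_on \<Omega>. P x"
  shows "AE x in lebesgue_on (interior K). P x"
proof -
  have "AE x in lebesgue. x \<in> \<Omega> \<longrightarrow> P x" using assms sets_domain by (simp add: AE_restrict_space_iff)
  then have "AE x in lebesgue. x \<in> interior K \<longrightarrow> P x"
    by eventually_elim (use interior_subset_domain in auto)
  then show ?thesis by (simp add: AE_restrict_space_iff)
qed

lemma Qh_eq:
  assumes "x \<in> interior K"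
  shows "Qh \<T> g x = (1 / measure lebesgue K) *\<^sub>R (LINT y|lebesgue_on (interior K). g y)"
proof -
  have "indicator (interior K') x = (0::real)" if "K' \<in> \<T> - {K}" for K'
    using mesh_intersection_dim(2)[OF triangulation_mesh simplex_mesh, of K K'] K that assms by (auto simp: indicator_def)
  then have "Qh \<T> g x = (\<Sum>K'\<in>{K}. indicator (interior K') x *\<^sub>R
     ((1 / measure lebesgue K') *\<^sub>R (LINT y|lebesgue_on (interior K'). g y)))"
    unfolding Qh_def using K finite_mesh by (intro sum.mono_neutral_right) auto
  then show ?thesis using assms by simp
qed

end

lemma AE_in_element: "AE x in lebesgue_on \<Omega>. \<exists>K\<in>\<T>. x \<in> interior K"
proof -
  have "negligible (\<Union>(frontier ` \<T>))"
    using finite_mesh polytope_imp_convex[OF polytope_element] negligible_convex_frontier by (intro negligible_Union) blast+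
  then have "AE x in lebesgue. x \<notin> \<Union>(frontier ` \<T>)"
    by (intro AE_not_in) (simp add: negligible_iff_null_sets)
  then have "AE x in lebesgue. x \<in> \<Omega> \<longrightarrow> (\<exists>K\<in>\<T>. x \<in> interior K)"
  proof eventually_elim
    case (elim x)
    show ?case
    proof
      assume "x \<in> \<Omega>"
      then obtain K where K: "K \<in> \<T>" "x \<in> K" using Union_mesh closure_subset by blast
      then have "x \<in> closure K" "x \<notin> frontier K" using elim closure_subset by blast+
      then show "\<exists>K\<in>\<T>. x \<in> interior K" using K by (auto simp: frontier_def)
    qed
  qed
  then show ?thesis using sets_domain by (simp add: AE_restrict_space_iff)
qed

lemma AE_elementwise:
  assumes "\<And>K. K \<in> \<T> \<Longrightarrow> AE x in lebesgue_on (interior K). P x"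
  shows "AE x in lebesgue_on \<Omega>. P x"
proof -
  have "AE x in lebesgue. \<forall>K\<in>\<T>. x \<in> interior K \<longrightarrow> P x"
    using finite_mesh assms by (intro AE_finite_allI) (auto simp: AE_restrict_space_iff)
  moreover have "AE x in lebesgue. x \<in> \<Omega> \<longrightarrow> (\<exists>K\<in>\<T>. x \<in> interior K)"
    using AE_in_element sets_domain by (simp add: AE_restrict_space_iff)
  ultimately have "AE x in lebesgue. x \<in> \<Omega> \<longrightarrow> P x" by eventually_elim blast
  then show ?thesis using sets_domain by (simp add: AE_restrict_space_iff)
qed

lemma Qh_cong_AE:
  assumes "AE x in lebesgue_on \<Omega>. g x = g' x"
    and "g \<in> borel_measurable (lebesgue_on \<Omega>)" "g' \<in> borel_measurable (lebesgue_on \<Omega>)"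
  shows "Qh \<T> g = Qh \<T> g'"
proof
  fix x
  have "(LINT y|lebesgue_on (interior K). g y) = (LINT y|lebesgue_on (interior K). g' y)" if K: "K \<in> \<T>" for K
  proof (rule integral_cong_AE)
    show "AE x in lebesgue_on (interior K). g x = g' x" by (rule AE_interior[OF K assms(1)])
    show "g \<in> borel_measurable (lebesgue_on (interior K))" "g' \<in> borel_measurable (lebesgue_on (interior K))"
      using assms(2,3) interior_subset_domain[OF K] measurable_restrict_mono by blast+
  qed
  then show "Qh \<T> g x = Qh \<T> g' x" by (simp add: Qh_def)
qed

lemma Qh_zero: "Qh \<T> (\<lambda>_. 0) x = 0"
  by (simp add: Qh_def)

context
  fixes g assumes g: "g \<in> Linf_sym \<Omega>"
begin

lemma Linf_sym_integrable_interior: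
  assumes K: "K \<in> \<T>"
  shows "integrable (lebesgue_on (interior K)) g"
proof -
  have "integrable (lebesgue_on \<Omega>) (\<lambda>x. norm (g x))"
    by (intro L2_integrable_norm Linf_sym_L2 lmeasurable_domain g)
  then have "integrable (lebesgue_on \<Omega>) g"
    using g by (subst (asm) integrable_norm_iff) (auto simp: Linf_sym_def)
  then show ?thesis
    using interior_subset_domain[OF K] sets_domain by (rule integrable_lebesgue_on_subset) simp
qed

text \<open>The elementwise mean commutes with the linear map \<open>A \<mapsto> \<xi> \<bullet> A \<eta>\<close>; this transfers symmetry and
  two-sided bounds of the matrix function to its mean.\<close>

lemma Qh_inner:
  assumes K: "K \<in> \<T>" and x: "x \<in> interior K"
  shows "\<xi> \<bullet> (Qh \<T> g x *v \<eta>) = (1 / measure lebesgue K) * (LINT y|lebesgue_on (interior K). \<xi> \<bullet> (g y *v \<eta>))"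
    and "integrable (lebesgue_on (interior K)) (\<lambda>y. \<xi> \<bullet> (g y *v \<eta>))"
proof -
  let ?L = "\<lambda>A :: mat3. \<xi> \<bullet> (A *v \<eta>)"
  have "linear ?L"
    by (rule linearI) (simp_all add: matrix_vector_mult_add_rdistrib inner_add_right scaleR_matrix_vector_assoc[symmetric])
  then have L: "bounded_linear ?L" by (simp add: linear_conv_bounded_linear)
  show "integrable (lebesgue_on (interior K)) (\<lambda>y. ?L (g y))"
    by (rule integrable_bounded_linear[OF L Linf_sym_integrable_interior[OF K]])
  have "?L (Qh \<T> g x) = (1 / measure lebesgue K) * ?L (LINT y|lebesgue_on (interior K). g y)"
    unfolding Qh_eq[OF K x] using linear_scale[OF \<open>linear ?L\<close>] by simp
  also have "?L (LINT y|lebesgue_on (interior K). g y) = (LINT y|lebesgue_on (interior K). ?L (g y))"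
    by (rule integral_bounded_linear[OF L Linf_sym_integrable_interior[OF K], symmetric])
  finally show "?L (Qh \<T> g x) = (1 / measure lebesgue K) * (LINT y|lebesgue_on (interior K). ?L (g y))" .
qed

lemma Qh_symmetric:
  assumes K: "K \<in> \<T>" and x: "x \<in> interior K"
  shows "\<xi> \<bullet> (Qh \<T> g x *v \<eta>) = \<eta> \<bullet> (Qh \<T> g x *v \<xi>)"
proof -
  have "AE y in lebesgue_on \<Omega>. transpose (g y) = g y" using g by (simp add: Linf_sym_def)
  then have "AE y in lebesgue_on (interior K). \<xi> \<bullet> (g y *v \<eta>) = \<eta> \<bullet> (g y *v \<xi>)"
    by (intro AE_interior[OF K]) (erule eventually_mono, rule symmetric_matrix_inner)
  then show ?thesis
    unfolding Qh_inner(1)[OF K x] using Qh_inner(2)[OF K x]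
    by (intro arg_cong2[where f = "(*)"] refl integral_cong_AE borel_measurable_integrable)
qed

lemma Qh_lower:
  assumes K: "K \<in> \<T>" and x: "x \<in> interior K"
    and low: "AE y in lebesgue_on \<Omega>. \<forall>\<xi>. c * (norm \<xi>)\<^sup>2 \<le> \<xi> \<bullet> (g y *v \<xi>)"
  shows "c * (norm \<xi>)\<^sup>2 \<le> \<xi> \<bullet> (Qh \<T> g x *v \<xi>)"
proof -
  have fin: "finite_measure (lebesgue_on (interior K))"
    by (rule finite_measure_lebesgue_on[OF lmeasurable_interior[OF K]])
  have le: "(LINT y|lebesgue_on (interior K). c * (norm \<xi>)\<^sup>2) \<le> (LINT y|lebesgue_on (interior K). \<xi> \<bullet> (g y *v \<xi>))"
    using Qh_inner(2)[OF K x] AE_interior[OF K low] finite_measure.integrable_const[OF fin]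
    by (intro integral_mono_AE) (auto elim: eventually_mono)
  have "measure (lebesgue_on (interior K)) (interior K) = measure lebesgue K"
    using measure_element(2)[OF K] by (simp add: measure_restrict_space)
  then have eq: "(LINT y|lebesgue_on (interior K). c * (norm \<xi>)\<^sup>2) = measure lebesgue K * (c * (norm \<xi>)\<^sup>2)"
    by simp
  show ?thesis
    unfolding Qh_inner(1)[OF K x] using mult_left_mono[OF le[unfolded eq], of "1 / measure lebesgue K"] measure_element(1)[OF K]
    by simp
qed

lemma Qh_upper:
  assumes K: "K \<in> \<T>" and x: "x \<in> interior K"
    and up: "AE y in lebesgue_on \<Omega>. \<forall>\<xi>. \<xi> \<bullet> (g y *v \<xi>) \<le> c * (norm \<xi>)\<^sup>2"
  shows "\<xi> \<bullet> (Qh \<T> g x *v \<xi>) \<le> c * (norm \<xi>)\<^sup>2"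
proof -
  have fin: "finite_measure (lebesgue_on (interior K))"
    by (rule finite_measure_lebesgue_on[OF lmeasurable_interior[OF K]])
  have le: "(LINT y|lebesgue_on (interior K). \<xi> \<bullet> (g y *v \<xi>)) \<le> (LINT y|lebesgue_on (interior K). c * (norm \<xi>)\<^sup>2)"
    using Qh_inner(2)[OF K x] AE_interior[OF K up] finite_measure.integrable_const[OF fin]
    by (intro integral_mono_AE) (auto elim: eventually_mono)
  have "measure (lebesgue_on (interior K)) (interior K) = measure lebesgue K"
    using measure_element(2)[OF K] by (simp add: measure_restrict_space)
  then have eq: "(LINT y|lebesgue_on (interior K). c * (norm \<xi>)\<^sup>2) = measure lebesgue K * (c * (norm \<xi>)\<^sup>2)"
    by simp
  show ?thesis
    unfolding Qh_inner(1)[OF K x] using mult_left_mono[OF le[unfolded eq], of "1 / measure lebesgue K"] measure_element(1)[OF K]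
    by simp
qed

lemma Qh_Linf_sym: "Qh \<T> g \<in> Linf_sym \<Omega>"
proof -
  let ?I = "\<lambda>K. (1 / measure lebesgue K) *\<^sub>R (LINT y|lebesgue_on (interior K). g y)"
  have "Qh \<T> g \<in> borel_measurable (lebesgue_on \<Omega>)"
    unfolding Qh_def[abs_def]
  proof (intro borel_measurable_sum borel_measurable_scaleR borel_measurable_indicator borel_measurable_const)
    fix K assume "K \<in> \<T>"
    then show "interior K \<in> sets (lebesgue_on \<Omega>)"
      using interior_subset_domain[of K] sets_domain by (subst sets_restrict_space_iff) auto
  qed
  moreover have "norm (Qh \<T> g x) \<le> (\<Sum>K\<in>\<T>. norm (?I K))" for x
    unfolding Qh_def by (intro order_trans[OF norm_sum] sum_mono) (auto simp: indicator_def)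
  moreover have "AE x in lebesgue_on \<Omega>. transpose (Qh \<T> g x) = Qh \<T> g x"
    using AE_in_element
  proof eventually_elim
    case (elim x)
    then obtain K where K: "K \<in> \<T>" "x \<in> interior K" by blast
    have "Qh \<T> g x $ j $ i = Qh \<T> g x $ i $ j" for i j
      using Qh_symmetric[OF K, of "axis i 1" "axis j 1"]
      by (simp add: inner_axis' matrix_vector_mul_component inner_axis)
    then show ?case by (simp add: vec_eq_iff transpose_def)
  qed
  ultimately show ?thesis unfolding Linf_sym_def by blast
qed

end

end

section \<open>Finite element fields and their traces\<close>

context mesh_domain
begin

lemma ND_L2: "v \<in> ND \<Omega> \<T> \<Longrightarrow> v \<in> L2 \<Omega>"
  and ND_Hcurl: "v \<in> ND \<Omega> \<T> \<Longrightarrow> v \<in> Hcurl \<Omega>"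
  by (auto simp: ND_def Hcurl_def)

lemma DG_L2: "w \<in> DG \<Omega> \<T> \<Longrightarrow> w \<in> L2 \<Omega>"
  by (simp add: DG_def)

lemma ND_add_scaleR:
  assumes "u \<in> ND \<Omega> \<T>" "v \<in> ND \<Omega> \<T>"
  shows "(\<lambda>x. u x + c *\<^sub>R v x) \<in> ND \<Omega> \<T>"
proof -
  have "\<exists>a b. \<forall>x\<in>interior K. u x + c *\<^sub>R v x = a + cross3 b x" if K: "K \<in> \<T>" for K
  proof -
    obtain a b where u: "\<forall>x\<in>interior K. u x = a + cross3 b x" using assms(1) K unfolding ND_def by blast
    obtain a' b' where v: "\<forall>x\<in>interior K. v x = a' + cross3 b' x" using assms(2) K unfolding ND_def by blast
    have "u x + c *\<^sub>R v x = (a + c *\<^sub>R a') + cross3 (b + c *\<^sub>R b') x" if "x \<in> interior K" for x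
      using u v that by (simp add: cross_add_left cross_mult_left scaleR_add_right)
    then show ?thesis by blast
  qed
  then show ?thesis
    using Hcurl_add_scaleR[OF open_domain bounded_domain ND_Hcurl[OF assms(1)] ND_Hcurl[OF assms(2)], of c] assms
    unfolding ND_def by auto
qed

lemma curl_ND_L2: "v \<in> ND \<Omega> \<T> \<Longrightarrow> curl \<Omega> v \<in> L2 \<Omega>"
  by (intro curl_in_L2 ND_Hcurl)

lemma L2_restrict_interior:
  assumes K: "K \<in> \<T>" and v: "v \<in> L2 \<Omega>"
  shows "v \<in> L2 (interior K)" "L2_norm (interior K) v \<le> L2_norm \<Omega> v"
proof -
  note sub = interior_subset_domain[OF K]
  show "v \<in> L2 (interior K)"
    unfolding L2_def mem_Collect_eq
    using measurable_restrict_mono[OF L2D(1)[OF v] sub]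
      integrable_lebesgue_on_subset[OF L2D(2)[OF v] sub sets_domain sets_interior[OF K]]
    by (rule conjI)
  have "(LINT x|lebesgue_on (interior K). (norm (v x))\<^sup>2) \<le> (LINT x|lebesgue_on \<Omega>. (norm (v x))\<^sup>2)"
    using L2D(2)[OF v] sub sets_domain by (intro integral_mono_lebesgue_on_AE) auto
  then show "L2_norm (interior K) v \<le> L2_norm \<Omega> v"
    unfolding L2_norm_def by (rule real_sqrt_le_mono)
qed

text \<open>An inverse estimate on the fixed mesh.\<close>

lemma ND_sup_bound: "\<exists>C\<ge>0. \<forall>v\<in>ND \<Omega> \<T>. \<forall>x. norm (v x) \<le> C * L2_norm \<Omega> v"
proof -
  have "\<exists>C\<ge>0. \<forall>a b. \<forall>x\<in>interior K. norm (a + cross3 b x) \<le> C * L2_norm (interior K) (\<lambda>x. a + cross3 b x)" if K: "K \<in> \<T>" for K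
    using polytope_imp_bounded[OF polytope_element[OF K]] interior_nonempty[OF K]
    by (intro rigid_motion_coefficients_bounded) (auto intro: bounded_interior)
  then obtain C where C: "\<And>K. K \<in> \<T> \<Longrightarrow> C K \<ge> 0"
    "\<And>K a b x. K \<in> \<T> \<Longrightarrow> x \<in> interior K \<Longrightarrow> norm (a + cross3 b x) \<le> C K * L2_norm (interior K) (\<lambda>x. a + cross3 b x)"
    by metis
  define D where "D = (\<Sum>K\<in>\<T>. C K)"
  have D: "D \<ge> 0" unfolding D_def using C(1) by (rule sum_nonneg)
  have "norm (v x) \<le> D * L2_norm \<Omega> v" if v: "v \<in> ND \<Omega> \<T>" for v x
  proof (cases "x \<in> (\<Union>K\<in>\<T>. interior K)")
    case True
    then obtain K where K: "K \<in> \<T>" "x \<in> interior K" by blast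
    obtain a b where ab: "\<forall>x\<in>interior K. v x = a + cross3 b x" using v K unfolding ND_def by blast
    have "L2_norm (interior K) (\<lambda>x. a + cross3 b x) = L2_norm (interior K) v"
      unfolding L2_norm_def using ab
      by (intro arg_cong[where f = sqrt] Bochner_Integration.integral_cong) (auto simp: space_restrict_space)
    then have "norm (v x) \<le> C K * L2_norm (interior K) v" using C(2)[OF K, of a b] ab K by simp
    also have "\<dots> \<le> D * L2_norm \<Omega> v"
      using C(1) K finite_mesh L2_restrict_interior(2)[OF K(1) ND_L2[OF v]] D
      unfolding D_def by (intro mult_mono member_le_sum) auto
    finally show ?thesis .
  next
    case False
    then have "v x = 0" using v unfolding ND_def by blast
    then show ?thesis using D by simp
  qed
  then show ?thesis using D by blast
qed

text \<open>Where no unit normal exists, the choice operator returns one and the same unspecified vector.\<close>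

lemma outer_normal_bounded: "\<exists>c\<ge>0. \<forall>x. norm (outer_normal \<Omega> x) \<le> c"
proof (intro exI[of _ "max 1 (norm (SOME n :: vec3. False))"] conjI allI)
  fix x
  show "norm (outer_normal \<Omega> x) \<le> max 1 (norm (SOME n :: vec3. False))"
  proof (cases "\<exists>n. norm n = 1 \<and> (\<exists>r>0. \<Omega> \<inter> ball x r = {y \<in> ball x r. (y - x) \<bullet> n < 0})")
    case True
    from someI_ex[OF this] show ?thesis by (simp add: outer_normal_def)
  next
    case False
    then have "(\<lambda>n. norm n = 1 \<and> (\<exists>r>0. \<Omega> \<inter> ball x r = {y \<in> ball x r. (y - x) \<bullet> n < 0})) = (\<lambda>_. False)"
      by blast
    then show ?thesis by (simp add: outer_normal_def)
  qed
qed simp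

text \<open>Almost everywhere on the boundary the trace is the limit of an affine function on a single
  tetrahedron, hence bounded by the maximum norm.\<close>

lemma tangential_trace_bounded:
  "\<exists>C\<ge>0. \<forall>v\<in>ND \<Omega> \<T>. AE x in surface_measure \<Omega>. norm (tangential_trace \<Omega> v x) \<le> C * L2_norm \<Omega> v"
proof -
  obtain C where C: "C \<ge> 0" "\<And>v x. v \<in> ND \<Omega> \<T> \<Longrightarrow> norm (v x) \<le> C * L2_norm \<Omega> v"
    using ND_sup_bound by blast
  obtain c where c: "c \<ge> 0" "\<And>x. norm (outer_normal \<Omega> x) \<le> c" using outer_normal_bounded by blast
  have "AE x in surface_measure \<Omega>. norm (tangential_trace \<Omega> v x) \<le> (c * C) * L2_norm \<Omega> v" if v: "v \<in> ND \<Omega> \<T>" for v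
    using surface_AE_in_single_element[OF open_domain lipschitz mesh]
  proof eventually_elim
    case (elim x)
    then obtain K r where K: "K \<in> \<T>" "r > 0" "x \<in> frontier \<Omega>" "\<Omega> \<inter> ball x r \<subseteq> interior K" by blast
    obtain a b where ab: "\<forall>x\<in>interior K. v x = a + cross3 b x" using v K unfolding ND_def by blast
    have ev: "eventually (\<lambda>y. a + cross3 b y = v y) (at x within \<Omega>)"
      unfolding eventually_at using K(2,4) ab by (intro exI[of _ r]) (auto simp: dist_commute subset_iff)
    have "continuous_on UNIV (\<lambda>y. a + cross3 b y)" by (intro continuous_intros continuous_on_cross)
    then have "((\<lambda>y. a + cross3 b y) \<longlongrightarrow> a + cross3 b x) (at x within \<Omega>)"
      by (meson UNIV_I continuous_on_def subset_UNIV tendsto_within_subset)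
    with ev have lim: "(v \<longlongrightarrow> a + cross3 b x) (at x within \<Omega>)" by (rule Lim_transform_eventually[rotated])
    have "x \<notin> \<Omega>" "x \<in> closure \<Omega>" using K(3) open_domain by (auto simp: frontier_def interior_open)
    then have nt: "\<not> trivial_limit (at x within \<Omega>)"
      by (simp add: trivial_limit_within closure_def)
    have "boundary_trace \<Omega> v x = a + cross3 b x"
      unfolding boundary_trace_def using nt lim by (rule tendsto_Lim)
    moreover have "norm (a + cross3 b x) \<le> C * L2_norm \<Omega> v"
      using C(2)[OF v] by (intro Lim_norm_ubound[OF nt lim] always_eventually allI)
    ultimately have trace: "norm (boundary_trace \<Omega> v x) \<le> C * L2_norm \<Omega> v" by simp
    have "(norm (tangential_trace \<Omega> v x))\<^sup>2 \<le> (norm (outer_normal \<Omega> x) * norm (boundary_trace \<Omega> v x))\<^sup>2"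
      using norm_cross_dot[of "outer_normal \<Omega> x" "boundary_trace \<Omega> v x"]
        zero_le_power2[of "outer_normal \<Omega> x \<bullet> boundary_trace \<Omega> v x"]
      unfolding tangential_trace_def by linarith
    then have "norm (tangential_trace \<Omega> v x) \<le> norm (outer_normal \<Omega> x) * norm (boundary_trace \<Omega> v x)"
      by (rule power2_le_imp_le) simp
    also have "\<dots> \<le> c * (C * L2_norm \<Omega> v)" using c trace by (intro mult_mono) auto
    finally show ?case by (simp add: mult.assoc)
  qed
  then show ?thesis using c(1) C(1) by (intro exI[of _ "c * C"]) auto
qed

context
  fixes b :: "vec3 \<Rightarrow> vec3 \<Rightarrow> vec3"
  assumes b: "B3 \<Omega> b"
begin

text \<open>The growth bound \<open>C (|\<xi>| + 1)\<close> is applied to \<open>r \<xi>\<close>. By homogeneity the constant term is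
  scaled to \<open>C / r\<close>, which is arbitrarily small.\<close>

lemma boundary_law_linear_growth:
  "\<exists>C\<ge>0. AE x in surface_measure \<Omega>. \<forall>\<xi>. norm (b x \<xi>) \<le> C * norm \<xi>"
proof -
  obtain C where C: "C > 0" "AE x in surface_measure \<Omega>. \<forall>\<xi>. norm (b x \<xi>) \<le> C * (norm \<xi> + 1)"
    using b unfolding B3_def by blast
  have hom: "AE x in surface_measure \<Omega>. \<forall>\<xi>. \<forall>r\<ge>0. b x (r *\<^sub>R \<xi>) = r *\<^sub>R b x \<xi>"
    using b unfolding B3_def by blast
  have "AE x in surface_measure \<Omega>. \<forall>\<xi>. norm (b x \<xi>) \<le> C * norm \<xi>"
    using C(2) hom
  proof eventually_elim
    case (elim x)
    show ?case
    proof
      fix \<xi>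
      show "norm (b x \<xi>) \<le> C * norm \<xi>"
      proof (rule field_le_epsilon)
        fix e :: real assume e: "e > 0"
        define r where "r = C / e"
        have r: "r > 0" using C e by (simp add: r_def)
        have "r * norm (b x \<xi>) = norm (b x (r *\<^sub>R \<xi>))" using elim(2) r by simp
        also have "\<dots> \<le> C * (norm (r *\<^sub>R \<xi>) + 1)" using elim(1) by blast
        also have "\<dots> = r * (C * norm \<xi> + e)" using r e C by (simp add: r_def field_simps)
        finally show "norm (b x \<xi>) \<le> C * norm \<xi> + e" using r by simp
      qed
    qed
  qed
  then show ?thesis using C(1) by (meson less_imp_le)
qed

lemma boundary_form_bounded:
  "\<exists>C\<ge>0. \<forall>u\<in>ND \<Omega> \<T>. \<forall>v\<in>ND \<Omega> \<T>.
     \<bar>LINT x|surface_measure \<Omega>. b x (tangential_trace \<Omega> u x) \<bullet> tangential_trace \<Omega> v x\<bar>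
       \<le> C * (L2_norm \<Omega> u * L2_norm \<Omega> v)"
proof -
  obtain C where C: "C \<ge> 0" "AE x in surface_measure \<Omega>. \<forall>\<xi>. norm (b x \<xi>) \<le> C * norm \<xi>"
    using boundary_law_linear_growth by blast
  obtain D where D: "D \<ge> 0"
    "\<And>v. v \<in> ND \<Omega> \<T> \<Longrightarrow> AE x in surface_measure \<Omega>. norm (tangential_trace \<Omega> v x) \<le> D * L2_norm \<Omega> v"
    using tangential_trace_bounded by blast
  let ?S = "measure (surface_measure \<Omega>) (space (surface_measure \<Omega>))"
  have "\<bar>LINT x|surface_measure \<Omega>. b x (tangential_trace \<Omega> u x) \<bullet> tangential_trace \<Omega> v x\<bar>
       \<le> (C * D * D * ?S) * (L2_norm \<Omega> u * L2_norm \<Omega> v)" if u: "u \<in> ND \<Omega> \<T>" and v: "v \<in> ND \<Omega> \<T>" for u v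
  proof -
    have "\<bar>LINT x|surface_measure \<Omega>. b x (tangential_trace \<Omega> u x) \<bullet> tangential_trace \<Omega> v x\<bar>
        \<le> (LINT x|surface_measure \<Omega>. (C * (D * L2_norm \<Omega> u)) * (D * L2_norm \<Omega> v))"
    proof (rule abs_integral_le)
      show "integrable (surface_measure \<Omega>) (\<lambda>x. (C * (D * L2_norm \<Omega> u)) * (D * L2_norm \<Omega> v))"
        by (rule finite_measure.integrable_const[OF finite_surface_measure[OF open_domain bounded_domain lipschitz]])
      show "AE x in surface_measure \<Omega>. \<bar>b x (tangential_trace \<Omega> u x) \<bullet> tangential_trace \<Omega> v x\<bar>
          \<le> (C * (D * L2_norm \<Omega> u)) * (D * L2_norm \<Omega> v)"
        using C(2) D(2)[OF u] D(2)[OF v]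
      proof eventually_elim
        case (elim x)
        let ?u = "tangential_trace \<Omega> u x" and ?v = "tangential_trace \<Omega> v x"
        have "\<bar>b x ?u \<bullet> ?v\<bar> \<le> norm (b x ?u) * norm ?v" by (rule Cauchy_Schwarz_ineq2)
        also have "norm (b x ?u) \<le> C * norm ?u" using elim(1) by blast
        also have "C * norm ?u \<le> C * (D * L2_norm \<Omega> u)" using elim(2) C(1) by (rule mult_left_mono)
        finally have "\<bar>b x ?u \<bullet> ?v\<bar> \<le> C * (D * L2_norm \<Omega> u) * norm ?v" by (simp add: mult_right_mono)
        also have "\<dots> \<le> C * (D * L2_norm \<Omega> u) * (D * L2_norm \<Omega> v)"
          using elim(3) C(1) D(1) by (intro mult_left_mono) auto
        finally show ?case .
      qed
    qed
    then show ?thesis by (simp add: algebra_simps)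
  qed
  then show ?thesis using C(1) D(1) by (intro exI[of _ "C * D * D * ?S"]) auto
qed

lemma boundary_form_nonneg:
  "0 \<le> (LINT x|surface_measure \<Omega>. b x (tangential_trace \<Omega> u x) \<bullet> tangential_trace \<Omega> u x)"
proof (rule integral_nonneg_AE)
  have "AE x in surface_measure \<Omega>. (\<forall>\<xi> \<eta>. 0 \<le> (b x \<xi> - b x \<eta>) \<bullet> (\<xi> - \<eta>)) \<and> b x 0 = 0"
    using b unfolding B3_def by (auto elim: eventually_mono)
  then show "AE x in surface_measure \<Omega>. 0 \<le> b x (tangential_trace \<Omega> u x) \<bullet> tangential_trace \<Omega> u x"
  proof eventually_elim
    case (elim x)
    then have "0 \<le> (b x (tangential_trace \<Omega> u x) - b x 0) \<bullet> (tangential_trace \<Omega> u x - 0)" by blast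
    then show ?case using elim by simp
  qed
qed

end

text \<open>A bounded right inverse of the curl on fields with elementwise constant curl. The functionals are
  the integrals of the components of the curl over the tetrahedra; together they determine an
  elementwise constant curl.\<close>

lemma curl_representation:
  "\<exists>(M::nat) e C. C \<ge> 0 \<and> (\<forall>j<M. e j \<in> ND \<Omega> \<T>) \<and>
    (\<forall>u\<in>ND \<Omega> \<T>. (\<forall>K\<in>\<T>. \<exists>a. AE x in lebesgue_on (interior K). curl \<Omega> u x = a) \<longrightarrow>
      (\<exists>c. (AE x in lebesgue_on \<Omega>. curl \<Omega> u x = (\<Sum>j<M. c j *\<^sub>R curl \<Omega> (e j) x)) \<and>
           (\<forall>j<M. \<bar>c j\<bar> \<le> C * L2_norm \<Omega> (curl \<Omega> u))))"
proof -
  define V where "V = {u \<in> ND \<Omega> \<T>. \<forall>K\<in>\<T>. \<exists>a. AE x in lebesgue_on (interior K). curl \<Omega> u x = a}"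
  define l where "l u = (\<lambda>(K, k). if K \<in> \<T> then (LINT x|lebesgue_on (interior K). curl \<Omega> u x $ k) else 0)"
    for u :: field
  let ?I = "\<T> \<times> (UNIV :: 3 set)"
  have curl_add: "AE x in lebesgue_on \<Omega>. curl \<Omega> (\<lambda>x. u x + c *\<^sub>R v x) x = curl \<Omega> u x + c *\<^sub>R curl \<Omega> v x"
    if "u \<in> V" "v \<in> V" for u v c
    using that by (intro curl_add_scaleR[OF open_domain bounded_domain] ND_Hcurl) (auto simp: V_def)
  have V_closed: "(\<lambda>x. u x + c *\<^sub>R v x) \<in> V" if u: "u \<in> V" and v: "v \<in> V" for u v c
    unfolding V_def
  proof (intro CollectI conjI ballI)
    show "(\<lambda>x. u x + c *\<^sub>R v x) \<in> ND \<Omega> \<T>" using u v by (intro ND_add_scaleR) (auto simp: V_def)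
    fix K assume K: "K \<in> \<T>"
    obtain a a' where "AE x in lebesgue_on (interior K). curl \<Omega> u x = a" "AE x in lebesgue_on (interior K). curl \<Omega> v x = a'"
      using u v K unfolding V_def by blast
    with AE_interior[OF K curl_add[OF u v, of c]]
    have "AE x in lebesgue_on (interior K). curl \<Omega> (\<lambda>x. u x + c *\<^sub>R v x) x = a + c *\<^sub>R a'"
      by eventually_elim simp
    then show "\<exists>a. AE x in lebesgue_on (interior K). curl \<Omega> (\<lambda>x. u x + c *\<^sub>R v x) x = a" by blast
  qed
  have const_int: "l u (K, k) = measure lebesgue K * a $ k"
    if "K \<in> \<T>" "AE x in lebesgue_on (interior K). curl \<Omega> u x = a" "u \<in> V" for u K k a
  proof -
    have "curl \<Omega> u \<in> borel_measurable (lebesgue_on (interior K))"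
      using that by (intro L2D(1) L2_restrict_interior(1) curl_ND_L2) (auto simp: V_def)
    from borel_measurable_inner[OF this borel_measurable_const[of "axis k 1"]]
    have "(\<lambda>x. curl \<Omega> u x $ k) \<in> borel_measurable (lebesgue_on (interior K))"
      by (simp add: inner_axis)
    then have "(LINT x|lebesgue_on (interior K). curl \<Omega> u x $ k) = (LINT x|lebesgue_on (interior K). a $ k)"
      using that(2) by (intro integral_cong_AE) (auto elim: eventually_mono)
    also have "\<dots> = measure lebesgue K * a $ k"
      using measure_element(2)[OF that(1)] by (simp add: measure_restrict_space)
    finally show ?thesis using that(1) by (simp add: l_def)
  qed
  have l_closed: "(\<lambda>i. p i + c * q i) \<in> l ` V" if pq: "p \<in> l ` V" "q \<in> l ` V" for p q c
  proof -
    obtain u v where uv: "u \<in> V" "v \<in> V" "p = l u" "q = l v" using pq by blast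
    have "p i + c * q i = l (\<lambda>x. u x + c *\<^sub>R v x) i" for i
    proof (cases i)
      case (Pair K k)
      show ?thesis
      proof (cases "K \<in> \<T>")
        case K: True
        obtain a a' where a: "AE x in lebesgue_on (interior K). curl \<Omega> u x = a" "AE x in lebesgue_on (interior K). curl \<Omega> v x = a'"
          using uv K unfolding V_def by blast
        with AE_interior[OF K curl_add[OF uv(1,2), of c]]
        have "AE x in lebesgue_on (interior K). curl \<Omega> (\<lambda>x. u x + c *\<^sub>R v x) x = a + c *\<^sub>R a'"
          by eventually_elim simp
        from const_int[OF K this V_closed[OF uv(1,2)]] show ?thesis
          unfolding uv Pair using const_int[OF K a(1) uv(1)] const_int[OF K a(2) uv(2)]
          by (simp add: algebra_simps)
      qed (simp add: uv Pair l_def)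
    qed
    then have "(\<lambda>i. p i + c * q i) = l (\<lambda>x. u x + c *\<^sub>R v x)" by blast
    then show ?thesis using V_closed[OF uv(1,2)] by blast
  qed
  have ne: "l ` V \<noteq> {}"
  proof -
    have z: "has_weak_curl \<Omega> (\<lambda>_. 0) (\<lambda>_. 0)" by (simp add: has_weak_curl_def L2_inner_def)
    then have Z: "(\<lambda>_. 0) \<in> Hcurl \<Omega>" using L2_zero by (auto simp: Hcurl_def)
    have "\<exists>a b. \<forall>x\<in>interior K. 0 = a + cross3 b x" for K
      by (intro exI[of _ 0]) simp
    then have ND0: "(\<lambda>_. 0) \<in> ND \<Omega> \<T>" using Z by (auto simp: ND_def)
    have AE0: "AE x in lebesgue_on \<Omega>. curl \<Omega> (\<lambda>_. 0) x = 0"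
      using weak_curl_unique[OF open_domain bounded_domain curl_in_L2[OF Z] L2_zero has_weak_curl_curl[OF Z] z] .
    have "\<forall>K\<in>\<T>. \<exists>a. AE x in lebesgue_on (interior K). curl \<Omega> (\<lambda>_. 0) x = a"
      by (intro ballI exI[of _ 0] AE_interior AE0)
    then have "(\<lambda>_. 0) \<in> V" using ND0 by (simp add: V_def)
    then show ?thesis by blast
  qed
  have fin: "finite ?I" using finite_mesh by simp
  have "\<exists>(M::nat) p C. C \<ge> 0 \<and> (\<forall>j<M. p j \<in> l ` V) \<and>
    (\<forall>x\<in>l ` V. \<exists>c. (\<forall>i\<in>?I. x i = (\<Sum>j<M. c j * p j i)) \<and> (\<forall>j<M. \<bar>c j\<bar> \<le> C * (\<Sum>i\<in>?I. \<bar>x i\<bar>)))"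
    by (rule finite_dimensional_representation[OF fin ne]) (rule l_closed)
  then obtain M :: nat and p C where C: "C \<ge> 0" and p: "\<forall>j<M. p j \<in> l ` V"
    and rep: "\<forall>x\<in>l ` V. \<exists>c. (\<forall>i\<in>?I. x i = (\<Sum>j<M. c j * p j i)) \<and> (\<forall>j<M. \<bar>c j\<bar> \<le> C * (\<Sum>i\<in>?I. \<bar>x i\<bar>))"
    by (elim exE conjE)
  obtain e where e: "\<And>j. j < M \<Longrightarrow> e j \<in> V \<and> p j = l (e j)" proof -
    have "\<forall>j. \<exists>v. j < M \<longrightarrow> v \<in> V \<and> p j = l v" using p by auto
    from choice[OF this] show thesis using that by blast
  qed
  define D where "D = real (card ?I) * L2_norm \<Omega> (\<lambda>_. 1 :: real)"
  have D: "D \<ge> 0" by (simp add: D_def)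
  have one: "(\<lambda>_. 1 :: real) \<in> L2 \<Omega>" by (rule L2_bounded[OF lmeasurable_domain]) auto
  have l_le: "(\<Sum>i\<in>?I. \<bar>l u i\<bar>) \<le> D * L2_norm \<Omega> (curl \<Omega> u)" if u: "u \<in> V" for u
  proof -
    have c: "curl \<Omega> u \<in> L2 \<Omega>" using u by (intro curl_ND_L2) (simp add: V_def)
    have nc: "(\<lambda>x. norm (curl \<Omega> u x)) \<in> L2 \<Omega>"
      by (rule L2_dominated[OF c, where c = 1]) (use L2D(1)[OF c] in auto)
    have "\<bar>l u i\<bar> \<le> L2_norm \<Omega> (\<lambda>_. 1 :: real) * L2_norm \<Omega> (curl \<Omega> u)" if i: "i \<in> ?I" for i
    proof -
      obtain K k where K: "i = (K, k)" "K \<in> \<T>" using i by auto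
      have "\<bar>l u i\<bar> \<le> (LINT x|lebesgue_on (interior K). norm (curl \<Omega> u x))"
        unfolding K(1) l_def using K(2)
        by (auto intro!: abs_integral_le L2_integrable_norm lmeasurable_interior L2_restrict_interior(1) c component_le_norm_cart)
      also have "\<dots> \<le> (LINT x|lebesgue_on \<Omega>. norm (curl \<Omega> u x))"
        using L2_integrable_norm[OF lmeasurable_domain c] interior_subset_domain[OF K(2)] sets_domain
        by (intro integral_mono_lebesgue_on_AE) auto
      also have "\<dots> = L2_inner \<Omega> (\<lambda>_. 1 :: real) (\<lambda>x. norm (curl \<Omega> u x))"
        by (simp add: L2_inner_def)
      also have "\<dots> \<le> L2_norm \<Omega> (\<lambda>_. 1 :: real) * L2_norm \<Omega> (\<lambda>x. norm (curl \<Omega> u x))"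
        using L2_Cauchy_Schwarz[OF one nc] by simp
      also have "L2_norm \<Omega> (\<lambda>x. norm (curl \<Omega> u x)) = L2_norm \<Omega> (curl \<Omega> u)"
        by (simp add: L2_norm_def)
      finally show ?thesis .
    qed
    then show ?thesis unfolding D_def mult.assoc by (intro sum_bounded_above)
  qed
  show ?thesis
  proof (rule exI[of _ M], rule exI[of _ e], rule exI[of _ "C * D"], intro conjI ballI impI allI)
    show "C * D \<ge> 0" using C D by simp
    show "e j \<in> ND \<Omega> \<T>" if "j < M" for j using e[OF that] by (simp add: V_def)
    fix u assume "u \<in> ND \<Omega> \<T>" "\<forall>K\<in>\<T>. \<exists>a. AE x in lebesgue_on (interior K). curl \<Omega> u x = a"
    then have u: "u \<in> V" by (simp add: V_def)
    obtain c where c: "\<forall>i\<in>?I. l u i = (\<Sum>j<M. c j * p j i)" "\<forall>j<M. \<bar>c j\<bar> \<le> C * (\<Sum>i\<in>?I. \<bar>l u i\<bar>)"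
      using rep u by blast
    have "\<forall>j<M. \<bar>c j\<bar> \<le> C * D * L2_norm \<Omega> (curl \<Omega> u)"
      using c(2) mult_left_mono[OF l_le[OF u] C] by (auto simp: mult.assoc intro: order_trans)
    moreover have "AE x in lebesgue_on \<Omega>. curl \<Omega> u x = (\<Sum>j<M. c j *\<^sub>R curl \<Omega> (e j) x)"
    proof (rule AE_elementwise)
      fix K assume K: "K \<in> \<T>"
      obtain a where a: "AE x in lebesgue_on (interior K). curl \<Omega> u x = a" using u K unfolding V_def by blast
      have "\<forall>j. \<exists>a. j < M \<longrightarrow> (AE x in lebesgue_on (interior K). curl \<Omega> (e j) x = a)"
        using e K unfolding V_def by blast
      then obtain a' where a': "\<And>j. j < M \<Longrightarrow> AE x in lebesgue_on (interior K). curl \<Omega> (e j) x = a' j"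
        by metis
      have "a $ k = (\<Sum>j<M. c j *\<^sub>R a' j) $ k" for k
      proof -
        have "measure lebesgue K * a $ k = (\<Sum>j<M. c j * p j (K, k))"
          using c(1) const_int[OF K a u, of k] K by simp
        also have "\<dots> = (\<Sum>j<M. c j * (measure lebesgue K * a' j $ k))"
          using e const_int[OF K a'] by (intro sum.cong) auto
        also have "\<dots> = measure lebesgue K * (\<Sum>j<M. c j *\<^sub>R a' j) $ k"
          by (simp add: sum_distrib_left mult.left_commute)
        finally show ?thesis using measure_element(1)[OF K] by simp
      qed
      then have eq: "a = (\<Sum>j<M. c j *\<^sub>R a' j)" by (simp add: vec_eq_iff)
      have "AE x in lebesgue_on (interior K). \<forall>j\<in>{..<M}. curl \<Omega> (e j) x = a' j"
        using a' by (intro AE_finite_allI) auto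
      with a show "AE x in lebesgue_on (interior K). curl \<Omega> u x = (\<Sum>j<M. c j *\<^sub>R curl \<Omega> (e j) x)"
        by eventually_elim (simp add: eq)
    qed
    ultimately show "\<exists>c. (AE x in lebesgue_on \<Omega>. curl \<Omega> u x = (\<Sum>j<M. c j *\<^sub>R curl \<Omega> (e j) x)) \<and>
           (\<forall>j<M. \<bar>c j\<bar> \<le> C * D * L2_norm \<Omega> (curl \<Omega> u))" by blast
  qed
qed

end

section \<open>The scheme after the transient phase\<close>

lemma decays_exponentially_if_two_step_contraction:
  fixes e :: "nat \<Rightarrow> real"
  assumes \<tau>: "\<tau> > 0" and q: "0 < q" "q < 1"
    and nonneg: "\<And>n. n \<ge> m \<Longrightarrow> e n \<ge> 0"
    and decr: "\<And>n. n \<ge> m \<Longrightarrow> e (Suc n) \<le> e n"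
    and contr: "\<And>n. n \<ge> m \<Longrightarrow> e (Suc (Suc n)) \<le> q * e n"
  shows "decays_exponentially \<tau> e"
proof -
  define c where "c = - ln q / (2 * \<tau>)"
  have c: "c > 0" using q \<tau> ln_less_zero[of q] by (simp add: c_def divide_neg_pos)
  have two: "e (m + 2 * k) \<le> q ^ k * e m" for k
  proof (induction k)
    case (Suc k)
    have "e (m + 2 * Suc k) \<le> q * e (m + 2 * k)" using contr[of "m + 2 * k"] by simp
    also have "\<dots> \<le> q * (q ^ k * e m)" using Suc q by (intro mult_left_mono) auto
    finally show ?case by (simp add: mult.assoc)
  qed simp
  have odd: "e (m + 2 * k + 1) \<le> q ^ k * e m" for k
    using decr[of "m + 2 * k"] two[of k] by simp
  have late: "e n \<le> e m * exp (c * ((real m + 1) * \<tau>)) * exp (- c * (real n * \<tau>))" if n: "n \<ge> m" for n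
  proof -
    \<comment> \<open>Up to one step, \<open>n\<close> is reached from \<open>m\<close> by \<open>k\<close> double steps.\<close>
    define k where "k = (n - m) div 2"
    have nk: "n = m + 2 * k \<or> n = m + 2 * k + 1" using n by (auto simp: k_def)
    then have le: "e n \<le> q ^ k * e m" using two[of k] odd[of k] by auto
    have "real n \<le> real m + 2 * real k + 1" using nk by auto
    then have "c * (real n * \<tau>) \<le> c * ((real m + 2 * real k + 1) * \<tau>)" using c \<tau> by (intro mult_left_mono mult_right_mono) auto
    moreover have "c * (2 * real k * \<tau>) = - real k * ln q" using \<tau> by (simp add: c_def)
    ultimately have "real k * ln q \<le> c * ((real m + 1) * \<tau>) - c * (real n * \<tau>)"
      by (simp add: algebra_simps)
    then have "exp (real k * ln q) \<le> exp (c * ((real m + 1) * \<tau>) + - c * (real n * \<tau>))" by simp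
    moreover have "exp (real k * ln q) = q ^ k" using q by (simp add: exp_of_nat_mult)
    ultimately have "q ^ k * e m \<le> exp (c * ((real m + 1) * \<tau>) + - c * (real n * \<tau>)) * e m"
      using nonneg[of m] by (intro mult_right_mono) auto
    with le have "e n \<le> exp (c * ((real m + 1) * \<tau>) + - c * (real n * \<tau>)) * e m" by (rule order_trans)
    then show ?thesis unfolding exp_add by (simp only: ac_simps)
  qed
  \<comment> \<open>The sum takes care of the finitely many initial terms.\<close>
  define C where "C = e m * exp (c * ((real m + 1) * \<tau>)) + (\<Sum>n<m. \<bar>e n\<bar> * exp (c * (real n * \<tau>))) + 1"
  have sum0: "(\<Sum>n<m. \<bar>e n\<bar> * exp (c * (real n * \<tau>))) \<ge> 0" by (intro sum_nonneg) auto
  have em: "e m * exp (c * ((real m + 1) * \<tau>)) \<ge> 0" using nonneg[of m] by simp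
  have "e n \<le> C * exp (- c * (real n * \<tau>))" for n
  proof (cases "n \<ge> m")
      case True
      have "e m * exp (c * ((real m + 1) * \<tau>)) * exp (- c * (real n * \<tau>)) \<le> C * exp (- c * (real n * \<tau>))"
        using sum0 by (intro mult_right_mono) (auto simp: C_def)
      with late[OF True] show ?thesis by linarith
    next
      case False
      have "\<bar>e n\<bar> * exp (c * (real n * \<tau>)) \<le> (\<Sum>n<m. \<bar>e n\<bar> * exp (c * (real n * \<tau>)))"
        using False by (intro member_le_sum) auto
      then have "\<bar>e n\<bar> * exp (c * (real n * \<tau>)) \<le> C" using em by (simp add: C_def)
      then have "\<bar>e n\<bar> * exp (c * (real n * \<tau>)) * exp (- c * (real n * \<tau>)) \<le> C * exp (- c * (real n * \<tau>))"
        by (rule mult_right_mono) simp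
      moreover have "exp (c * (real n * \<tau>)) * exp (- c * (real n * \<tau>)) = 1" by (simp flip: exp_add)
      ultimately have "\<bar>e n\<bar> \<le> C * exp (- c * (real n * \<tau>))" unfolding mult.assoc by (simp only: mult_1_right)
      then show ?thesis by linarith
    qed
  moreover have "C > 0" using sum0 em by (simp add: C_def)
  ultimately show ?thesis using c unfolding decays_exponentially_def by blast
qed

locale maxwell_scheme = mesh_domain \<Omega> \<T> for \<Omega> \<T> +
  fixes \<tau> T\<^sub>\<mu> T\<^sub>J T\<^sub>f :: real
    and \<epsilon> \<mu> :: "real \<Rightarrow> vec3 \<Rightarrow> mat3" and \<mu>inf :: "vec3 \<Rightarrow> mat3"
    and J :: "vec3 \<Rightarrow> vec3 \<Rightarrow> vec3 \<Rightarrow> real \<Rightarrow> vec3"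
    and b :: "vec3 \<Rightarrow> vec3 \<Rightarrow> vec3" and f :: "real \<Rightarrow> field"
  assumes \<tau>: "\<tau> > 0" and B1: "B1 \<Omega> \<epsilon> \<mu> \<mu>inf T\<^sub>\<mu>" and B2: "B2 \<Omega> J T\<^sub>J" and B3: "B3 \<Omega> b"
    and B4: "B4 \<Omega> f T\<^sub>f" and B5: "B5 \<Omega> \<T> \<tau> \<epsilon> J T\<^sub>J"
begin

abbreviation \<mu>h :: "vec3 \<Rightarrow> mat3" where "\<mu>h \<equiv> Qh \<T> \<mu>inf"

abbreviation boundary_form :: "field \<Rightarrow> field \<Rightarrow> real" where
  "boundary_form u v \<equiv> LINT x|surface_measure \<Omega>. b x (tangential_trace \<Omega> u x) \<bullet> tangential_trace \<Omega> v x"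

lemma T_nonneg: "T\<^sub>\<mu> \<ge> 0" "T\<^sub>J \<ge> 0" "T\<^sub>f \<ge> 0"
  using B1 B2 B4 unfolding B1_def B2_def B4_def by blast+

lemma permittivity_Linf: "t \<ge> 0 \<Longrightarrow> \<epsilon> t \<in> Linf_sym \<Omega>"
  and permeability_Linf: "t \<ge> 0 \<Longrightarrow> \<mu> t \<in> Linf_sym \<Omega>"
  and limit_permeability_Linf: "\<mu>inf \<in> Linf_sym \<Omega>"
  using B1 unfolding B1_def time_continuous_on_def by auto

lemma Linf_sym_measurable: "g \<in> Linf_sym \<Omega> \<Longrightarrow> g \<in> borel_measurable (lebesgue_on \<Omega>)"
  by (simp add: Linf_sym_def)

lemma Linf_sym_AE_symmetric:
  "g \<in> Linf_sym \<Omega> \<Longrightarrow> AE x in lebesgue_on \<Omega>. \<forall>\<xi> \<eta>. \<xi> \<bullet> (g x *v \<eta>) = \<eta> \<bullet> (g x *v \<xi>)"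
  unfolding Linf_sym_def using symmetric_matrix_inner by (auto elim: eventually_mono)

lemma coefficient_bounds:
  obtains \<epsilon>l \<epsilon>u \<mu>u where "\<epsilon>l > 0" "\<epsilon>u > 0" "\<mu>u > 0"
    "\<And>t. t \<ge> 0 \<Longrightarrow> AE x in lebesgue_on \<Omega>. \<forall>\<xi>. \<epsilon>l * (norm \<xi>)\<^sup>2 \<le> \<xi> \<bullet> (\<epsilon> t x *v \<xi>)"
    "\<And>t. t \<ge> 0 \<Longrightarrow> AE x in lebesgue_on \<Omega>. \<forall>\<xi>. \<xi> \<bullet> (\<epsilon> t x *v \<xi>) \<le> \<epsilon>u * (norm \<xi>)\<^sup>2"
    "\<And>t. t \<ge> 0 \<Longrightarrow> AE x in lebesgue_on \<Omega>. \<forall>\<xi>. \<xi> \<bullet> (\<mu> t x *v \<xi>) \<le> \<mu>u * (norm \<xi>)\<^sup>2"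
proof -
  obtain \<epsilon>l \<epsilon>u \<mu>l \<mu>u where pos: "\<epsilon>l > 0" "\<epsilon>u > 0" "\<mu>u > 0"
    and AE: "\<forall>t\<ge>0. AE x in lebesgue_on \<Omega>. \<forall>\<xi>.
        \<epsilon>l * (norm \<xi>)\<^sup>2 \<le> \<xi> \<bullet> (\<epsilon> t x *v \<xi>) \<and> \<xi> \<bullet> (\<epsilon> t x *v \<xi>) \<le> \<epsilon>u * (norm \<xi>)\<^sup>2 \<and>
        \<mu>l * (norm \<xi>)\<^sup>2 \<le> \<xi> \<bullet> (\<mu> t x *v \<xi>) \<and> \<xi> \<bullet> (\<mu> t x *v \<xi>) \<le> \<mu>u * (norm \<xi>)\<^sup>2"
    using B1 unfolding B1_def by (elim conjE exE) (rule that)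
  show thesis
    by (rule that[OF pos]; drule AE[rule_format]; erule eventually_mono; blast)
qed

lemma permittivity_operator_bound:
  "\<exists>M>0. \<forall>t\<ge>0. AE x in lebesgue_on \<Omega>. \<forall>\<eta>. norm (\<epsilon> t x *v \<eta>) \<le> M * norm \<eta>"
proof -
  obtain \<epsilon>l \<epsilon>u \<mu>u where *: "\<epsilon>l > 0" "\<epsilon>u > 0"
    "\<And>t. t \<ge> 0 \<Longrightarrow> AE x in lebesgue_on \<Omega>. \<forall>\<xi>. \<epsilon>l * (norm \<xi>)\<^sup>2 \<le> \<xi> \<bullet> (\<epsilon> t x *v \<xi>)"
    "\<And>t. t \<ge> 0 \<Longrightarrow> AE x in lebesgue_on \<Omega>. \<forall>\<xi>. \<xi> \<bullet> (\<epsilon> t x *v \<xi>) \<le> \<epsilon>u * (norm \<xi>)\<^sup>2"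
    by (rule coefficient_bounds) blast
  have "AE x in lebesgue_on \<Omega>. \<forall>\<eta>. norm (\<epsilon> t x *v \<eta>) \<le> \<epsilon>u * norm \<eta>" if t: "t \<ge> 0" for t
    using *(3)[OF t] *(4)[OF t] Linf_sym_AE_symmetric[OF permittivity_Linf[OF t]]
  proof eventually_elim
    case (elim x)
    have "0 \<le> \<xi> \<bullet> (\<epsilon> t x *v \<xi>)" for \<xi>
      using elim(1)[rule_format, of \<xi>] *(1) by (meson mult_nonneg_nonneg less_imp_le order_trans zero_le_power2)
    with elim *(2) show ?case by (intro allI psd_matrix_bound) auto
  qed
  then show ?thesis using *(2) by blast
qed

lemma Qh_permeability: "t \<ge> T\<^sub>\<mu> \<Longrightarrow> Qh \<T> (\<mu> t) = \<mu>h"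
  using B1 T_nonneg(1) unfolding B1_def
  by (intro Qh_cong_AE Linf_sym_measurable permeability_Linf limit_permeability_Linf) auto

lemma Qh_permeability_deriv:
  assumes "t > T\<^sub>\<mu>"
  shows "Qh \<T> (dt \<Omega> \<mu> t) x = 0"
proof -
  have sob: "\<mu> \<in> time_sobolev \<Omega> (Linf_sym \<Omega>) (Linf_norm \<Omega>) 2 (Linf_time (Linf_sym \<Omega>) (Linf_norm \<Omega>) {0<..})"
    and const: "\<And>t. t \<ge> T\<^sub>\<mu> \<Longrightarrow> AE x in lebesgue_on \<Omega>. \<mu> t x = \<mu>inf x"
    using B1 unfolding B1_def by blast+
  have "AE x in lebesgue_on \<Omega>. dt \<Omega> \<mu> t x = 0"
    using T_nonneg(1)
    by (intro dt_zero_if_eventually_constant[OF lmeasurable_domain sob limit_permeability_Linf T_nonneg(1) _ const assms]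
        permeability_Linf) auto
  moreover have "dt \<Omega> \<mu> t \<in> borel_measurable (lebesgue_on \<Omega>)"
    using dt_properties(1)[OF sob] assms T_nonneg(1)
    by (intro Linf_sym_measurable) (auto simp: time_continuous_on_def)
  ultimately have "Qh \<T> (dt \<Omega> \<mu> t) = Qh \<T> (\<lambda>_. 0)" by (intro Qh_cong_AE) auto
  then show ?thesis by (simp add: Qh_zero)
qed

lemma Qh_source: 
  assumes "t \<ge> T\<^sub>f"
  shows "Qh \<T> (f t) x = 0"
proof -
  have "t \<ge> 0" using assms T_nonneg(3) by simp
  then have "f t \<in> L2 \<Omega>" using B4 unfolding B4_def time_continuous_on_def by auto
  moreover have "AE x in lebesgue_on \<Omega>. f t x = 0" using B4 assms unfolding B4_def by blast
  ultimately have "Qh \<T> (f t) = Qh \<T> (\<lambda>_. 0)" using L2D(1) by (intro Qh_cong_AE) auto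
  then show ?thesis by (simp add: Qh_zero)
qed

lemma limit_permeability_lower:
  obtains c where "c > 0" "AE x in lebesgue_on \<Omega>. \<forall>\<xi>. c * (norm \<xi>)\<^sup>2 \<le> \<xi> \<bullet> (\<mu>h x *v \<xi>)"
proof -
  obtain c where c: "c > 0" "AE x in lebesgue_on \<Omega>. \<forall>\<xi>. c * (norm \<xi>)\<^sup>2 \<le> \<xi> \<bullet> (\<mu>inf x *v \<xi>)"
    using B1 unfolding B1_def by blast
  have "AE x in lebesgue_on \<Omega>. \<forall>\<xi>. c * (norm \<xi>)\<^sup>2 \<le> \<xi> \<bullet> (\<mu>h x *v \<xi>)"
    using AE_in_element
    by eventually_elim (use Qh_lower[OF limit_permeability_Linf _ _ c(2)] in blast)
  then show thesis using c(1) that by blast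
qed

text \<open>At late times the current vanishes for \<open>\<xi> = 0\<close> by homogeneity, so Lipschitz continuity bounds it by
  the electric field. The constant is uniform in time because \<open>\<partial>\<^sub>t \<epsilon>\<close> is uniformly bounded.\<close>

lemma current_bound:
  obtains C where "C \<ge> 0"
    and "\<And>t u w. t \<ge> T\<^sub>J \<Longrightarrow> t > 0 \<Longrightarrow> u \<in> L2 \<Omega> \<Longrightarrow> w \<in> L2 \<Omega> \<Longrightarrow>
      (\<lambda>x. current \<Omega> \<epsilon> J x (u x) (w x) t) \<in> L2 \<Omega>"
    and "\<And>t u w. t \<ge> T\<^sub>J \<Longrightarrow> t > 0 \<Longrightarrow> u \<in> L2 \<Omega> \<Longrightarrow> w \<in> L2 \<Omega> \<Longrightarrow>
      AE x in lebesgue_on \<Omega>. norm (current \<Omega> \<epsilon> J x (u x) (w x) t) \<le> C * norm (u x)"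
    and "\<And>t u w. t \<ge> T\<^sub>J \<Longrightarrow> t > 0 \<Longrightarrow> u \<in> L2 \<Omega> \<Longrightarrow> w \<in> L2 \<Omega> \<Longrightarrow>
      AE x in lebesgue_on \<Omega>. current \<Omega> \<epsilon> J x (u x) (w x) t = current \<Omega> \<epsilon> J x (u x) 0 t"
proof -
  have sob2: "\<epsilon> \<in> time_sobolev \<Omega> (Linf_sym \<Omega>) (Linf_norm \<Omega>) 2 (Linf_time_loc (Linf_sym \<Omega>) (Linf_norm \<Omega>))"
    and sob1: "\<epsilon> \<in> time_sobolev \<Omega> (Linf_sym \<Omega>) (Linf_norm \<Omega>) 1 (Linf_time (Linf_sym \<Omega>) (Linf_norm \<Omega>) {0<..})"
    using B1 unfolding B1_def by blast+
  obtain C where C: "C \<ge> 0" "\<And>t. t > 0 \<Longrightarrow> AE x in lebesgue_on \<Omega>. norm (dt \<Omega> \<epsilon> t x) \<le> C"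
    using dt_uniformly_bounded[OF lmeasurable_domain sob2 sob1] by blast
  obtain L where L: "L > 0" "AE x in lebesgue_on \<Omega>. \<forall>\<xi> \<xi>' \<eta> \<eta>'. \<forall>t\<ge>0. \<forall>t'\<ge>0.
        norm (J x \<xi> \<eta> t - J x \<xi>' \<eta>' t')
        \<le> L * (norm (\<xi> - \<xi>') + norm (\<eta> - \<eta>') + (1 + norm \<xi> + norm \<xi>' + norm \<eta> + norm \<eta>') * \<bar>t - t'\<bar>)"
    using B2 unfolding B2_def by blast
  have "(\<lambda>x. current \<Omega> \<epsilon> J x (u x) (w x) t) \<in> L2 \<Omega> \<and>
     (AE x in lebesgue_on \<Omega>. norm (current \<Omega> \<epsilon> J x (u x) (w x) t) \<le> (L + C) * norm (u x)) \<and>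
     (AE x in lebesgue_on \<Omega>. current \<Omega> \<epsilon> J x (u x) (w x) t = current \<Omega> \<epsilon> J x (u x) 0 t)"
    if t: "t \<ge> T\<^sub>J" "t > 0" and u: "u \<in> L2 \<Omega>" and w: "w \<in> L2 \<Omega>" for t u w
  proof -
    have "\<forall>t\<ge>T\<^sub>J. \<forall>r\<ge>0. AE x in lebesgue_on \<Omega>. \<forall>\<xi> \<eta> \<eta>'.
        J x (r *\<^sub>R \<xi>) \<eta> t = r *\<^sub>R J x \<xi> \<eta> t \<and> J x \<xi> \<eta> t = J x \<xi> \<eta>' t"
      using B2 unfolding B2_def by (elim conjE)
    from this[rule_format, OF t(1) order_refl]
    have hom: "AE x in lebesgue_on \<Omega>. \<forall>\<xi> \<eta> \<eta>'. J x (0 *\<^sub>R \<xi>) \<eta> t = 0 *\<^sub>R J x \<xi> \<eta> t \<and> J x \<xi> \<eta> t = J x \<xi> \<eta>' t" .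
    have J_le: "AE x in lebesgue_on \<Omega>. norm (J x (u x) (w x) t) \<le> L * norm (u x)"
      using hom L(2)
    proof eventually_elim
      case (elim x)
      have "J x 0 (w x) t = 0" using elim(1) by (metis scaleR_zero_left)
      then show ?case using elim(2)[rule_format, of t t "u x" "w x" 0 "w x"] t(2) by simp
    qed
    have J_eq: "AE x in lebesgue_on \<Omega>. J x (u x) (w x) t = J x (u x) 0 t"
      using hom by eventually_elim metis
    have J_meas: "(\<lambda>x. J x (u x) (w x) t) \<in> borel_measurable (lebesgue_on \<Omega>)"
    proof -
      let ?F = "\<lambda>x p. J x (fst p) (snd p) t" and ?p = "\<lambda>x. (u x, w x)"
      have "(\<lambda>x. ?F x (?p x)) \<in> borel_measurable (lebesgue_on \<Omega>)"
      proof (rule caratheodory_measurable[OF sets_domain, where F = ?F and u = ?p])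
        show "(\<lambda>x. J x (fst p) (snd p) t) \<in> borel_measurable (lebesgue_on \<Omega>)" for p :: "vec3 \<times> vec3"
          using B2 t(2) unfolding B2_def by simp
        show "AE x in lebesgue_on \<Omega>. continuous_on UNIV (\<lambda>p :: vec3 \<times> vec3. J x (fst p) (snd p) t)"
          using L(2)
        proof eventually_elim
          case (elim x)
          have "(2 * L)-lipschitz_on UNIV (\<lambda>p. J x (fst p) (snd p) t)"
          proof (rule lipschitz_onI)
            fix p q :: "vec3 \<times> vec3"
            have "dist (J x (fst p) (snd p) t) (J x (fst q) (snd q) t) \<le> L * (norm (fst p - fst q) + norm (snd p - snd q))"
              using elim[rule_format, of t t "fst p" "snd p" "fst q" "snd q"] t(2) by (simp add: dist_norm)
            also have "\<dots> \<le> L * (dist p q + dist p q)"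
              using L(1) dist_fst_le[of p q] dist_snd_le[of p q] by (intro mult_left_mono add_mono) (auto simp: dist_norm)
            finally show "dist (J x (fst p) (snd p) t) (J x (fst q) (snd q) t) \<le> 2 * L * dist p q" by simp
          qed (use L(1) in simp)
          then show ?case by (rule lipschitz_on_continuous_on)
        qed
        show "(\<lambda>x. (u x, w x)) \<in> borel_measurable (lebesgue_on \<Omega>)"
          by (intro borel_measurable_Pair L2D(1) u w)
      qed
      then show ?thesis by simp
    qed
    have dtL: "dt \<Omega> \<epsilon> t \<in> Linf_sym \<Omega>"
      using dt_properties(1)[OF sob2] t(2) by (auto simp: time_continuous_on_def)
    have bound: "AE x in lebesgue_on \<Omega>. norm (current \<Omega> \<epsilon> J x (u x) (w x) t) \<le> (L + C) * norm (u x)"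
      using J_le C(2)[OF t(2)]
    proof eventually_elim
      case (elim x)
      have "norm (current \<Omega> \<epsilon> J x (u x) (w x) t) \<le> norm (J x (u x) (w x) t) + norm (dt \<Omega> \<epsilon> t x *v u x)"
        unfolding current_def by (rule norm_triangle_ineq)
      also have "\<dots> \<le> L * norm (u x) + C * norm (u x)"
        using elim by (intro add_mono order_trans[OF norm_matrix_vector_le] mult_right_mono) auto
      finally show ?case by (simp add: algebra_simps)
    qed
    have "(\<lambda>x. current \<Omega> \<epsilon> J x (u x) (w x) t) \<in> borel_measurable (lebesgue_on \<Omega>)"
      unfolding current_def using J_meas L2D(1)[OF matrix_vector_L2[OF dtL u]] by (rule borel_measurable_add)
    then have "(\<lambda>x. current \<Omega> \<epsilon> J x (u x) (w x) t) \<in> L2 \<Omega>" using L2_dominated[OF u _ bound] by blast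
    moreover have "AE x in lebesgue_on \<Omega>. current \<Omega> \<epsilon> J x (u x) (w x) t = current \<Omega> \<epsilon> J x (u x) 0 t"
      using J_eq by eventually_elim (simp add: current_def)
    ultimately show ?thesis using bound by blast
  qed
  moreover have "L + C \<ge> 0" using L(1) C(1) by simp
  ultimately show thesis using that[of "L + C"] by blast
qed

text \<open>The second equation of the scheme once the permeability is constant.\<close>

lemma Faraday_law:
  assumes t: "real n * \<tau> > T\<^sub>\<mu>" and sol: "solves_step \<Omega> \<T> \<tau> \<epsilon> \<mu> J b f n (E', H') (E, H)"
  shows "AE x in lebesgue_on \<Omega>. \<mu>h x *v (H x - H' x) = - \<tau> *\<^sub>R curl \<Omega> E x"
proof -
  have "AE x in lebesgue_on \<Omega>. \<mu>h x *v ((1/\<tau>) *\<^sub>R (H x - H' x)) + curl \<Omega> E x + 0 *v H x = 0"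
    using sol t Qh_permeability[of "real n * \<tau>"] Qh_permeability_deriv[of "real n * \<tau>"]
    by (simp add: solves_step_def)
  then show ?thesis
  proof eventually_elim
    case (elim x)
    then have "(1/\<tau>) *\<^sub>R (\<mu>h x *v (H x - H' x)) = - curl \<Omega> E x"
      by (simp add: matrix_vector_mult_scaleR eq_neg_iff_add_eq_0)
    then have "\<tau> *\<^sub>R ((1/\<tau>) *\<^sub>R (\<mu>h x *v (H x - H' x))) = \<tau> *\<^sub>R (- curl \<Omega> E x)" by simp
    then show ?case using \<tau> by simp
  qed
qed

text \<open>The first equation of the scheme once the source has vanished, with the integral split into its
  terms.\<close>

lemma Ampere_law:
  assumes t: "real n * \<tau> \<ge> T\<^sub>J" "real n * \<tau> \<ge> T\<^sub>f" "n \<ge> 1"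
    and E: "E \<in> ND \<Omega> \<T>" "E' \<in> ND \<Omega> \<T>" "H \<in> DG \<Omega> \<T>" and v: "v \<in> ND \<Omega> \<T>"
    and sol: "solves_step \<Omega> \<T> \<tau> \<epsilon> \<mu> J b f n (E', H') (E, H)"
  shows "(1/\<tau>) * weighted_inner \<Omega> (\<epsilon> (real n * \<tau>)) (\<lambda>x. E x - E' x) v - L2_inner \<Omega> H (curl \<Omega> v)
    + L2_inner \<Omega> (\<lambda>x. current \<Omega> \<epsilon> J x (E x) (H x) (real n * \<tau>)) v + boundary_form E v = 0"
proof -
  let ?t = "real n * \<tau>"
  have tpos: "?t > 0" using t(3) \<tau> by simp
  note L = ND_L2[OF E(1)] ND_L2[OF E(2)] DG_L2[OF E(3)] ND_L2[OF v] curl_ND_L2[OF v]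
  have J: "(\<lambda>x. current \<Omega> \<epsilon> J x (E x) (H x) ?t) \<in> L2 \<Omega>"
    by (rule current_bound) (use t(1) tpos L in blast)
  have eL: "(\<lambda>x. \<epsilon> ?t x *v ((1/\<tau>) *\<^sub>R (E x - E' x))) \<in> L2 \<Omega>"
    using tpos by (intro matrix_vector_L2 permittivity_Linf L2_scaleR L2_diff L) auto
  have "(LINT x|lebesgue_on \<Omega>. (\<epsilon> ?t x *v ((1/\<tau>) *\<^sub>R (E x - E' x))) \<bullet> v x - H x \<bullet> curl \<Omega> v x
           + current \<Omega> \<epsilon> J x (E x) (H x) ?t \<bullet> v x) + boundary_form E v = 0"
    using sol v Qh_source[OF t(2)] by (simp add: solves_step_def)
  moreover have "(LINT x|lebesgue_on \<Omega>. (\<epsilon> ?t x *v ((1/\<tau>) *\<^sub>R (E x - E' x))) \<bullet> v x - H x \<bullet> curl \<Omega> v x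
           + current \<Omega> \<epsilon> J x (E x) (H x) ?t \<bullet> v x)
    = L2_inner \<Omega> (\<lambda>x. \<epsilon> ?t x *v ((1/\<tau>) *\<^sub>R (E x - E' x))) v - L2_inner \<Omega> H (curl \<Omega> v)
       + L2_inner \<Omega> (\<lambda>x. current \<Omega> \<epsilon> J x (E x) (H x) ?t) v"
    unfolding L2_inner_def
    using L2_integrable_inner[OF eL L(4)] L2_integrable_inner[OF L(3,5)] L2_integrable_inner[OF J L(4)] by simp
  moreover have "L2_inner \<Omega> (\<lambda>x. \<epsilon> ?t x *v ((1/\<tau>) *\<^sub>R (E x - E' x))) v = (1/\<tau>) * weighted_inner \<Omega> (\<epsilon> ?t) (\<lambda>x. E x - E' x) v"
    unfolding weighted_inner_def L2_inner_def
    by (simp only: matrix_vector_mult_scaleR inner_scaleR_left Bochner_Integration.integral_mult_right_zero)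
  ultimately show ?thesis by simp
qed

lemma energy_eq:
  "energy \<Omega> \<T> \<tau> \<epsilon> \<mu> n v w = 1/2 * (weighted_inner \<Omega> (\<epsilon> (real n * \<tau>)) v v + weighted_inner \<Omega> (Qh \<T> (\<mu> (real n * \<tau>))) w w)"
  by (simp add: energy_def weighted_inner_def)

section \<open>Exponential decay of the energy\<close>

text \<open>The time conditions refer to the earlier of the two time levels, so that the energies at both
  levels involve the limit permeability.\<close>

definition late_step :: "nat \<Rightarrow> field \<Rightarrow> field \<Rightarrow> field \<Rightarrow> field \<Rightarrow> bool" where
  "late_step n E' H' E H \<longleftrightarrow>
     real n * \<tau> \<ge> T\<^sub>J \<and> real n * \<tau> \<ge> T\<^sub>f \<and> real n * \<tau> \<ge> T\<^sub>\<mu> \<and>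
     E \<in> ND \<Omega> \<T> \<and> E' \<in> ND \<Omega> \<T> \<and> H \<in> DG \<Omega> \<T> \<and> H' \<in> DG \<Omega> \<T> \<and>
     solves_step \<Omega> \<T> \<tau> \<epsilon> \<mu> J b f (Suc n) (E', H') (E, H)"

text \<open>Ampere's law tested with \<open>E\<close> and Faraday's law tested with \<open>H\<close>: the curl terms cancel. The numerical
  dissipation of the magnetic field and the boundary term are nonnegative, and the coercivity
  assumption bounds the remaining terms from below by the electric field.\<close>

lemma energy_dissipation:
  obtains \<gamma> where "\<gamma> > 0"
    and "\<And>n E' H' E H. late_step n E' H' E H \<Longrightarrow>
      energy \<Omega> \<T> \<tau> \<epsilon> \<mu> (Suc n) E H \<le> energy \<Omega> \<T> \<tau> \<epsilon> \<mu> n E' H' - \<gamma> * (L2_norm \<Omega> E)\<^sup>2"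
proof -
  obtain \<gamma> where \<gamma>: "\<gamma> > 0" and coercive: "\<And>v v' n. v \<in> ND \<Omega> \<T> \<Longrightarrow> v' \<in> ND \<Omega> \<T> \<Longrightarrow> n \<ge> 1 \<Longrightarrow> real n * \<tau> \<ge> T\<^sub>J \<Longrightarrow>
        1/2 * L2_inner \<Omega> (\<lambda>x. \<epsilon> (real n * \<tau>) x *v (v x - v' x)) (\<lambda>x. v x - v' x)
        + \<tau> * L2_inner \<Omega> (\<lambda>x. current \<Omega> \<epsilon> J x (v x) 0 (real n * \<tau>)) v
        - 1/2 * L2_inner \<Omega> (\<lambda>x. (\<epsilon> (real n * \<tau>) x - \<epsilon> (real (n - 1) * \<tau>) x) *v v' x) v'
        \<ge> \<gamma> * (L2_norm \<Omega> v)\<^sup>2"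
    using B5 unfolding B5_def by blast
  have "energy \<Omega> \<T> \<tau> \<epsilon> \<mu> (Suc n) E H \<le> energy \<Omega> \<T> \<tau> \<epsilon> \<mu> n E' H' - \<gamma> * (L2_norm \<Omega> E)\<^sup>2"
    if "late_step n E' H' E H" for n E' H' E H
  proof -
    from that have t: "real n * \<tau> \<ge> T\<^sub>J" "real n * \<tau> \<ge> T\<^sub>f" "real n * \<tau> \<ge> T\<^sub>\<mu>"
      and mem: "E \<in> ND \<Omega> \<T>" "E' \<in> ND \<Omega> \<T>" "H \<in> DG \<Omega> \<T>" "H' \<in> DG \<Omega> \<T>"
      and sol: "solves_step \<Omega> \<T> \<tau> \<epsilon> \<mu> J b f (Suc n) (E', H') (E, H)"
      unfolding late_step_def by auto
    let ?t = "real (Suc n) * \<tau>" and ?s = "real n * \<tau>"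
    have ts: "?t = ?s + \<tau>" by (simp add: algebra_simps)
    have t': "?t \<ge> T\<^sub>J" "?t \<ge> T\<^sub>f" "?t > T\<^sub>\<mu>" "?t > 0" "?s \<ge> 0"
      using t \<tau> T_nonneg unfolding ts by auto
    note L = ND_L2[OF mem(1)] ND_L2[OF mem(2)] DG_L2[OF mem(3)] DG_L2[OF mem(4)]
    note dE = L2_diff[OF L(1,2)] and dH = L2_diff[OF L(3,4)]
    have \<epsilon>t: "\<epsilon> ?t \<in> Linf_sym \<Omega>" and \<epsilon>s: "\<epsilon> ?s \<in> Linf_sym \<Omega>" using t' by (auto intro: permittivity_Linf)
    note \<mu>L = Qh_Linf_sym[OF limit_permeability_Linf]
    let ?Jc = "\<lambda>x. current \<Omega> \<epsilon> J x (E x) (H x) ?t"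
    define wE where "wE = weighted_inner \<Omega> (\<epsilon> ?t)"
    define wH where "wH = weighted_inner \<Omega> \<mu>h"
    define \<delta>E where "\<delta>E = (\<lambda>x. E x - E' x)"
    define \<delta>H where "\<delta>H = (\<lambda>x. H x - H' x)"
    have ampere: "(1/\<tau>) * wE \<delta>E E - L2_inner \<Omega> H (curl \<Omega> E) + L2_inner \<Omega> ?Jc E + boundary_form E E = 0"
      unfolding wE_def \<delta>E_def using Ampere_law[OF t'(1,2) _ mem(1,2,3,1) sol] by simp
    have faraday: "wH \<delta>H H = - \<tau> * L2_inner \<Omega> H (curl \<Omega> E)"
    proof -
      have "wH \<delta>H H = L2_inner \<Omega> (\<lambda>x. - \<tau> *\<^sub>R curl \<Omega> E x) H"
        unfolding wH_def \<delta>H_def weighted_inner_def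
        using Faraday_law[OF t'(3) sol] matrix_vector_L2[OF \<mu>L dH] L2_scaleR[OF curl_ND_L2[OF mem(1)], of "- \<tau>"] L(3)
        by (intro L2_inner_cong_AE L2D(1)) auto
      also have "\<dots> = - \<tau> * L2_inner \<Omega> (curl \<Omega> E) H"
        by (simp add: L2_inner_def)
      finally show ?thesis by (simp add: L2_inner_commute)
    qed
    have "\<tau> * ((1/\<tau>) * wE \<delta>E E - L2_inner \<Omega> H (curl \<Omega> E) + L2_inner \<Omega> ?Jc E + boundary_form E E) = 0"
      unfolding ampere by simp
    then have sum: "wE \<delta>E E + wH \<delta>H H + \<tau> * L2_inner \<Omega> ?Jc E + \<tau> * boundary_form E E = 0"
      unfolding faraday using \<tau> by (simp add: algebra_simps)
    have eE: "wE \<delta>E E = 1/2 * wE E E - 1/2 * wE E' E' + 1/2 * wE \<delta>E \<delta>E"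
      unfolding wE_def \<delta>E_def by (rule weighted_inner_diff[OF \<epsilon>t L(1,2)])
    have eH: "wH \<delta>H H = 1/2 * wH H H - 1/2 * wH H' H' + 1/2 * wH \<delta>H \<delta>H"
      unfolding wH_def \<delta>H_def by (rule weighted_inner_diff[OF \<mu>L L(3,4)])
    obtain c where c: "c > 0" "AE x in lebesgue_on \<Omega>. \<forall>\<xi>. c * (norm \<xi>)\<^sup>2 \<le> \<xi> \<bullet> (\<mu>h x *v \<xi>)"
      by (rule limit_permeability_lower)
    have "c * (L2_norm \<Omega> \<delta>H)\<^sup>2 \<le> wH \<delta>H \<delta>H"
      unfolding wH_def \<delta>H_def by (rule weighted_inner_lower[OF \<mu>L dH c(2)])
    then have H0: "wH \<delta>H \<delta>H \<ge> 0" using c(1) by (meson less_imp_le mult_nonneg_nonneg order_trans zero_le_power2)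
    have B0: "\<tau> * boundary_form E E \<ge> 0" using boundary_form_nonneg[OF B3] \<tau> by simp
    \<comment> \<open>The coercivity assumption refers to the current with third argument \<open>0\<close>.\<close>
    have Jeq: "L2_inner \<Omega> ?Jc E = L2_inner \<Omega> (\<lambda>x. current \<Omega> \<epsilon> J x (E x) 0 ?t) E"
    proof -
      have "AE x in lebesgue_on \<Omega>. ?Jc x = current \<Omega> \<epsilon> J x (E x) 0 ?t"
        by (rule current_bound) (use t'(1,4) L(1,3) in blast)
      moreover have "(\<lambda>x. current \<Omega> \<epsilon> J x (E x) (w x) ?t) \<in> L2 \<Omega>" if "w \<in> L2 \<Omega>" for w
        by (rule current_bound) (use t'(1,4) L(1) that in blast)
      note this[OF L(3)] this[OF L2_zero]
      ultimately show ?thesis using L(1) by (intro L2_inner_cong_AE L2D(1)) auto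
    qed
    have "wE E' E' - weighted_inner \<Omega> (\<epsilon> ?s) E' E' = L2_inner \<Omega> (\<lambda>x. (\<epsilon> ?t x - \<epsilon> ?s x) *v E' x) E'"
      unfolding wE_def weighted_inner_def
      using L2_inner_add_scaleR_left[OF matrix_vector_L2[OF \<epsilon>t L(2)] matrix_vector_L2[OF \<epsilon>s L(2)] L(2), of "-1"]
      by (simp add: matrix_vector_mult_diff_rdistrib)
    moreover have "1/2 * wE \<delta>E \<delta>E + \<tau> * L2_inner \<Omega> ?Jc E - 1/2 * L2_inner \<Omega> (\<lambda>x. (\<epsilon> ?t x - \<epsilon> ?s x) *v E' x) E'
        \<ge> \<gamma> * (L2_norm \<Omega> E)\<^sup>2"
      using coercive[OF mem(1,2), of "Suc n"] t'(1) unfolding wE_def \<delta>E_def weighted_inner_def Jeq by simp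
    moreover have "energy \<Omega> \<T> \<tau> \<epsilon> \<mu> (Suc n) E H = 1/2 * (wE E E + wH H H)"
      unfolding energy_eq wE_def wH_def using Qh_permeability[of ?t] t'(3) by simp
    moreover have "energy \<Omega> \<T> \<tau> \<epsilon> \<mu> n E' H' = 1/2 * (weighted_inner \<Omega> (\<epsilon> ?s) E' E' + wH H' H')"
      unfolding energy_eq wH_def using Qh_permeability[of ?s] t(3) by simp
    ultimately show ?thesis using sum eE eH H0 B0 by (simp add: algebra_simps)
  qed
  then show thesis using \<gamma> that by blast
qed

text \<open>Since \<open>\<mu>h H\<close> is the curl of \<open>u\<close>, twice the magnetic energy is \<open>\<langle>H, curl u\<rangle>\<close>. Here \<open>curl u\<close> is a combination of
  the curls of fixed fields \<open>e j\<close> with coefficients bounded by \<open>|curl u|\<close>, hence by \<open>|H|\<close>. Ampere's law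
  tested with \<open>e j\<close> bounds \<open>\<langle>H, curl (e j)\<rangle>\<close> by the electric field at both time levels. Altogether
  \<open>|H|\<^sup>2\<close> is at most a multiple of \<open>|H| (|E| + |E'|)\<close>.\<close>

lemma magnetic_field_bound:
  obtains C where "C \<ge> 0"
    and "\<And>n E' H' E H u. late_step n E' H' E H \<Longrightarrow> u \<in> ND \<Omega> \<T> \<Longrightarrow>
      (AE x in lebesgue_on \<Omega>. \<mu>h x *v H x = curl \<Omega> u x) \<Longrightarrow>
      L2_norm \<Omega> H \<le> C * (L2_norm \<Omega> E + L2_norm \<Omega> E')"
proof -
  obtain M and e :: "nat \<Rightarrow> field" and C0 where C0: "C0 \<ge> 0" and e: "\<forall>j<M. e j \<in> ND \<Omega> \<T>"
    and rep: "\<forall>u\<in>ND \<Omega> \<T>. (\<forall>K\<in>\<T>. \<exists>a. AE x in lebesgue_on (interior K). curl \<Omega> u x = a) \<longrightarrow>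
      (\<exists>c. (AE x in lebesgue_on \<Omega>. curl \<Omega> u x = (\<Sum>j<M. c j *\<^sub>R curl \<Omega> (e j) x)) \<and>
           (\<forall>j<M. \<bar>c j\<bar> \<le> C0 * L2_norm \<Omega> (curl \<Omega> u)))"
    using curl_representation by (elim exE conjE)
  obtain M\<epsilon> where M\<epsilon>: "M\<epsilon> > 0" "\<And>t. t \<ge> 0 \<Longrightarrow> AE x in lebesgue_on \<Omega>. \<forall>\<eta>. norm (\<epsilon> t x *v \<eta>) \<le> M\<epsilon> * norm \<eta>"
    using permittivity_operator_bound by blast
  obtain CJ where CJ: "CJ \<ge> 0"
    "\<And>t u w. t \<ge> T\<^sub>J \<Longrightarrow> t > 0 \<Longrightarrow> u \<in> L2 \<Omega> \<Longrightarrow> w \<in> L2 \<Omega> \<Longrightarrow>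
      (\<lambda>x. current \<Omega> \<epsilon> J x (u x) (w x) t) \<in> L2 \<Omega>"
    "\<And>t u w. t \<ge> T\<^sub>J \<Longrightarrow> t > 0 \<Longrightarrow> u \<in> L2 \<Omega> \<Longrightarrow> w \<in> L2 \<Omega> \<Longrightarrow>
      AE x in lebesgue_on \<Omega>. norm (current \<Omega> \<epsilon> J x (u x) (w x) t) \<le> CJ * norm (u x)"
    by (rule current_bound) (rule that)
  obtain Cb where Cb: "Cb \<ge> 0" "\<And>u v. u \<in> ND \<Omega> \<T> \<Longrightarrow> v \<in> ND \<Omega> \<T> \<Longrightarrow> \<bar>boundary_form u v\<bar> \<le> Cb * (L2_norm \<Omega> u * L2_norm \<Omega> v)"
    using boundary_form_bounded[OF B3] by blast
  obtain c\<mu> where c\<mu>: "c\<mu> > 0" "AE x in lebesgue_on \<Omega>. \<forall>\<xi>. c\<mu> * (norm \<xi>)\<^sup>2 \<le> \<xi> \<bullet> (\<mu>h x *v \<xi>)"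
    by (rule limit_permeability_lower)
  note \<mu>L = Qh_Linf_sym[OF limit_permeability_Linf]
  define N where "N = max 0 (Linf_norm \<Omega> \<mu>h)"
  define A where "A = (1/\<tau>) * M\<epsilon> + CJ + Cb"
  have A: "A \<ge> 0" using \<tau> M\<epsilon> CJ Cb by (simp add: A_def)
  define S where "S = (\<Sum>j<M. L2_norm \<Omega> (e j))"
  have S: "S \<ge> 0" unfolding S_def by (intro sum_nonneg) simp
  have "L2_norm \<Omega> H \<le> (C0 * N * A * S / c\<mu>) * (L2_norm \<Omega> E + L2_norm \<Omega> E')"
    if step: "late_step n E' H' E H" and u: "u \<in> ND \<Omega> \<T>"
      and curl: "AE x in lebesgue_on \<Omega>. \<mu>h x *v H x = curl \<Omega> u x" for n E' H' E H u
  proof -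
    let ?t = "real (Suc n) * \<tau>" and ?a = "L2_norm \<Omega> E + L2_norm \<Omega> E'"
    from step have mem: "E \<in> ND \<Omega> \<T>" "E' \<in> ND \<Omega> \<T>" "H \<in> DG \<Omega> \<T>" "u \<in> ND \<Omega> \<T>"
      and sol: "solves_step \<Omega> \<T> \<tau> \<epsilon> \<mu> J b f (Suc n) (E', H') (E, H)"
      using u unfolding late_step_def by auto
    have "?t \<ge> real n * \<tau>" using \<tau> by (intro mult_right_mono) auto
    with step have t: "?t \<ge> T\<^sub>J" "?t \<ge> T\<^sub>f" "Suc n \<ge> 1" unfolding late_step_def by linarith+
    have tpos: "?t > 0" using \<tau> by simp
    note L = ND_L2[OF mem(1)] ND_L2[OF mem(2)] DG_L2[OF mem(3)]
    have \<epsilon>t: "\<epsilon> ?t \<in> Linf_sym \<Omega>" using tpos by (intro permittivity_Linf) simp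
    \<comment> \<open>Ampere's law bounds the magnetic field on curls.\<close>
    have test: "\<bar>L2_inner \<Omega> H (curl \<Omega> v)\<bar> \<le> A * ?a * L2_norm \<Omega> v" if v: "v \<in> ND \<Omega> \<T>" for v
    proof -
      note vL = ND_L2[OF v]
      let ?Jc = "\<lambda>x. current \<Omega> \<epsilon> J x (E x) (H x) ?t"
      have dE: "(\<lambda>x. E x - E' x) \<in> L2 \<Omega>" by (rule L2_diff[OF L(1,2)])
      have "L2_norm \<Omega> (\<lambda>x. E x + (-1) *\<^sub>R E' x) \<le> L2_norm \<Omega> E + L2_norm \<Omega> (\<lambda>x. (-1) *\<^sub>R E' x)"
        by (rule L2_triangle[OF L(1) L2_scaleR[OF L(2)]])
      then have ndE: "L2_norm \<Omega> (\<lambda>x. E x - E' x) \<le> ?a"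
        by (simp add: L2_norm_def)
      have "AE x in lebesgue_on \<Omega>. norm (\<epsilon> ?t x *v (E x - E' x)) \<le> M\<epsilon> * norm (E x - E' x)"
        using M\<epsilon>(2)[OF less_imp_le[OF tpos]] by eventually_elim blast
      then have "L2_norm \<Omega> (\<lambda>x. \<epsilon> ?t x *v (E x - E' x)) \<le> M\<epsilon> * L2_norm \<Omega> (\<lambda>x. E x - E' x)"
        using M\<epsilon>(1) by (intro L2_norm_mono dE matrix_vector_L2 \<epsilon>t) auto
      also have "\<dots> \<le> M\<epsilon> * ?a" using ndE M\<epsilon>(1) by (intro mult_left_mono) auto
      finally have n1: "L2_norm \<Omega> (\<lambda>x. \<epsilon> ?t x *v (E x - E' x)) \<le> M\<epsilon> * ?a" .
      have "\<bar>weighted_inner \<Omega> (\<epsilon> ?t) (\<lambda>x. E x - E' x) v\<bar> \<le> L2_norm \<Omega> (\<lambda>x. \<epsilon> ?t x *v (E x - E' x)) * L2_norm \<Omega> v"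
        unfolding weighted_inner_def by (rule L2_Cauchy_Schwarz[OF matrix_vector_L2[OF \<epsilon>t dE] vL])
      also have "\<dots> \<le> M\<epsilon> * ?a * L2_norm \<Omega> v" using n1 by (rule mult_right_mono) simp
      finally have "(1/\<tau>) * \<bar>weighted_inner \<Omega> (\<epsilon> ?t) (\<lambda>x. E x - E' x) v\<bar> \<le> (1/\<tau>) * (M\<epsilon> * ?a * L2_norm \<Omega> v)"
        using \<tau> by (intro mult_left_mono) auto
      moreover have "\<bar>(1/\<tau>) * weighted_inner \<Omega> (\<epsilon> ?t) (\<lambda>x. E x - E' x) v\<bar> = (1/\<tau>) * \<bar>weighted_inner \<Omega> (\<epsilon> ?t) (\<lambda>x. E x - E' x) v\<bar>"
        using \<tau> by (simp add: abs_mult)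
      ultimately have 1: "\<bar>(1/\<tau>) * weighted_inner \<Omega> (\<epsilon> ?t) (\<lambda>x. E x - E' x) v\<bar> \<le> (1/\<tau>) * M\<epsilon> * (?a * L2_norm \<Omega> v)"
        by (simp only: mult.assoc)
      have le: "L2_norm \<Omega> E * L2_norm \<Omega> v \<le> ?a * L2_norm \<Omega> v" by (intro mult_right_mono) auto
      note Jc = CJ(2,3)[OF t(1) tpos L(1,3)]
      have "\<bar>L2_inner \<Omega> ?Jc v\<bar> \<le> L2_norm \<Omega> ?Jc * L2_norm \<Omega> v"
        using Jc vL by (intro L2_Cauchy_Schwarz) auto
      also have "L2_norm \<Omega> ?Jc \<le> CJ * L2_norm \<Omega> E"
        using Jc CJ(1) by (intro L2_norm_mono L) auto
      finally have "\<bar>L2_inner \<Omega> ?Jc v\<bar> \<le> CJ * (L2_norm \<Omega> E * L2_norm \<Omega> v)"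
        by (simp add: mult.assoc mult_right_mono)
      also have "\<dots> \<le> CJ * (?a * L2_norm \<Omega> v)" using le CJ(1) by (rule mult_left_mono)
      finally have 2: "\<bar>L2_inner \<Omega> ?Jc v\<bar> \<le> CJ * (?a * L2_norm \<Omega> v)" .
      have "\<bar>boundary_form E v\<bar> \<le> Cb * (L2_norm \<Omega> E * L2_norm \<Omega> v)" by (rule Cb(2)[OF mem(1) v])
      also have "\<dots> \<le> Cb * (?a * L2_norm \<Omega> v)" using le Cb(1) by (rule mult_left_mono)
      finally have 3: "\<bar>boundary_form E v\<bar> \<le> Cb * (?a * L2_norm \<Omega> v)" .
      have "A * ?a * L2_norm \<Omega> v = (1/\<tau>) * M\<epsilon> * (?a * L2_norm \<Omega> v) + CJ * (?a * L2_norm \<Omega> v) + Cb * (?a * L2_norm \<Omega> v)"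
        unfolding A_def by (simp only: distrib_right mult.assoc)
      then show ?thesis using Ampere_law[OF t mem(1,2,3) v sol] 1 2 3 by linarith
    qed
    have "\<exists>a. AE x in lebesgue_on (interior K). curl \<Omega> u x = a" if K: "K \<in> \<T>" for K
    proof -
      obtain h where h: "\<forall>x\<in>interior K. H x = h" using mem(3) K unfolding DG_def by blast
      let ?Q = "(1 / measure lebesgue K) *\<^sub>R (LINT y|lebesgue_on (interior K). \<mu>inf y)"
      have "AE x in lebesgue_on (interior K). curl \<Omega> u x = ?Q *v h"
        using AE_interior[OF K curl]
      proof (rule lebesgue_on_mono)
        fix x assume *: "\<mu>h x *v H x = curl \<Omega> u x" and x: "x \<in> interior K"
        have "curl \<Omega> u x = \<mu>h x *v h" using * h x by simp
        then show "curl \<Omega> u x = ?Q *v h" unfolding Qh_eq[OF K x] .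
      qed
      then show ?thesis by blast
    qed
    then obtain c where c: "AE x in lebesgue_on \<Omega>. curl \<Omega> u x = (\<Sum>j<M. c j *\<^sub>R curl \<Omega> (e j) x)"
      "\<forall>j<M. \<bar>c j\<bar> \<le> C0 * L2_norm \<Omega> (curl \<Omega> u)"
      using rep mem(4) by blast
    have eL: "curl \<Omega> (e j) \<in> L2 \<Omega>" if "j < M" for j using e that curl_ND_L2 by blast
    have sum_L2: "(\<lambda>x. \<Sum>j<k. c j *\<^sub>R curl \<Omega> (e j) x) \<in> L2 \<Omega>" if "k \<le> M" for k
      using that
    proof (induction k)
      case (Suc k)
      then show ?case using L2_add_scaleR[OF _ eL[of k], of "\<lambda>x. \<Sum>j<k. c j *\<^sub>R curl \<Omega> (e j) x" "c k"] by simp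
    qed (simp add: L2_zero)
    have "AE x in lebesgue_on \<Omega>. norm (curl \<Omega> u x) \<le> N * norm (H x)"
      using curl Linf_sym_bounded[OF \<mu>L]
    proof eventually_elim
      case (elim x)
      have "norm (curl \<Omega> u x) \<le> norm (\<mu>h x) * norm (H x)"
        unfolding elim(1)[symmetric] by (rule norm_matrix_vector_le)
      also have "\<dots> \<le> N * norm (H x)" using elim(2) by (intro mult_right_mono) (auto simp: N_def)
      finally show ?case .
    qed
    then have nu: "L2_norm \<Omega> (curl \<Omega> u) \<le> N * L2_norm \<Omega> H"
      by (intro L2_norm_mono L curl_ND_L2 mem) (auto simp: N_def)
    have "c\<mu> * (L2_norm \<Omega> H)\<^sup>2 \<le> weighted_inner \<Omega> \<mu>h H H"
      by (rule weighted_inner_lower[OF \<mu>L L(3) c\<mu>(2)])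
    also have "\<dots> = L2_inner \<Omega> (\<lambda>x. \<Sum>j<M. c j *\<^sub>R curl \<Omega> (e j) x) H"
      unfolding weighted_inner_def
    proof (rule L2_inner_cong_AE)
      show "AE x in lebesgue_on \<Omega>. \<mu>h x *v H x = (\<Sum>j<M. c j *\<^sub>R curl \<Omega> (e j) x)"
        using curl c(1) by eventually_elim simp
    qed (intro AE_I2 refl L2D(1) matrix_vector_L2[OF \<mu>L] L(3) sum_L2 order_refl)+
    also have "\<dots> = (\<Sum>j<M. c j * L2_inner \<Omega> (curl \<Omega> (e j)) H)"
      by (rule L2_inner_sum_left[OF eL L(3)])
    also have "\<dots> \<le> (\<Sum>j<M. (C0 * N * L2_norm \<Omega> H) * (A * ?a * L2_norm \<Omega> (e j)))"
    proof (rule sum_mono)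
      fix j assume "j \<in> {..<M}"
      then have j: "j < M" by simp
      have "\<bar>c j\<bar> \<le> C0 * N * L2_norm \<Omega> H"
        using c(2) j mult_left_mono[OF nu C0] by (auto simp: mult.assoc intro: order_trans)
      moreover have "\<bar>L2_inner \<Omega> (curl \<Omega> (e j)) H\<bar> \<le> A * ?a * L2_norm \<Omega> (e j)"
        using test[of "e j"] e j by (simp add: L2_inner_commute)
      ultimately have prod: "\<bar>c j\<bar> * \<bar>L2_inner \<Omega> (curl \<Omega> (e j)) H\<bar> \<le> (C0 * N * L2_norm \<Omega> H) * (A * ?a * L2_norm \<Omega> (e j))"
        using C0 by (intro mult_mono) (auto simp: N_def)
      have "c j * L2_inner \<Omega> (curl \<Omega> (e j)) H \<le> \<bar>c j\<bar> * \<bar>L2_inner \<Omega> (curl \<Omega> (e j)) H\<bar>"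
        by (simp flip: abs_mult)
      then show "c j * L2_inner \<Omega> (curl \<Omega> (e j)) H \<le> (C0 * N * L2_norm \<Omega> H) * (A * ?a * L2_norm \<Omega> (e j))"
        using prod by (rule order_trans)
    qed
    also have "\<dots> = (C0 * N * A * S * ?a) * L2_norm \<Omega> H"
      unfolding S_def by (simp add: sum_distrib_left mult.assoc mult.left_commute mult.commute)
    finally have main: "c\<mu> * (L2_norm \<Omega> H)\<^sup>2 \<le> (C0 * N * A * S * ?a) * L2_norm \<Omega> H" .
    show ?thesis
    proof (cases "L2_norm \<Omega> H = 0")
      case True
      then show ?thesis using C0 A S c\<mu>(1) by (simp add: N_def)
    next
      case False
      then have "L2_norm \<Omega> H > 0" by (simp add: order_less_le)
      moreover have "(c\<mu> * L2_norm \<Omega> H) * L2_norm \<Omega> H \<le> (C0 * N * A * S * ?a) * L2_norm \<Omega> H"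
        using main by (simp add: power2_eq_square mult.assoc)
      ultimately have "c\<mu> * L2_norm \<Omega> H \<le> C0 * N * A * S * ?a" by (rule mult_right_le_imp_le[rotated])
      then show ?thesis using c\<mu>(1) by (simp add: pos_le_divide_eq mult.commute mult.left_commute)
    qed
  qed
  moreover have "C0 * N * A * S / c\<mu> \<ge> 0" using C0 A S c\<mu>(1) by (simp add: N_def)
  ultimately show thesis using that by blast
qed

text \<open>Faraday's law changes \<open>\<mu>h H\<close> by a multiple of the curl of the electric field.\<close>

lemma magnetic_flux_invariant:
  assumes t: "real n * \<tau> > T\<^sub>\<mu>" and sol: "solves_step \<Omega> \<T> \<tau> \<epsilon> \<mu> J b f n (E', H') (E, H)"
    and E: "E \<in> ND \<Omega> \<T>" and u: "u \<in> ND \<Omega> \<T>" "AE x in lebesgue_on \<Omega>. \<mu>h x *v H' x = curl \<Omega> u x"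
  shows "\<exists>u\<in>ND \<Omega> \<T>. AE x in lebesgue_on \<Omega>. \<mu>h x *v H x = curl \<Omega> u x"
proof (rule bexI)
  show "(\<lambda>x. u x + (- \<tau>) *\<^sub>R E x) \<in> ND \<Omega> \<T>" by (rule ND_add_scaleR[OF u(1) E])
  show "AE x in lebesgue_on \<Omega>. \<mu>h x *v H x = curl \<Omega> (\<lambda>x. u x + (- \<tau>) *\<^sub>R E x) x"
    using Faraday_law[OF t sol] u(2) curl_add_scaleR[OF open_domain bounded_domain ND_Hcurl[OF u(1)] ND_Hcurl[OF E], of "- \<tau>"]
  proof eventually_elim
    case (elim x)
    have "\<mu>h x *v H x = \<mu>h x *v (H x - H' x) + \<mu>h x *v H' x"
      by (simp add: matrix_vector_mult_diff_distrib)
    then show ?case using elim by simp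
  qed
qed

text \<open>The elementwise mean of the permeability is positive definite and thus invertible.\<close>

lemma Wh_flux:
  assumes "(E, H) \<in> Wh \<Omega> \<T> \<mu>inf"
  shows "\<exists>u\<in>ND \<Omega> \<T>. AE x in lebesgue_on \<Omega>. \<mu>h x *v H x = curl \<Omega> u x"
proof -
  obtain u where u: "u \<in> ND \<Omega> \<T>" "AE x in lebesgue_on \<Omega>. H x = matrix_inv (\<mu>h x) *v curl \<Omega> u x"
    using assms unfolding Wh_def by blast
  obtain c where c: "c > 0" "AE x in lebesgue_on \<Omega>. \<forall>\<xi>. c * (norm \<xi>)\<^sup>2 \<le> \<xi> \<bullet> (\<mu>h x *v \<xi>)"
    by (rule limit_permeability_lower)
  have "AE x in lebesgue_on \<Omega>. \<mu>h x *v H x = curl \<Omega> u x"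
    using u(2) c(2)
  proof eventually_elim
    case (elim x)
    have "\<xi> = 0" if "\<mu>h x *v \<xi> = 0" for \<xi>
      using elim(2)[rule_format, of \<xi>] c(1) that by (simp add: mult_le_0_iff)
    then have "\<exists>B. B ** \<mu>h x = mat 1" by (simp add: matrix_left_invertible_ker)
    then have "invertible (\<mu>h x)" by (simp add: invertible_left_inverse)
    then have "\<mu>h x ** matrix_inv (\<mu>h x) = mat 1"
      using someI_ex[of "\<lambda>B. \<mu>h x ** B = mat 1 \<and> B ** \<mu>h x = mat 1"]
      unfolding invertible_def matrix_inv_def by blast
    then show ?case unfolding elim(1) by (simp add: matrix_vector_mul_assoc)
  qed
  with u(1) show ?thesis by blast
qed

text \<open>The index \<open>k\<close> is where membership in the invariant subspace is known: any time level from which on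
  the permeability is constant. The electric energies of two consecutive levels bound the total
  energy, and at the same time they are bounded by the energy lost during these two steps.\<close>

lemma energy_decay:
  fixes E H :: "nat \<Rightarrow> field"
  assumes mem: "\<And>n. E n \<in> ND \<Omega> \<T>" "\<And>n. H n \<in> DG \<Omega> \<T>"
    and sol: "\<And>n. solves_step \<Omega> \<T> \<tau> \<epsilon> \<mu> J b f (Suc n) (E n, H n) (E (Suc n), H (Suc n))"
    and m: "real m * \<tau> \<ge> T\<^sub>J" "real m * \<tau> \<ge> T\<^sub>f" "real m * \<tau> \<ge> T\<^sub>\<mu>"
    and k: "k \<le> m" "real k * \<tau> \<ge> T\<^sub>\<mu>" and W: "(E k, H k) \<in> Wh \<Omega> \<T> \<mu>inf"
  shows "decays_exponentially \<tau> (\<lambda>n. energy \<Omega> \<T> \<tau> \<epsilon> \<mu> n (E n) (H n))"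
proof -
  let ?e = "\<lambda>n. energy \<Omega> \<T> \<tau> \<epsilon> \<mu> n (E n) (H n)" and ?a = "\<lambda>n. L2_norm \<Omega> (E n)"
  have flux: "\<exists>u\<in>ND \<Omega> \<T>. AE x in lebesgue_on \<Omega>. \<mu>h x *v H n x = curl \<Omega> u x" if "n \<ge> k" for n
    using that
  proof (induction n rule: dec_induct)
    case base
    show ?case by (rule Wh_flux[OF W])
  next
    case (step n)
    have "real k * \<tau> < real (Suc n) * \<tau>" using step(1) \<tau> by (intro mult_strict_right_mono) auto
    with k(2) have "real (Suc n) * \<tau> > T\<^sub>\<mu>" by simp
    with step.IH show ?case using magnetic_flux_invariant[OF _ sol mem(1)] by blast
  qed
  have time: "real n * \<tau> \<ge> T\<^sub>J" "real n * \<tau> \<ge> T\<^sub>f" "real n * \<tau> \<ge> T\<^sub>\<mu>" "real n * \<tau> \<ge> 0" if "n \<ge> m" for n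
  proof -
    have "real m * \<tau> \<le> real n * \<tau>" using that \<tau> by (intro mult_right_mono) auto
    then show "real n * \<tau> \<ge> T\<^sub>J" "real n * \<tau> \<ge> T\<^sub>f" "real n * \<tau> \<ge> T\<^sub>\<mu>" using m by linarith+
    show "real n * \<tau> \<ge> 0" using \<tau> by simp
  qed
  have late: "late_step n (E n) (H n) (E (Suc n)) (H (Suc n))" if "n \<ge> m" for n
    unfolding late_step_def using time[OF that] mem sol by auto
  obtain \<gamma> where \<gamma>: "\<gamma> > 0" and dissip: "\<And>n. n \<ge> m \<Longrightarrow> ?e (Suc n) \<le> ?e n - \<gamma> * (?a (Suc n))\<^sup>2"
    using energy_dissipation late by metis
  obtain C where C: "C \<ge> 0" and HE: "\<And>n. n \<ge> m \<Longrightarrow> L2_norm \<Omega> (H (Suc n)) \<le> C * (?a (Suc n) + ?a n)"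
  proof (rule magnetic_field_bound)
    fix C :: real assume C: "C \<ge> 0" and *: "\<And>n E' H' E H u. late_step n E' H' E H \<Longrightarrow> u \<in> ND \<Omega> \<T> \<Longrightarrow>
      (AE x in lebesgue_on \<Omega>. \<mu>h x *v H x = curl \<Omega> u x) \<Longrightarrow> L2_norm \<Omega> H \<le> C * (L2_norm \<Omega> E + L2_norm \<Omega> E')"
    show thesis
    proof (rule that[OF C])
      fix n assume n: "m \<le> n"
      then have "k \<le> Suc n" using k(1) by simp
      then show "L2_norm \<Omega> (H (Suc n)) \<le> C * (?a (Suc n) + ?a n)"
        using flux *[OF late[OF n]] by blast
    qed
  qed
  obtain \<epsilon>l \<epsilon>u \<mu>u where pos: "\<epsilon>l > 0" "\<epsilon>u > 0" "\<mu>u > 0"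
    and \<epsilon>low: "\<And>t. t \<ge> 0 \<Longrightarrow> AE x in lebesgue_on \<Omega>. \<forall>\<xi>. \<epsilon>l * (norm \<xi>)\<^sup>2 \<le> \<xi> \<bullet> (\<epsilon> t x *v \<xi>)"
    and \<epsilon>up: "\<And>t. t \<ge> 0 \<Longrightarrow> AE x in lebesgue_on \<Omega>. \<forall>\<xi>. \<xi> \<bullet> (\<epsilon> t x *v \<xi>) \<le> \<epsilon>u * (norm \<xi>)\<^sup>2"
    and \<mu>up: "\<And>t. t \<ge> 0 \<Longrightarrow> AE x in lebesgue_on \<Omega>. \<forall>\<xi>. \<xi> \<bullet> (\<mu> t x *v \<xi>) \<le> \<mu>u * (norm \<xi>)\<^sup>2"
    by (rule coefficient_bounds) (rule that)
  obtain c where c: "c > 0" "AE x in lebesgue_on \<Omega>. \<forall>\<xi>. c * (norm \<xi>)\<^sup>2 \<le> \<xi> \<bullet> (\<mu>h x *v \<xi>)"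
    by (rule limit_permeability_lower)
  have e_eq: "?e n = 1/2 * (weighted_inner \<Omega> (\<epsilon> (real n * \<tau>)) (E n) (E n) + weighted_inner \<Omega> \<mu>h (H n) (H n))" if "n \<ge> m" for n
    unfolding energy_eq using Qh_permeability[OF time(3)[OF that]] by simp
  note EL = ND_L2[OF mem(1)] and HL = DG_L2[OF mem(2)] and \<mu>L = Qh_Linf_sym[OF limit_permeability_Linf]
  have nonneg: "?e n \<ge> 0" if n: "n \<ge> m" for n
  proof -
    have "\<epsilon>l * (?a n)\<^sup>2 \<le> weighted_inner \<Omega> (\<epsilon> (real n * \<tau>)) (E n) (E n)"
      by (intro weighted_inner_lower permittivity_Linf EL \<epsilon>low time(4)[OF n])
    moreover have "c * (L2_norm \<Omega> (H n))\<^sup>2 \<le> weighted_inner \<Omega> \<mu>h (H n) (H n)"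
      by (intro weighted_inner_lower \<mu>L HL c)
    moreover have "\<epsilon>l * (?a n)\<^sup>2 \<ge> 0" "c * (L2_norm \<Omega> (H n))\<^sup>2 \<ge> 0" using pos c by auto
    ultimately show ?thesis unfolding e_eq[OF n] by simp
  qed
  have "AE x in lebesgue_on \<Omega>. \<forall>\<xi>. \<xi> \<bullet> (Qh \<T> (\<mu> (real m * \<tau>)) x *v \<xi>) \<le> \<mu>u * (norm \<xi>)\<^sup>2"
    using AE_in_element
    by eventually_elim (use Qh_upper[OF permeability_Linf[OF time(4)] _ _ \<mu>up[OF time(4)]] in blast)
  then have \<mu>hup: "AE x in lebesgue_on \<Omega>. \<forall>\<xi>. \<xi> \<bullet> (\<mu>h x *v \<xi>) \<le> \<mu>u * (norm \<xi>)\<^sup>2"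
    unfolding Qh_permeability[OF m(3)] .
  \<comment> \<open>The second term bounds the magnetic energy, by \<open>(x + y)\<^sup>2 \<le> 2 (x\<^sup>2 + y\<^sup>2)\<close>.\<close>
  define B where "B = \<epsilon>u + 2 * \<mu>u * C\<^sup>2"
  have B: "B > 0" using pos by (simp add: B_def add_pos_nonneg)
  have upper: "?e (Suc n) \<le> B * ((?a (Suc n))\<^sup>2 + (?a n)\<^sup>2)" if n: "n \<ge> m" for n
  proof -
    have n': "Suc n \<ge> m" using n by simp
    have "weighted_inner \<Omega> (\<epsilon> (real (Suc n) * \<tau>)) (E (Suc n)) (E (Suc n)) \<le> \<epsilon>u * (?a (Suc n))\<^sup>2"
      by (intro weighted_inner_upper permittivity_Linf EL \<epsilon>up time(4)[OF n'])
    also have "\<dots> \<le> \<epsilon>u * ((?a (Suc n))\<^sup>2 + (?a n)\<^sup>2)" using pos by (intro mult_left_mono) auto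
    finally have 1: "weighted_inner \<Omega> (\<epsilon> (real (Suc n) * \<tau>)) (E (Suc n)) (E (Suc n)) \<le> \<epsilon>u * ((?a (Suc n))\<^sup>2 + (?a n)\<^sup>2)" .
    have "weighted_inner \<Omega> \<mu>h (H (Suc n)) (H (Suc n)) \<le> \<mu>u * (L2_norm \<Omega> (H (Suc n)))\<^sup>2"
      by (intro weighted_inner_upper \<mu>L HL \<mu>hup)
    also have "(L2_norm \<Omega> (H (Suc n)))\<^sup>2 \<le> (C * (?a (Suc n) + ?a n))\<^sup>2"
      using HE[OF n] by (rule power_mono) simp
    also have "\<dots> = C\<^sup>2 * (?a (Suc n) + ?a n)\<^sup>2" by (rule power_mult_distrib)
    also have "(?a (Suc n) + ?a n)\<^sup>2 \<le> 2 * ((?a (Suc n))\<^sup>2 + (?a n)\<^sup>2)"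
      using sum_squares_bound[of "?a (Suc n)" "?a n"] by (simp add: power2_sum)
    finally have 2: "weighted_inner \<Omega> \<mu>h (H (Suc n)) (H (Suc n)) \<le> \<mu>u * (C\<^sup>2 * (2 * ((?a (Suc n))\<^sup>2 + (?a n)\<^sup>2)))"
      using pos by (simp add: mult_left_mono)
    have "B * ((?a (Suc n))\<^sup>2 + (?a n)\<^sup>2) = \<epsilon>u * ((?a (Suc n))\<^sup>2 + (?a n)\<^sup>2) + \<mu>u * (C\<^sup>2 * (2 * ((?a (Suc n))\<^sup>2 + (?a n)\<^sup>2)))"
      by (simp add: B_def algebra_simps)
    then have "2 * ?e (Suc n) \<le> B * ((?a (Suc n))\<^sup>2 + (?a n)\<^sup>2)" unfolding e_eq[OF n'] using 1 2 by simp
    with nonneg[OF n'] show ?thesis by linarith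
  qed
  show ?thesis
  proof (rule decays_exponentially_if_two_step_contraction[OF \<tau>])
    \<comment> \<open>The contraction factor results from \<open>e (n + 2) \<le> (B / \<gamma>) (e n - e (n + 2))\<close>.\<close>
    show "0 < B / (B + \<gamma>)" "B / (B + \<gamma>) < 1" using B \<gamma> by auto
    show "?e n \<ge> 0" if "n \<ge> m" for n using nonneg[OF that] .
    show decr: "?e (Suc n) \<le> ?e n" if "n \<ge> m" for n
    proof -
      have "\<gamma> * (?a (Suc n))\<^sup>2 \<ge> 0" using \<gamma> by simp
      with dissip[OF that] show ?thesis by linarith
    qed
    show "?e (Suc (Suc n)) \<le> B / (B + \<gamma>) * ?e n" if n: "n \<ge> m" for n
    proof -
      have n': "Suc n \<ge> m" using n by simp
      let ?s = "(?a (Suc (Suc n)))\<^sup>2 + (?a (Suc n))\<^sup>2"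
      have "\<gamma> * ?s \<le> ?e n - ?e (Suc (Suc n))"
        using dissip[OF n] dissip[OF n'] by (simp add: distrib_left)
      then have "B * (\<gamma> * ?s) \<le> B * (?e n - ?e (Suc (Suc n)))" using B by (intro mult_left_mono) auto
      moreover have "\<gamma> * ?e (Suc (Suc n)) \<le> \<gamma> * (B * ?s)" using upper[OF n'] \<gamma> by (intro mult_left_mono) auto
      moreover have "B * (\<gamma> * ?s) = \<gamma> * (B * ?s)" by (rule mult.left_commute)
      ultimately have "(B + \<gamma>) * ?e (Suc (Suc n)) \<le> B * ?e n"
        by (simp only: distrib_right right_diff_distrib)
      then show ?thesis using B \<gamma> by (simp add: pos_le_divide_eq mult.commute)
    qed
  qed
qed

end

theorem corollary3p14:
  fixes \<Omega> :: "vec3 set" and M :: "real set" and \<T> :: "real \<Rightarrow> vec3 set set"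
    and h \<tau> T\<^sub>\<mu> T\<^sub>J T\<^sub>f :: real
    and \<epsilon> \<mu> :: "real \<Rightarrow> vec3 \<Rightarrow> mat3" and \<mu>inf :: "vec3 \<Rightarrow> mat3"
    and J\<^sub>t\<^sub>o\<^sub>t :: "vec3 \<Rightarrow> vec3 \<Rightarrow> vec3 \<Rightarrow> real \<Rightarrow> vec3"
    and b :: "vec3 \<Rightarrow> vec3 \<Rightarrow> vec3" and f :: "real \<Rightarrow> field"
    and E H :: "nat \<Rightarrow> field" and m :: nat
  assumes "lipschitz_polyhedral_domain \<Omega>"
    and "quasi_uniform_family \<Omega> M \<T>" and "h \<in> M" and "h > 0" and "\<tau> > 0"
    and "B1 \<Omega> \<epsilon> \<mu> \<mu>inf T\<^sub>\<mu>"
    and "B2 \<Omega> J\<^sub>t\<^sub>o\<^sub>t T\<^sub>J"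
    and "B3 \<Omega> b"
    and "B4 \<Omega> f T\<^sub>f"
    and "B5 \<Omega> (\<T> h) \<tau> \<epsilon> J\<^sub>t\<^sub>o\<^sub>t T\<^sub>J"
    and "well_posed \<Omega> (\<T> h) \<tau> \<epsilon> \<mu> J\<^sub>t\<^sub>o\<^sub>t b f"
    and "(E 0, H 0) \<in> ND \<Omega> (\<T> h) \<times> DG \<Omega> (\<T> h)"
    and "\<And>n. n \<ge> 1 \<Longrightarrow>
           (E n, H n) = solution_op \<Omega> (\<T> h) \<tau> \<epsilon> \<mu> J\<^sub>t\<^sub>o\<^sub>t b f n (E (n - 1), H (n - 1))"
    and "m = (LEAST n. real n * \<tau> \<ge> Max {T\<^sub>J, T\<^sub>f, T\<^sub>\<mu>})"
  shows "((E m, H m) \<in> Wh \<Omega> (\<T> h) \<mu>inf \<longrightarrow>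
            decays_exponentially \<tau> (\<lambda>n. energy \<Omega> (\<T> h) \<tau> \<epsilon> \<mu> n (E n) (H n)))
       \<and> (T\<^sub>\<mu> = 0 \<and> (E 0, H 0) \<in> Wh \<Omega> (\<T> h) \<mu>inf \<longrightarrow>
            decays_exponentially \<tau> (\<lambda>n. energy \<Omega> (\<T> h) \<tau> \<epsilon> \<mu> n (E n) (H n)))"
proof -
  have "tetrahedral_mesh \<Omega> (\<T> h)"
    using assms(2,3) unfolding quasi_uniform_family_def by blast
  then interpret maxwell_scheme \<Omega> "\<T> h" \<tau> T\<^sub>\<mu> T\<^sub>J T\<^sub>f \<epsilon> \<mu> \<mu>inf J\<^sub>t\<^sub>o\<^sub>t b f
    using assms(1,5-10) unfolding lipschitz_polyhedral_domain_def by unfold_locales auto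
  have step: "(E (Suc n), H (Suc n)) \<in> ND \<Omega> (\<T> h) \<times> DG \<Omega> (\<T> h) \<and>
      solves_step \<Omega> (\<T> h) \<tau> \<epsilon> \<mu> J\<^sub>t\<^sub>o\<^sub>t b f (Suc n) (E n, H n) (E (Suc n), H (Suc n))"
    if "(E n, H n) \<in> ND \<Omega> (\<T> h) \<times> DG \<Omega> (\<T> h)" for n
  proof -
    have "\<exists>!q. q \<in> ND \<Omega> (\<T> h) \<times> DG \<Omega> (\<T> h) \<and> solves_step \<Omega> (\<T> h) \<tau> \<epsilon> \<mu> J\<^sub>t\<^sub>o\<^sub>t b f (Suc n) (E n, H n) q"
      using assms(11) that unfolding well_posed_def by simp
    from theI'[OF this] show ?thesis
      using assms(13)[of "Suc n"] by (simp add: solution_op_def)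
  qed
  have mem: "(E n, H n) \<in> ND \<Omega> (\<T> h) \<times> DG \<Omega> (\<T> h)" for n
    by (induction n) (use assms(12) step in blast)+
  have "\<exists>n::nat. real n * \<tau> \<ge> Max {T\<^sub>J, T\<^sub>f, T\<^sub>\<mu>}"
  proof -
    obtain n :: nat where "real n \<ge> Max {T\<^sub>J, T\<^sub>f, T\<^sub>\<mu>} / \<tau>" using real_arch_simple by blast
    then show ?thesis using assms(5) by (intro exI[of _ n]) (simp only: pos_divide_le_eq)
  qed
  then have "real m * \<tau> \<ge> Max {T\<^sub>J, T\<^sub>f, T\<^sub>\<mu>}"
    unfolding assms(14) by (rule LeastI_ex)
  then have m: "real m * \<tau> \<ge> T\<^sub>J" "real m * \<tau> \<ge> T\<^sub>f" "real m * \<tau> \<ge> T\<^sub>\<mu>"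
    by simp_all
  have decay: "decays_exponentially \<tau> (\<lambda>n. energy \<Omega> (\<T> h) \<tau> \<epsilon> \<mu> n (E n) (H n))"
    if "k \<le> m" "real k * \<tau> \<ge> T\<^sub>\<mu>" "(E k, H k) \<in> Wh \<Omega> (\<T> h) \<mu>inf" for k
    using energy_decay[of E H m k] mem step[OF mem] m that by simp
  show ?thesis
    using decay[of m] decay[of 0] m(3) by auto
qed

end
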